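(* For $\tau\in\mathbb H$ (the upper half-plane) let $q:=e^{2\pi i\tau}$ and $$G(q):=\sum_{n\ge 0}\frac{q^{n^2}}{(q;q)_n},\qquad H(q):=\sum_{n\ge 0}\frac{q^{n(n+1)}}{(q;q)_n},$$ $$f_1(\tau):=q^{-1/60}G(q),\qquad f_2(\tau):=q^{11/60}H(q).$$ Then the pair $\mathbf f=(f_1,f_2)^{\mathsf T}$ is a two-dimensional vector-valued modular function of level $5$. In particular, for all $\tau\in\mathbb H$, $$\mathbf f(\tau+1)=\rho(T)\,\mathbf f(\tau)\qquad\text{and}\qquad \mathbf f\!\left(-\frac1\tau\right)=\rho(S)\,\mathbf f(\tau),$$ with constant multiplier matrices $$\rho(T)=\begin{pmatrix} e^{-2\pi i/60} & 0\\ 0 & e^{11\cdot 2\pi i/60}\end{pmatrix}\qquad\text{and}\qquad \rho(S)=\frac{2}{\sqrt5}\begin{pmatrix}\sin\left(\tfrac{2\pi}{5}\right) & \sin\left(\tfrac{\pi}{5}\right)\\ \sin\left(\tfrac{\pi}{5}\right) & -\sin\left(\tfrac{2\pi}{5}\right)\end{pmatrix}.$$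
   Context: Notation: $(a;q)_n:=\prod_{j=0}^{n-1}(1-aq^j)$. Fractional powers are $q^{\alpha}:=e^{2\pi i\alpha\tau}$. The standard generators of $\mathrm{SL}_2(\mathbb Z)$ are $T=\begin{pmatrix}1&1\\0&1\end{pmatrix}$ and $S=\begin{pmatrix}0&-1\\1&0\end{pmatrix}$, and $\mathrm{SL}_2(\mathbb Z)$ acts on $\mathbb H$ by fractional linear transformations. An $r$-dimensional level $N$ vector-valued modular function $\mathbf f=(f_1,\dots,f_r)^{\mathsf T}$ is a function on $\mathbb H$ with a multiplier representation $\rho:\mathrm{SL}_2(\mathbb Z)\to\mathrm{GL}_r(\mathbb C)$ that factors through a congruence quotient of level $N$ (i.e. through $\mathrm{SL}_2(\mathbb Z/N\mathbb Z)$), for which $\mathbf f(\gamma\tau)=\rho(\gamma)\mathbf f(\tau)$ for all $\gamma\in\mathrm{SL}_2(\mathbb Z)$ and $\tau\in\mathbb H$.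
   Formalization: "Level 5" is read up to a character: ρ is a congruence character of SL₂(ℤ) times a representation factoring through SL₂(ℤ/5ℤ), because ρ(T)⁵ = e^{-2πi/12}·I ≠ I although T⁵ ≡ I mod 5, so ρ itself does not factor through SL₂(ℤ/5ℤ). *)

theory Defs
  imports "HOL-Analysis.Analysis" "HOL-Algebra.Group"
begin

subsection \<open>Groups\<close>

definition SL2Z :: "(int^2^2) monoid" where
  "SL2Z = \<lparr>carrier = {A. det A = 1}, mult = (**), one = mat 1\<rparr>"

definition reduce_mod :: "nat \<Rightarrow> int^2^2 \<Rightarrow> int^2^2" where
  "reduce_mod N A = (\<chi> i j. (A $ i $ j) mod int N)"

text \<open>$\mathrm{SL}_2(\mathbb Z/N\mathbb Z)$ for $N \ge 1$, with residue classes represented by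
  their least nonnegative representatives.\<close>

definition SL2_mod :: "nat \<Rightarrow> (int^2^2) monoid" where
  "SL2_mod N =
     \<lparr>carrier = {A. (\<forall>i j. A $ i $ j \<in> {0..<int N}) \<and> det A mod int N = 1 mod int N},
      mult = (\<lambda>A B. reduce_mod N (A ** B)), one = reduce_mod N (mat 1)\<rparr>"

definition GL :: "(complex^'r^'r) monoid" where
  "GL = \<lparr>carrier = {A. invertible A}, mult = (**), one = mat 1\<rparr>"

definition complex_mult_group :: "complex monoid" where
  "complex_mult_group = \<lparr>carrier = UNIV - {0}, mult = (*), one = 1\<rparr>"

definition mat_T :: "int^2^2" where
  "mat_T = vector [vector [1, 1], vector [0, 1]]"

definition mat_S :: "int^2^2" where
  "mat_S = vector [vector [0, -1], vector [1, 0]]"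

subsection \<open>Vector-valued modular functions\<close>

definition upper_half_plane :: "complex set" where
  "upper_half_plane = {\<tau>. Im \<tau> > 0}"

definition moebius_act :: "int^2^2 \<Rightarrow> complex \<Rightarrow> complex" where
  "moebius_act \<gamma> \<tau> =
     (of_int (\<gamma> $ 1 $ 1) * \<tau> + of_int (\<gamma> $ 1 $ 2)) /
     (of_int (\<gamma> $ 2 $ 1) * \<tau> + of_int (\<gamma> $ 2 $ 2))"

definition factors_through_SL2_mod ::
    "('g, 'm) monoid_scheme \<Rightarrow> nat \<Rightarrow> (int^2^2 \<Rightarrow> 'g) \<Rightarrow> bool" where
  "factors_through_SL2_mod G N \<rho> \<longleftrightarrow>
     (\<exists>\<sigma> \<in> hom (SL2_mod N) G. \<forall>\<gamma> \<in> carrier SL2Z. \<rho> \<gamma> = \<sigma> (reduce_mod N \<gamma>))"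

text \<open>
  The level of a multiplier representation is understood up to a one-dimensional congruence
  character of $\mathrm{SL}_2(\mathbb Z)$: $\rho = \psi \otimes \rho'$, where $\rho'$ factors
  through $\mathrm{SL}_2(\mathbb Z/N\mathbb Z)$.  The character cannot be dropped for the
  Rogers--Ramanujan pair at $N = 5$: there $\rho(T)^5 = e^{-2\pi i/12} I \neq I$ although
  $T^5 \equiv I$ modulo $5$, so $\rho$ itself does not factor through
  $\mathrm{SL}_2(\mathbb Z/5\mathbb Z)$.
\<close>

definition has_level :: "nat \<Rightarrow> (int^2^2 \<Rightarrow> complex^'r^'r) \<Rightarrow> bool" where
  "has_level N \<rho> \<longleftrightarrow>
     (\<exists>\<psi> \<rho>'. (\<exists>M>0. factors_through_SL2_mod complex_mult_group M \<psi>) \<and>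
             factors_through_SL2_mod GL N \<rho>' \<and>
             (\<forall>\<gamma> \<in> carrier SL2Z. \<rho> \<gamma> = mat (\<psi> \<gamma>) ** \<rho>' \<gamma>))"

definition vv_modular_function ::
    "nat \<Rightarrow> (int^2^2 \<Rightarrow> complex^'r^'r) \<Rightarrow> (complex \<Rightarrow> complex^'r) \<Rightarrow> bool" where
  "vv_modular_function N \<rho> f \<longleftrightarrow>
     \<rho> \<in> hom SL2Z GL \<and> has_level N \<rho> \<and>
     (\<forall>\<gamma> \<in> carrier SL2Z. \<forall>\<tau> \<in> upper_half_plane. f (moebius_act \<gamma> \<tau>) = \<rho> \<gamma> *v f \<tau>)"

subsection \<open>The Rogers--Ramanujan functions\<close>

definition q_pochhammer :: "complex \<Rightarrow> complex \<Rightarrow> nat \<Rightarrow> complex" where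
  "q_pochhammer a q n = (\<Prod>j<n. 1 - a * q ^ j)"

definition rr_G :: "complex \<Rightarrow> complex" where
  "rr_G q = (\<Sum>n. q ^ (n\<^sup>2) / q_pochhammer q q n)"

definition rr_H :: "complex \<Rightarrow> complex" where
  "rr_H q = (\<Sum>n. q ^ (n * (n + 1)) / q_pochhammer q q n)"

text \<open>The power $q^\alpha$ as a function of $\tau$; the nome itself is \<open>q_power 1 \<tau>\<close>.\<close>

definition q_power :: "real \<Rightarrow> complex \<Rightarrow> complex" where
  "q_power \<alpha> \<tau> = exp (2 * of_real pi * \<i> * of_real \<alpha> * \<tau>)"

definition rr_f1 :: "complex \<Rightarrow> complex" where
  "rr_f1 \<tau> = q_power (- 1 / 60) \<tau> * rr_G (q_power 1 \<tau>)"

definition rr_f2 :: "complex \<Rightarrow> complex" where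
  "rr_f2 \<tau> = q_power (11 / 60) \<tau> * rr_H (q_power 1 \<tau>)"

definition rr_vec :: "complex \<Rightarrow> complex^2" where
  "rr_vec \<tau> = vector [rr_f1 \<tau>, rr_f2 \<tau>]"

definition rr_rho_T :: "complex^2^2" where
  "rr_rho_T = vector [vector [exp (- (2 * of_real pi * \<i> / 60)), 0],
                      vector [0, exp (11 * (2 * of_real pi * \<i> / 60))]]"

definition rr_rho_S :: "complex^2^2" where
  "rr_rho_S =
     mat (of_real (2 / sqrt 5)) **
     vector [vector [of_real (sin (2 * pi / 5)), of_real (sin (pi / 5))],
             vector [of_real (sin (pi / 5)), - of_real (sin (2 * pi / 5))]]"

end

theory Submission
  imports
    Defs
    "HOL-Complex_Analysis.Conformal_Mappings"
    "HOL-Real_Asymp.Real_Asymp"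
    "HOL-Number_Theory.Cong"
begin

text \<open>
  Two applications of the Bailey lemma to the unit Bailey pair express $(q;q)_\infty G$ and
  $(q;q)_\infty H$, and one application expresses $(q;q)_\infty$ itself, as the theta series
  $\sum_n (-1)^n e^{\pi i k \tau (n + a)^2}$ with $k = 5$, $a = 1/10, 3/10$ and $k = 3$, $a = 1/6$.
  Poisson summation under $\tau \mapsto -1/\tau$, after sorting the dual sum by residues modulo $k$,
  permutes these series linearly with a common factor $\sqrt{-i\tau}$, which cancels in the
  quotients $f_1$, $f_2$. As $S$ and $T$ generate $\mathrm{SL}_2(\mathbb Z)$, it remains to exhibit a
  representation with the right values at $S$ and $T$: the product of a character of order $12$ with
  the two-dimensional representation of $\mathrm{SL}_2(\mathbb Z/5)$ (the binary icosahedral group),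
  both given by formulas in the matrix entries and checked on right multiplication by the generators.
\<close>

subsection \<open>Sums over the integers and the Bailey lemma\<close>

text \<open>The sums G and H are compared with theta series instead of infinite products, because
  series are what Poisson summation acts on. The prefactors come from the numbers k a^2 of the three
  series, 1/20, 9/20 and 1/12: one has 1/20 - 1/12 = 2 (-1/60) and 9/20 - 1/12 = 2 (11/60). The
  dimensions come from k being odd. The dual sum involves a = (2i+1)/(2k); reflection identifies a
  with 1 - a up to sign and kills a = 1/2, so k = 3 leaves one series and k = 5 leaves two. The
  transformation laws only prescribe values at S and T. That some homomorphism of the right level
  takes these values is a separate algebraic fact. Since T^5 acts as the scalar exp(-2 pi i/12), a
  character must be split off whose value at T has fifth power exp(-2 pi i/12); characters of the
  modular group take 12th roots of unity as values, and 5 * 7 = -1 modulo 12 singles out exp(2 pi i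
  7/12). What remains has determinant one at S and T.\<close>

lemma infsum_shift_int: "infsum (\<lambda>j::int. f (j + k)) UNIV = infsum f UNIV"
proof -
  have "bij_betw (\<lambda>j::int. j + k) UNIV UNIV"
    by (rule bij_betw_byWitness[where f' = "\<lambda>j. j - k"]) auto
  thus ?thesis by (rule infsum_reindex_bij_betw)
qed

lemma infsum_reflect_int: "infsum (\<lambda>j::int. f (k - j)) UNIV = infsum f UNIV"
proof -
  have "bij_betw (\<lambda>j::int. k - j) UNIV UNIV"
    by (rule bij_betw_byWitness[where f' = "\<lambda>j. k - j"]) auto
  thus ?thesis by (rule infsum_reindex_bij_betw)
qed

lemma summable_on_power_abs_int:
  fixes x :: real
  assumes "0 \<le> x" "x < 1"
  shows "(\<lambda>j::int. x ^ nat \<bar>j\<bar>) summable_on UNIV"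
proof -
  have geo: "(\<lambda>n::nat. x ^ n) summable_on UNIV"
    by (rule summable_nonneg_imp_summable_on) (use assms in \<open>auto intro: summable_geometric\<close>)
  have "(\<lambda>j::int. x ^ nat \<bar>j\<bar>) summable_on range int"
    using geo by (subst summable_on_reindex) (auto simp: o_def)
  moreover have "(\<lambda>j::int. x ^ nat \<bar>j\<bar>) summable_on range (\<lambda>n. - int n)"
    using geo by (subst summable_on_reindex) (auto simp: o_def inj_def)
  moreover have "(UNIV :: int set) = range int \<union> range (\<lambda>n. - int n)"
  proof (intro equalityI subsetI)
    fix j :: int
    show "j \<in> range int \<union> range (\<lambda>n. - int n)"
      by (cases j rule: int_cases2) auto
  qed auto
  ultimately show ?thesis using summable_on_union by metis
qed

text \<open>Tannery's theorem: the majorant \<open>h\<close> makes the finite partial sums converge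
  uniformly in n, so the limit in n and the sum may be exchanged.\<close>

lemma infsum_dominated_convergence:
  fixes f :: "nat \<Rightarrow> 'a \<Rightarrow> complex"
  assumes lim: "\<And>x. (\<lambda>n. f n x) \<longlonglongrightarrow> g x"
    and bound: "\<And>n x. norm (f n x) \<le> h x" and h: "h summable_on UNIV"
  shows "(\<lambda>n. infsum (f n) UNIV) \<longlonglongrightarrow> infsum g UNIV"
proof -
  have g_bound: "norm (g x) \<le> h x" for x
    using bound by (intro tendsto_upperbound[OF tendsto_norm[OF lim[of x]]]) auto
  have "(\<lambda>x. norm (g x)) summable_on UNIV"
    using h g_bound by (rule Infinite_Sum.abs_summable_on_comparison_test')
  hence g: "g summable_on UNIV" by (rule abs_summable_summable)
  show ?thesis
  proof (rule swap_uniform_limit')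
    show "\<forall>\<^sub>F X in finite_subsets_at_top UNIV. (\<lambda>n. \<Sum>x\<in>X. f n x) \<longlonglongrightarrow> (\<Sum>x\<in>X. g x)"
      by (intro always_eventually allI tendsto_sum lim)
    show "((\<lambda>X. \<Sum>x\<in>X. g x) \<longlongrightarrow> infsum g UNIV) (finite_subsets_at_top UNIV)"
      using g by (rule infsum_tendsto)
    show "uniform_limit UNIV (\<lambda>X n. \<Sum>x\<in>X. f n x) (\<lambda>n. infsum (f n) UNIV) (finite_subsets_at_top UNIV)"
      using bound h by (intro Weierstrass_m_test_general) auto
  qed auto
qed

lemma has_sum_finite_sum:
  fixes f :: "'i \<Rightarrow> 'a \<Rightarrow> complex"
  assumes "\<And>i. i \<in> I \<Longrightarrow> (f i has_sum S i) A"
  shows "((\<lambda>x. \<Sum>i\<in>I. f i x) has_sum (\<Sum>i\<in>I. S i)) A"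
  using assms by (induction I rule: infinite_finite_induct) (auto intro: has_sum_add)

section \<open>One step of the Bailey chain, for finite n\<close>

locale nome =
  fixes p :: complex
  assumes p_nonzero: "p \<noteq> 0" and norm_p_less_1: "norm p < 1"
begin

definition q :: complex where "q = p ^ 2"

abbreviation P :: "nat \<Rightarrow> complex" where "P \<equiv> q_pochhammer q q"

lemma q_nonzero: "q \<noteq> 0"
  using p_nonzero by (simp add: q_def)

lemma norm_q_less_1: "norm q < 1"
  using norm_p_less_1 by (simp add: q_def norm_power power_less_one_iff)

lemma q_power_neq_1: "n > 0 \<Longrightarrow> q ^ n \<noteq> 1"
proof
  assume "n > 0" "q ^ n = 1"
  hence "norm q ^ n = 1" by (metis norm_one norm_power)
  with norm_q_less_1 \<open>n > 0\<close> show False by (metis less_irrefl norm_ge_zero power_less_one_iff)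
qed

lemma P_0 [simp]: "P 0 = 1"
  by (simp add: q_pochhammer_def)

lemma P_Suc: "P (Suc n) = P n * (1 - q ^ Suc n)"
  by (simp add: q_pochhammer_def mult.commute)

lemma P_nonzero [simp]: "P n \<noteq> 0"
proof (induction n)
  case (Suc n)
  thus ?case using q_power_neq_1[of "Suc n"] by (simp add: P_Suc del: power_Suc)
qed simp

text \<open>A form of the $q$-Vandermonde identity. The induction splits
  $1 - q^{M+1} = (1 - q^i) + q^i (1 - q^{M+1-i})$; both halves are multiples of the summand for
  $(M, c+1)$, and their coefficients add up to one.\<close>

lemma bailey_kernel:
  "(\<Sum>i\<le>M. q ^ (i * (i + c)) / (P (M - i) * P i * P (i + c))) = 1 / (P M * P (M + c))"
proof (induction M arbitrary: c)
  case 0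
  show ?case by simp
next
  case (Suc M)
  define T where "T = (\<lambda>M c i. q ^ (i * (i + c)) / (P (M - i) * P i * P (i + c)))"
  have fin: "1 - q ^ Suc n \<noteq> 0" for n
    using q_power_neq_1[of "Suc n"] by simp
  have A: "(1 - q ^ Suc i) * T (Suc M) c (Suc i) = q ^ (i + c + 1) * T M (Suc c) i" for i
  proof -
    have "q ^ (Suc i * (Suc i + c)) = q ^ (i + c + 1) * q ^ (i * (i + Suc c))"
      by (simp add: algebra_simps flip: power_add)
    thus ?thesis using fin[of i]
      by (simp add: T_def P_Suc[of i] divide_simps del: power_Suc)
  qed
  have B: "q ^ i * (1 - q ^ (Suc M - i)) * T (Suc M) c i = (1 - q ^ (i + c + 1)) * T M (Suc c) i"
    if "i \<le> M" for i
  proof -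
    have 1: "q ^ (i * (i + Suc c)) = q ^ i * q ^ (i * (i + c))"
      by (simp add: algebra_simps flip: power_add)
    have 2: "Suc M - i = Suc (M - i)" using that by simp
    show ?thesis using fin[of "i+c"] fin[of "M-i"]
      by (simp add: T_def 1 2 P_Suc[of "i+c"] P_Suc[of "M-i"] divide_simps power_add del: power_Suc)
  qed
  have "(1 - q ^ Suc M) * (\<Sum>i\<le>Suc M. T (Suc M) c i) =
     (\<Sum>i\<le>Suc M. (1 - q ^ i) * T (Suc M) c i + q ^ i * (1 - q ^ (Suc M - i)) * T (Suc M) c i)"
    unfolding sum_distrib_left
  proof (rule sum.cong)
    fix i assume "i \<in> {..Suc M}"
    hence "q ^ Suc M = q ^ i * q ^ (Suc M - i)" by (simp flip: power_add)
    thus "(1 - q ^ Suc M) * T (Suc M) c i = 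
      (1 - q ^ i) * T (Suc M) c i + q ^ i * (1 - q ^ (Suc M - i)) * T (Suc M) c i"
      by (simp add: algebra_simps del: power_Suc)
  qed simp
  also have "\<dots> = (\<Sum>i\<le>Suc M. (1 - q ^ i) * T (Suc M) c i) + 
       (\<Sum>i\<le>Suc M. q ^ i * (1 - q ^ (Suc M - i)) * T (Suc M) c i)"
    by (rule sum.distrib)
  also have "(\<Sum>i\<le>Suc M. (1 - q ^ i) * T (Suc M) c i) = (\<Sum>i\<le>M. (1 - q ^ Suc i) * T (Suc M) c (Suc i))"
    by (subst sum.atMost_Suc_shift) simp
  also have "\<dots> = (\<Sum>i\<le>M. q ^ (i + c + 1) * T M (Suc c) i)"
    by (simp only: A)
  also have "(\<Sum>i\<le>Suc M. q ^ i * (1 - q ^ (Suc M - i)) * T (Suc M) c i) = 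
     (\<Sum>i\<le>M. q ^ i * (1 - q ^ (Suc M - i)) * T (Suc M) c i)"
    by (subst sum.atMost_Suc) simp
  also have "\<dots> = (\<Sum>i\<le>M. (1 - q ^ (i + c + 1)) * T M (Suc c) i)"
    by (intro sum.cong refl B) simp
  also have "(\<Sum>i\<le>M. q ^ (i + c + 1) * T M (Suc c) i) + \<dots> = (\<Sum>i\<le>M. T M (Suc c) i)"
    by (subst sum.distrib[symmetric]) (simp add: algebra_simps)
  also have "\<dots> = 1 / (P M * P (M + Suc c))"
    using Suc.IH[of "Suc c"] by (simp add: T_def)
  finally have "(\<Sum>i\<le>Suc M. T (Suc M) c i) = 1 / (P (Suc M) * P (Suc M + c))"
    using fin[of M] by (simp add: P_Suc[of M] eq_divide_eq mult.commute mult.left_commute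
        del: power_Suc sum.atMost_Suc)
  thus ?case by (simp add: T_def)
qed

text \<open>Reciprocals of the $q$-factorials, extended by zero so that the bilateral sums below
  have finite support and satisfy the recursion without boundary cases.\<close>

definition rq :: "int \<Rightarrow> complex" where
  "rq k = (if k < 0 then 0 else 1 / P (nat k))"

lemma rq_neg [simp]: "k < 0 \<Longrightarrow> rq k = 0"
  by (simp add: rq_def)

lemma rq_0 [simp]: "rq 0 = 1"
  by (simp add: rq_def)

lemma rq_of_nat: "rq (int n) = 1 / P n"
  by (simp add: rq_def)

lemma rq_rec: "(1 - q powi k) * rq k = rq (k - 1)"
proof (cases "k > 0")
  case True
  then obtain n where k: "k = int (Suc n)" by (metis gr0_conv_Suc zero_less_imp_eq_int)
  have "q powi k = q ^ Suc n" by (simp only: k power_int_of_nat)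
  moreover have "nat k = Suc n" "nat (k - 1) = n" "\<not> k < 0" "\<not> k - 1 < 0" using k by auto
  ultimately show ?thesis using q_power_neq_1[of "Suc n"]
    by (simp add: rq_def P_Suc divide_simps del: power_Suc)
qed (cases "k = 0", auto)

text \<open>For j = k >= 0 only k <= s <= n contributes, and s = k + i turns the sum into
  \<open>bailey_kernel\<close> with M = n - k and c = 2k + e. Both sides are invariant under j -> -j
  - e, which exchanges the two \<open>rq\<close> factors and so covers negative j.\<close>

lemma bailey_kernel_int:
  assumes "e \<in> {0, 1}"
  shows "q powi (j * (j + int e)) * (rq (int n - j) * rq (int n + j + int e)) =
         (\<Sum>s\<le>n. q ^ (s * (s + e)) * rq (int n - int s) * (rq (int s - j) * rq (int s + j + int e)))"
    (is "?L j = ?R j")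
proof -
  have nonneg: "?L (int k) = ?R (int k)" for k
  proof (cases "k \<le> n")
    case False
    hence "?R (int k) = 0" by (intro sum.neutral) auto
    with False show ?thesis by simp
  next
    case True
    define g where "g = (\<lambda>s. q ^ (s * (s + e)) * rq (int n - int s) * (rq (int s - int k) * rq (int s + int k + int e)))"
    have "?R (int k) = sum g {k..n}"
      unfolding g_def by (rule sum.mono_neutral_right) auto
    also have "\<dots> = (\<Sum>i\<le>n-k. g (k + i))"
      using True
      by (intro sum.reindex_bij_witness[of _ "\<lambda>i. k + i" "\<lambda>s. s - k"]) auto
    also have "\<dots> = (\<Sum>i\<le>n-k. q ^ (k * (k + e)) * (q ^ (i * (i + (2*k+e))) / (P (n - k - i) * P i * P (i + (2*k+e)))))"
    proof (rule sum.cong[OF refl])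
      fix i assume "i \<in> {..n-k}"
      hence i: "int n - int (k + i) = int (n - k - i)" "int (k+i) - int k = int i"
         "int (k + i) + int k + int e = int (i + (2*k+e))"
        using True by auto
      have "(k + i) * (k + i + e) = k * (k + e) + i * (i + (2*k+e))" by (simp add: algebra_simps)
      thus "g (k + i) = q ^ (k * (k + e)) * (q ^ (i * (i + (2*k+e))) / (P (n - k - i) * P i * P (i + (2*k+e))))"
        unfolding g_def i rq_of_nat by (simp add: power_add)
    qed
    also have "\<dots> = q ^ (k * (k + e)) * (1 / (P (n - k) * P (n - k + (2*k+e))))"
      by (subst sum_distrib_left[symmetric], subst bailey_kernel) simp
    also have "\<dots> = ?L (int k)"
    proof -
      have "int n - int k = int (n - k)" "int n + int k + int e = int (n - k + (2*k+e))"
        using True by auto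
      moreover have "q powi (int k * (int k + int e)) = q ^ (k * (k + e))"
        by (metis of_nat_add of_nat_mult power_int_of_nat)
      ultimately show ?thesis by (simp only: rq_of_nat) simp
    qed
    finally show ?thesis ..
  qed
  have sym: "?L (- j - int e) = ?L j" "?R (- j - int e) = ?R j" for j
  proof -
    have eqs: "int m - (- j - int e) = int m + j + int e" "int m + (- j - int e) + int e = int m - j" for m
      by auto
    show "?L (- j - int e) = ?L j" "?R (- j - int e) = ?R j"
      unfolding eqs by (simp_all add: algebra_simps)
  qed
  show ?thesis
  proof (cases "j \<ge> 0")
    case True
    thus ?thesis using nonneg[of "nat j"] by simp
  next
    case False
    \<comment> \<open>For j <= -1 the reflected index -j - e is nonnegative because e <= 1.\<close>
    hence "- j - int e = int (nat (- j - int e))" using assms by auto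
    with nonneg[of "nat (- j - int e)"] have "?L (- j - int e) = ?R (- j - int e)" by simp
    thus ?thesis by (simp only: sym)
  qed
qed

lemma rq_product_summable: "(\<lambda>j. f j * (rq (m - j) * rq (k + j))) summable_on UNIV"
proof (rule finite_nonzero_values_imp_summable_on)
  have "{j \<in> UNIV. f j * (rq (m - j) * rq (k + j)) \<noteq> 0} \<subseteq> {-k..m}"
    by (auto simp: not_less[symmetric])
  thus "finite {j \<in> UNIV. f j * (rq (m - j) * rq (k + j)) \<noteq> 0}"
    by (rule finite_subset) auto
qed

text \<open>The Bailey lemma with its two free parameters sent to infinity. Up to a constant factor,
  the inner sum is the beta sequence of the bilateral alpha sequence \<open>a\<close>, relative to
  the parameter q^e; multiplying \<open>a\<close> by q^(j(j+e)) replaces beta by the finite sum on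
  the right.\<close>

lemma bailey_lemma:
  assumes "e \<in> {0, 1}"
  shows "(\<Sum>\<^sub>\<infinity>j. a j * q powi (j * (j + int e)) * (rq (int n - j) * rq (int n + int e + j))) =
         (\<Sum>s\<le>n. q ^ (s * (s + e)) * rq (int n - int s) *
            (\<Sum>\<^sub>\<infinity>j. a j * (rq (int s - j) * rq (int s + int e + j))))"
proof -
  have "a j * q powi (j * (j + int e)) * (rq (int n - j) * rq (int n + int e + j)) =
     (\<Sum>s\<le>n. q ^ (s * (s + e)) * rq (int n - int s) * (a j * (rq (int s - j) * rq (int s + int e + j))))" for j
  proof -
    have "a j * q powi (j * (j + int e)) * (rq (int n - j) * rq (int n + int e + j)) =
      a j * (q powi (j * (j + int e)) * (rq (int n - j) * rq (int n + j + int e)))"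
      by (simp add: ac_simps)
    thus ?thesis
      unfolding bailey_kernel_int[OF assms] by (simp add: sum_distrib_left ac_simps)
  qed
  moreover have "((\<lambda>j. \<Sum>s\<le>n. q ^ (s * (s + e)) * rq (int n - int s) *
         (a j * (rq (int s - j) * rq (int s + int e + j)))) has_sum
      (\<Sum>s\<le>n. q ^ (s * (s + e)) * rq (int n - int s) *
            (\<Sum>\<^sub>\<infinity>j. a j * (rq (int s - j) * rq (int s + int e + j))))) UNIV"
    by (intro has_sum_finite_sum has_sum_cmult_right has_sum_infsum rq_product_summable)
  ultimately show ?thesis by (simp add: infsumI)
qed

end

section \<open>The unit Bailey pair and its first two iterates\<close>

lemma minus_one_powi_minus: "(-1 :: 'a :: division_ring) powi (- k) = (-1) powi k"
  by (simp add: power_int_minus flip: power_int_inverse)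

context nome begin

text \<open>The base $p = q^{1/2}$ keeps all exponents integral: $u_j = (-1)^j q^{j(j-1)/2}$.\<close>

definition u :: "int \<Rightarrow> complex" where
  "u j = (-1) powi j * p powi (j * (j - 1))"

lemma q_powi: "q powi k = p powi (2 * k)"
  using p_nonzero by (simp add: q_def power_int_mult)

lemma u_shift: "u (j + 1) = - ((-1) powi j * p powi (j * (j + 1)))"
  by (simp add: u_def power_int_add algebra_simps)

lemma u_times_q_powi: "u j * q powi (m + j) = q powi m * ((-1) powi j * p powi (j * (j + 1)))"
proof -
  have "u j * q powi (m + j) = (-1) powi j * p powi (j * (j - 1) + 2 * (m + j))"
    using p_nonzero by (simp add: u_def q_powi power_int_add)
  also have "j * (j - 1) + 2 * (m + j) = 2 * m + j * (j + 1)" by (simp add: algebra_simps)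
  also have "(-1) powi j * p powi \<dots> = q powi m * ((-1) powi j * p powi (j * (j + 1)))"
    using p_nonzero by (simp add: q_powi power_int_add)
  finally show ?thesis .
qed

text \<open>The reflection j -> -1 - j swaps the two \<open>rq\<close> factors, preserves j(j+1) and
  reverses the sign, so the sum equals its own negative.\<close>

lemma antisymmetric_sum_zero:
  "(\<Sum>\<^sub>\<infinity>j. (-1) powi j * p powi (j * (j + 1)) * (rq (N - j) * rq (N + 1 + j))) = 0" (is "infsum ?f UNIV = 0")
proof -
  have "?f (-1 - j) = - ?f j" for j
  proof -
    have "(-1 :: complex) powi (-1 - j) = (-1) powi (- (j + 1))"
      by (rule arg_cong) simp
    also have "\<dots> = - ((-1) powi j)"
      unfolding minus_one_powi_minus by (simp add: power_int_add)
    finally have 1: "(-1 :: complex) powi (-1 - j) = - ((-1) powi j)" .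
    have 2: "(-1 - j) * (-1 - j + 1) = j * (j + 1)" "N - (-1 - j) = N + 1 + j" "N + 1 + (-1 - j) = N - j"
      by (simp_all add: algebra_simps)
    show ?thesis unfolding 1 2 by (simp add: mult.commute)
  qed
  hence "infsum ?f UNIV = - infsum ?f UNIV"
    using infsum_reflect_int[of ?f "-1"] by (simp add: infsum_uminus)
  thus ?thesis by simp
qed

text \<open>For n > 0 split 1 - q^(2n) = (1 - q^(n+j)) + q^(n+j) (1 - q^(n-j)). By
  \<open>rq_rec\<close> each half lowers the index of one \<open>rq\<close> factor; the first half
  after a shift of j, the second directly, is a multiple of the vanishing sum
  \<open>E\<close>.\<close>

lemma unit_pair_0:
  "(\<Sum>\<^sub>\<infinity>j. u j * (rq (int n - j) * rq (int n + j))) = (if n = 0 then 1 else 0)"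
proof (cases "n = 0")
  case True
  have "((\<lambda>j. u j * (rq (- j) * rq j)) has_sum 1) UNIV"
  proof (rule has_sum_finite_neutralI[of "{0}"])
    fix j :: int assume "j \<in> UNIV - {0}"
    hence "j < 0 \<or> j > 0" by auto
    thus "u j * (rq (- j) * rq j) = 0" by auto
  qed (auto simp: u_def)
  thus ?thesis using True by (simp add: infsumI)
next
  case False
  define E where "E = (\<lambda>j. (-1) powi j * p powi (j * (j + 1)) * (rq (int n - 1 - j) * rq (int n + j)))"
  have E0: "infsum E UNIV = 0"
    using antisymmetric_sum_zero[of "int n - 1"] by (simp add: E_def)
  have E_sum: "E summable_on UNIV"
    unfolding E_def by (rule rq_product_summable)
  have eq: "(1 - q powi (2 * int n)) * (u j * (rq (int n - j) * rq (int n + j))) =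
     u j * (rq (int n - j) * rq (int n - 1 + j)) + q powi (int n) * E j" for j
  proof -
    have 1: "(1 - q powi (int n + j)) * rq (int n + j) = rq (int n - 1 + j)"
      by (subst rq_rec) (simp add: algebra_simps)
    have 2: "(1 - q powi (int n - j)) * rq (int n - j) = rq (int n - 1 - j)"
      by (subst rq_rec) (simp add: algebra_simps)
    have "q powi (2 * int n) = q powi (int n + j) * q powi (int n - j)"
      using q_nonzero by (simp flip: power_int_add)
    hence "(1 - q powi (2 * int n)) * (u j * (rq (int n - j) * rq (int n + j))) =
      u j * (rq (int n - j) * ((1 - q powi (int n + j)) * rq (int n + j))) +
      (u j * q powi (int n + j)) * (((1 - q powi (int n - j)) * rq (int n - j)) * rq (int n + j))"
      by (simp add: algebra_simps)
    thus ?thesis unfolding 1 2 u_times_q_powi by (simp add: E_def)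
  qed
  have "(\<Sum>\<^sub>\<infinity>j. u j * (rq (int n - j) * rq (int n - 1 + j))) = 
    (\<Sum>\<^sub>\<infinity>j. u (j + 1) * (rq (int n - (j + 1)) * rq (int n - 1 + (j + 1))))"
    by (rule infsum_shift_int[symmetric])
  also have "\<dots> = (\<Sum>\<^sub>\<infinity>j. - E j)"
    by (rule infsum_cong) (simp add: u_shift E_def algebra_simps)
  finally have first: "(\<Sum>\<^sub>\<infinity>j. u j * (rq (int n - j) * rq (int n - 1 + j))) = 0"
    using E0 by (simp add: infsum_uminus)
  have "(1 - q powi (2 * int n)) * (\<Sum>\<^sub>\<infinity>j. u j * (rq (int n - j) * rq (int n + j))) =
    (\<Sum>\<^sub>\<infinity>j. u j * (rq (int n - j) * rq (int n - 1 + j)) + q powi (int n) * E j)"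
    by (simp only: infsum_cmult_right'[symmetric] eq)
  also have "\<dots> = 0"
    by (subst infsum_add) (simp_all add: first E0 E_sum rq_product_summable summable_on_cmult_right infsum_cmult_right')
  finally show ?thesis
    using False q_power_neq_1[of "2 * n"] by (simp add: power_int_def nat_mult_distrib)
qed

text \<open>The same splitting of 1 - q^(2n+1). The first half is the sum of
  \<open>unit_pair_0\<close>, the second its shift with factor -q^(n+1). Together they give (1 -
  q^(n+1)) times a Kronecker delta, and at n = 0 the factor 1 - q cancels.\<close>

lemma unit_pair_1:
  "(\<Sum>\<^sub>\<infinity>j. u j * (rq (int n - j) * rq (int n + 1 + j))) = (if n = 0 then 1 else 0)"
proof -
  define D where "D = (\<lambda>j. u j * (rq (int n - j) * rq (int n + j)))"
  define E where "E = (\<lambda>j. (-1) powi j * p powi (j * (j + 1)) * (rq (int n - 1 - j) * rq (int n + 1 + j)))"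
  have D_sum: "D summable_on UNIV" and E_sum: "E summable_on UNIV"
    unfolding D_def E_def by (rule rq_product_summable)+
  have "infsum E UNIV = (\<Sum>\<^sub>\<infinity>j. - D (j + 1))"
    by (rule infsum_cong) (simp add: D_def E_def u_shift algebra_simps)
  also have "\<dots> = - infsum D UNIV"
    by (simp add: infsum_uminus infsum_shift_int)
  finally have ED: "infsum E UNIV = - infsum D UNIV" .
  have eq: "(1 - q powi (2 * int n + 1)) * (u j * (rq (int n - j) * rq (int n + 1 + j))) =
     D j + q powi (int n + 1) * E j" for j
  proof -
    have 1: "(1 - q powi (int n + 1 + j)) * rq (int n + 1 + j) = rq (int n + j)"
      by (subst rq_rec) (simp add: algebra_simps)
    have 2: "(1 - q powi (int n - j)) * rq (int n - j) = rq (int n - 1 - j)"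
      by (subst rq_rec) (simp add: algebra_simps)
    have "q powi (2 * int n + 1) = q powi (int n + 1 + j) * q powi (int n - j)"
      using q_nonzero by (simp flip: power_int_add)
    hence "(1 - q powi (2 * int n + 1)) * (u j * (rq (int n - j) * rq (int n + 1 + j))) =
      u j * (rq (int n - j) * ((1 - q powi (int n + 1 + j)) * rq (int n + 1 + j))) +
      (u j * q powi (int n + 1 + j)) * (((1 - q powi (int n - j)) * rq (int n - j)) * rq (int n + 1 + j))"
      by (simp add: algebra_simps)
    thus ?thesis unfolding 1 2 u_times_q_powi by (simp add: D_def E_def)
  qed
  have "(1 - q powi (2 * int n + 1)) * (\<Sum>\<^sub>\<infinity>j. u j * (rq (int n - j) * rq (int n + 1 + j))) =
    (\<Sum>\<^sub>\<infinity>j. D j + q powi (int n + 1) * E j)"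
    by (simp only: infsum_cmult_right'[symmetric] eq)
  also have "\<dots> = infsum D UNIV + q powi (int n + 1) * infsum E UNIV"
    by (subst infsum_add) (simp_all add: D_sum E_sum summable_on_cmult_right infsum_cmult_right')
  also have "\<dots> = (if n = 0 then 1 - q else 0)"
    using unit_pair_0[of n] by (simp add: ED flip: D_def)
  finally have *: "(1 - q powi (2 * int n + 1)) * (\<Sum>\<^sub>\<infinity>j. u j * (rq (int n - j) * rq (int n + 1 + j))) =
     (if n = 0 then 1 - q else 0)" .
  have "q powi (2 * int n + 1) = q ^ (2 * n + 1)"
    using power_int_of_nat[of q "2 * n + 1"] by (simp add: add.commute)
  hence "1 - q powi (2 * int n + 1) \<noteq> 0" using q_power_neq_1[of "2 * n + 1"] by simp
  with * show ?thesis by (cases "n = 0") auto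
qed

lemma unit_pair:
  assumes "e \<in> {0, 1}"
  shows "(\<Sum>\<^sub>\<infinity>j. u j * (rq (int n - j) * rq (int n + int e + j))) = (if n = 0 then 1 else 0)"
  using assms unit_pair_0[of n] unit_pair_1[of n] by auto

lemma bailey_once:
  assumes "e \<in> {0, 1}"
  shows "(\<Sum>\<^sub>\<infinity>j. u j * q powi (j * (j + int e)) * (rq (int n - j) * rq (int n + int e + j))) = rq (int n)"
  unfolding bailey_lemma[OF assms] unit_pair[OF assms]
  by (subst sum.remove[of _ 0]) (auto intro!: sum.neutral)

text \<open>A finite form of the Rogers-Ramanujan identities: for n to infinity
  \<open>rq (int n - int s)\<close> becomes a constant, and the terms of G or H remain.\<close>

lemma bailey_twice:
  assumes "e \<in> {0, 1}"
  shows "(\<Sum>\<^sub>\<infinity>j. u j * q powi (j * (j + int e)) * q powi (j * (j + int e)) *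
            (rq (int n - j) * rq (int n + int e + j))) =
         (\<Sum>s\<le>n. q ^ (s * (s + e)) * rq (int n - int s) * rq (int s))"
  by (subst bailey_lemma[OF assms], subst bailey_once[OF assms]) (rule refl)

end

section \<open>Limits of the finite identities for n to infinity\<close>

lemma filterlim_int_add: "filterlim (\<lambda>n. int n + k) at_top sequentially"
  unfolding filterlim_at_top
proof
  fix Z :: int
  show "\<forall>\<^sub>F n in sequentially. Z \<le> int n + k"
    using eventually_ge_at_top[of "nat (Z - k)"] by eventually_elim linarith
qed

context nome begin

definition qinf :: complex where "qinf = lim P"

text \<open>The product converges absolutely and no factor vanishes, so the limit is nonzero. This
  is what later permits division by \<open>theta 3 (1 / 6)\<close>.\<close>

lemma P_limit: "P \<longlonglongrightarrow> qinf" and qinf_nonzero: "qinf \<noteq> 0"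
proof -
  have "summable (\<lambda>i. norm q * norm q ^ i)"
    using norm_q_less_1 by (intro summable_mult summable_geometric) auto
  hence "summable (\<lambda>i. norm ((1 - q * q ^ i) - 1))"
    by (simp add: norm_mult norm_power)
  hence "convergent_prod (\<lambda>i. 1 - q * q ^ i)"
    by (intro abs_convergent_prod_imp_convergent_prod summable_imp_abs_convergent_prod)
  moreover have "1 - q * q ^ i \<noteq> 0" for i
    using q_power_neq_1[of "Suc i"] by simp
  ultimately obtain L where L: "(\<lambda>n. \<Prod>i\<le>n. 1 - q * q ^ i) \<longlonglongrightarrow> L" "L \<noteq> 0"
    by (subst (asm) convergent_prod_iff_nz_lim) auto
  from L(1) have "(\<lambda>n. P (Suc n)) \<longlonglongrightarrow> L"
    by (simp add: q_pochhammer_def lessThan_Suc_atMost)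
  hence "P \<longlonglongrightarrow> L" by (simp add: filterlim_sequentially_Suc)
  moreover from this have "L = qinf" unfolding qinf_def by (simp add: limI)
  ultimately show "P \<longlonglongrightarrow> qinf" "qinf \<noteq> 0" using L(2) by auto
qed

lemma rq_limit: "(rq \<longlongrightarrow> 1 / qinf) at_top"
proof (rule Lim_transform_eventually)
  show "((\<lambda>k. 1 / P (nat k)) \<longlongrightarrow> 1 / qinf) at_top"
    by (intro tendsto_divide tendsto_const filterlim_compose[OF P_limit] filterlim_nat_sequentially qinf_nonzero)
  show "\<forall>\<^sub>F k in at_top. 1 / P (nat k) = rq k"
    using eventually_ge_at_top[of 0] by eventually_elim (simp add: rq_def)
qed

lemma rq_bounded: obtains C where "C > 0" "\<And>k. norm (rq k) \<le> C"
proof -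
  have "convergent (\<lambda>n. 1 / P n)"
    using tendsto_divide[OF tendsto_const P_limit qinf_nonzero] by (auto simp: convergent_def)
  then obtain C where C: "C > 0" "\<And>n. norm (1 / P n) \<le> C"
    using convergent_imp_Bseq BseqE by metis
  have "norm (rq k) \<le> C" for k
    using C by (auto simp: rq_def)
  with C(1) show ?thesis by (rule that)
qed

lemma norm_u: "norm (u j) = norm p powi (j * (j - 1))"
  by (simp add: u_def norm_mult norm_power_int)

lemma norm_p_powi_le:
  assumes "\<bar>j\<bar> \<le> m"
  shows "norm p powi m \<le> norm p ^ nat \<bar>j\<bar>"
proof -
  have "norm p powi m = norm p ^ nat m"
    using assms by (simp add: power_int_def)
  also have "\<dots> \<le> norm p ^ nat \<bar>j\<bar>"
    using assms norm_p_less_1 by (intro power_decreasing) auto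
  finally show ?thesis .
qed

text \<open>The exponents of p are 3j^2 + (2e-1)j and 5j^2 + (4e-1)j, both at least |j| because |j|
  <= j^2 for integers. The bound provides a majorant that is independent of n.\<close>

lemma norm_u_q_le:
  assumes "e \<in> {0, 1}"
  shows "norm (u j * q powi (j * (j + int e))) \<le> norm p ^ nat \<bar>j\<bar>"
    and "norm (u j * q powi (j * (j + int e)) * q powi (j * (j + int e))) \<le> norm p ^ nat \<bar>j\<bar>"
proof -
  have sq: "\<bar>j\<bar> \<le> j * j"
  proof -
    have "\<bar>j\<bar> * 1 \<le> \<bar>j\<bar> * \<bar>j\<bar>" by (cases "j = 0") (simp, intro mult_left_mono, auto)
    thus ?thesis by (simp add: abs_mult_self_eq)
  qed
  have e: "j * int e = 0 \<or> j * int e = j" using assms by auto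
  have add: "norm p powi (a + b) = norm p powi a * norm p powi b" for a b
    using p_nonzero by (simp add: power_int_add)
  have 1: "norm (u j * q powi (j * (j + int e))) = norm p powi (j * (j - 1) + 2 * (j * (j + int e)))"
    and 2: "norm (u j * q powi (j * (j + int e)) * q powi (j * (j + int e))) = 
       norm p powi (j * (j - 1) + 2 * (j * (j + int e)) + 2 * (j * (j + int e)))"
    by (simp_all only: norm_mult norm_u q_powi norm_power_int add)
  show "norm (u j * q powi (j * (j + int e))) \<le> norm p ^ nat \<bar>j\<bar>"
    unfolding 1 using sq e by (intro norm_p_powi_le) (auto simp: algebra_simps)
  show "norm (u j * q powi (j * (j + int e)) * q powi (j * (j + int e))) \<le> norm p ^ nat \<bar>j\<bar>"
    unfolding 2 using sq e by (intro norm_p_powi_le) (auto simp: algebra_simps)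
qed

lemma bailey_lhs_limit:
  assumes "\<And>j. norm (a j) \<le> norm p ^ nat \<bar>j\<bar>"
  shows "(\<lambda>n. \<Sum>\<^sub>\<infinity>j. a j * (rq (int n - j) * rq (int n + int e + j)))
           \<longlonglongrightarrow> infsum a UNIV * (1 / qinf * (1 / qinf))"
proof -
  obtain C where C: "C > 0" "\<And>k. norm (rq k) \<le> C" using rq_bounded by blast
  have "(\<lambda>n. \<Sum>\<^sub>\<infinity>j. a j * (rq (int n - j) * rq (int n + int e + j)))
           \<longlonglongrightarrow> (\<Sum>\<^sub>\<infinity>j. a j * (1 / qinf * (1 / qinf)))"
  proof (rule infsum_dominated_convergence)
    fix j :: int
    have "filterlim (\<lambda>n. int n - j) at_top sequentially" 
      using filterlim_int_add[of "- j"] by simp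
    moreover have "filterlim (\<lambda>n. int n + int e + j) at_top sequentially" 
      using filterlim_int_add[of "int e + j"] by (simp add: add.assoc)
    ultimately show "(\<lambda>n. a j * (rq (int n - j) * rq (int n + int e + j))) \<longlonglongrightarrow> a j * (1 / qinf * (1 / qinf))"
      by (intro tendsto_mult tendsto_const filterlim_compose[OF rq_limit])
  next
    fix n j
    have "norm (a j * (rq (int n - j) * rq (int n + int e + j))) \<le> norm p ^ nat \<bar>j\<bar> * (C * C)"
      unfolding norm_mult using C assms by (intro mult_mono) (auto intro: less_imp_le)
    thus "norm (a j * (rq (int n - j) * rq (int n + int e + j))) \<le> norm p ^ nat \<bar>j\<bar> * (C * C)" .
  next
    show "(\<lambda>j::int. norm p ^ nat \<bar>j\<bar> * (C * C)) summable_on UNIV"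
      by (intro summable_on_cmult_left summable_on_power_abs_int) (use norm_p_less_1 in auto)
  qed
  thus ?thesis by (simp only: infsum_cmult_left')
qed

text \<open>Euler's pentagonal number theorem, with exponents j(3j-1)/2 or j(3j+1)/2 of q. In the
  limit of \<open>bailey_once\<close> the left side carries two factors 1/\<open>qinf\<close> and
  the right side one.\<close>

lemma theta_eq_qinf:
  assumes "e \<in> {0, 1}"
  shows "(\<Sum>\<^sub>\<infinity>j. u j * q powi (j * (j + int e))) = qinf"
proof -
  have "(\<lambda>n. rq (int n)) \<longlonglongrightarrow> infsum (\<lambda>j. u j * q powi (j * (j + int e))) UNIV * (1 / qinf * (1 / qinf))"
    using bailey_lhs_limit[OF norm_u_q_le(1)[OF assms], of e] by (simp only: bailey_once[OF assms])
  moreover have "(\<lambda>n. rq (int n)) \<longlonglongrightarrow> 1 / qinf"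
    by (rule filterlim_compose[OF rq_limit filterlim_int_sequentially])
  ultimately have "infsum (\<lambda>j. u j * q powi (j * (j + int e))) UNIV * (1 / qinf * (1 / qinf)) = 1 / qinf"
    by (rule LIMSEQ_unique)
  thus ?thesis using qinf_nonzero by (simp add: field_simps)
qed

text \<open>The Rogers-Ramanujan identities before the triple product is applied: the exponents of q
  on the left are j(5j-1)/2 for e = 0 and j(5j+3)/2 for e = 1. Both sides of
  \<open>bailey_twice\<close> converge by domination.\<close>

lemma theta_eq_qinf_times_sum:
  assumes "e \<in> {0, 1}"
  shows "(\<Sum>\<^sub>\<infinity>j. u j * q powi (j * (j + int e)) * q powi (j * (j + int e))) = 
           qinf * (\<Sum>n. q ^ (n * (n + e)) / P n)"
proof -
  obtain C where C: "C > 0" "\<And>k. norm (rq k) \<le> C" using rq_bounded by blast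
  have pow_le: "norm (q ^ (s * (s + e))) \<le> norm q ^ s" for s
  proof -
    have "s \<le> s * (s + e)" by (cases s) auto
    thus ?thesis unfolding norm_power using norm_q_less_1 by (intro power_decreasing) auto
  qed
  have geo: "(\<lambda>s. norm q ^ s * D) summable_on UNIV" for D
    by (intro summable_on_cmult_left summable_nonneg_imp_summable_on)
       (use norm_q_less_1 in \<open>auto intro: summable_geometric\<close>)
  define S where "S = (\<Sum>\<^sub>\<infinity>s. q ^ (s * (s + e)) * rq (int s))"
  have "(\<lambda>n. \<Sum>\<^sub>\<infinity>s. q ^ (s * (s + e)) * rq (int n - int s) * rq (int s)) \<longlonglongrightarrow> 
        (\<Sum>\<^sub>\<infinity>s. q ^ (s * (s + e)) * (1 / qinf) * rq (int s))"
  proof (rule infsum_dominated_convergence)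
    fix s :: nat
    have "filterlim (\<lambda>n. int n - int s) at_top sequentially" 
      using filterlim_int_add[of "- int s"] by simp
    thus "(\<lambda>n. q ^ (s * (s + e)) * rq (int n - int s) * rq (int s)) \<longlonglongrightarrow> q ^ (s * (s + e)) * (1 / qinf) * rq (int s)"
      by (intro tendsto_mult tendsto_const filterlim_compose[OF rq_limit])
  next
    fix n s
    show "norm (q ^ (s * (s + e)) * rq (int n - int s) * rq (int s)) \<le> norm q ^ s * (C * C)"
      unfolding norm_mult mult.assoc using C pow_le by (intro mult_mono) (auto intro: less_imp_le)
  qed (rule geo)
  moreover have "(\<Sum>\<^sub>\<infinity>s. q ^ (s * (s + e)) * rq (int n - int s) * rq (int s)) =
    (\<Sum>s\<le>n. q ^ (s * (s + e)) * rq (int n - int s) * rq (int s))" for n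
    by (intro infsumI has_sum_finite_neutralI) auto
  moreover have "(\<Sum>\<^sub>\<infinity>s. q ^ (s * (s + e)) * (1 / qinf) * rq (int s)) = 1 / qinf * S"
    unfolding S_def by (subst infsum_cmult_right'[symmetric]) (simp add: ac_simps)
  ultimately have "(\<lambda>n. \<Sum>s\<le>n. q ^ (s * (s + e)) * rq (int n - int s) * rq (int s)) \<longlonglongrightarrow> 1 / qinf * S"
    by simp
  moreover have "(\<lambda>n. \<Sum>s\<le>n. q ^ (s * (s + e)) * rq (int n - int s) * rq (int s)) \<longlonglongrightarrow>
     (\<Sum>\<^sub>\<infinity>j. u j * q powi (j * (j + int e)) * q powi (j * (j + int e))) * (1 / qinf * (1 / qinf))"
    using bailey_lhs_limit[OF norm_u_q_le(2)[OF assms], of e] by (simp only: bailey_twice[OF assms])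
  ultimately have "(\<Sum>\<^sub>\<infinity>j. u j * q powi (j * (j + int e)) * q powi (j * (j + int e))) * (1 / qinf * (1 / qinf)) =
      1 / qinf * S"
    using LIMSEQ_unique by blast
  hence "(\<Sum>\<^sub>\<infinity>j. u j * q powi (j * (j + int e)) * q powi (j * (j + int e))) = qinf * S"
    using qinf_nonzero by (simp add: field_simps)
  moreover have "S = (\<Sum>n. q ^ (n * (n + e)) / P n)"
  proof -
    have "(\<lambda>s. norm (q ^ (s * (s + e)) * rq (int s))) summable_on UNIV"
    proof (rule Infinite_Sum.abs_summable_on_comparison_test'[OF geo])
      fix s
      show "norm (q ^ (s * (s + e)) * rq (int s)) \<le> norm q ^ s * C"
        unfolding norm_mult using C pow_le by (intro mult_mono) (auto intro: less_imp_le)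
    qed
    hence "((\<lambda>s. q ^ (s * (s + e)) * rq (int s)) has_sum S) UNIV"
      unfolding S_def by (intro has_sum_infsum) (rule abs_summable_summable)
    hence "(\<lambda>s. q ^ (s * (s + e)) * rq (int s)) sums S"
      by (rule has_sum_imp_sums)
    hence "S = (\<Sum>s. q ^ (s * (s + e)) * rq (int s))" by (rule sums_unique)
    thus ?thesis by (simp only: rq_of_nat times_divide_eq_right mult_1_right)
  qed
  ultimately show ?thesis by simp
qed

end

subsection \<open>Poisson summation for Gaussians\<close>

text \<open>Orthogonality of characters. The representatives are symmetric about 0 so that the
  cosines of \<open>polya_identity\<close> are only evaluated at angles up to pi/2 when |theta| <=
  pi.\<close>

lemma sum_cis_root_of_unity:
  fixes j :: int and r :: nat
  defines "l \<equiv> 2 * r + 1"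
  shows "(\<Sum>\<nu>=-int r..int r. cis (2 * pi * of_int (j * \<nu>) / real l)) =
           (if int l dvd j then of_nat l else 0)"
proof -
  define w where "w = cis (2 * pi * of_int j / real l)"
  have l: "l > 0" by (simp add: l_def)
  have w_powi: "w powi \<nu> = cis (2 * pi * of_int (j * \<nu>) / real l)" for \<nu>
    by (simp add: w_def cis_power_int mult_ac)
  have w_eq_1: "w = 1 \<longleftrightarrow> int l dvd j"
  proof
    assume "w = 1"
    then obtain n :: int where "2 * pi * of_int j / real l = of_int (2 * n) * pi"
      by (auto simp: w_def cis_conv_exp exp_eq_1)
    hence "real_of_int j = of_int (n * int l)"
      using l by (simp add: field_simps)
    hence "j = n * int l" by linarith
    thus "int l dvd j" by simp
  next
    assume "int l dvd j"
    then obtain n where "j = int l * n" by auto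
    hence "2 * pi * of_int j / real l = 2 * pi * of_int n" using l by simp
    hence "w = cis (2 * pi * of_int n)" by (simp only: w_def)
    thus "w = 1" by (simp only: cis_multiple_2pi Ints_of_int)
  qed
  have "w ^ l = cis (2 * pi * of_int j)"
    using l by (simp add: w_def Complex.DeMoivre)
  also have "\<dots> = 1" by (rule cis_multiple_2pi) simp
  finally have w_l: "w ^ l = 1" .
  have w0: "w \<noteq> 0" by (simp add: w_def)
  have "(\<Sum>\<nu>=-int r..int r. w powi \<nu>) = (\<Sum>i<l. w powi (int i - int r))"
    by (intro sum.reindex_bij_witness[of _ "\<lambda>i. int i - int r" "\<lambda>\<nu>. nat (\<nu> + int r)"])
       (auto simp: l_def)
  also have "\<dots> = w powi (- int r) * (\<Sum>i<l. w ^ i)"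
    using w0 by (simp add: sum_distrib_left power_int_diff power_int_minus field_simps)
  also have "\<dots> = (if w = 1 then of_nat l else 0)"
    using w_l by (auto simp: geometric_sum)
  finally show ?thesis by (simp add: w_powi w_eq_1)
qed

text \<open>Polya's proof of the Poisson formula: filter the binomial expansion of $\cos^{2m}$ by
  $l$-th roots of unity and let $m$ grow like $\alpha l^2$. Stirling-type asymptotics turn the
  binomial coefficients into one Gaussian, and powers of the cosine into the dual one.\<close>

definition binom_weight :: "nat \<Rightarrow> int \<Rightarrow> real" where
  "binom_weight m j = (if \<bar>j\<bar> \<le> int m then real ((2 * m) choose nat (int m + j)) / 4 ^ m else 0)"

lemma cos_power_expansion:
  "complex_of_real (cos x ^ (2 * m)) =
     (\<Sum>j=-int m..int m. of_real (binom_weight m j) * cis (2 * x * of_int j))"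
proof -
  have "complex_of_real (cos x) = (cis x + cis (- x)) / 2"
    by (simp add: complex_eq_iff)
  hence "complex_of_real (cos x ^ (2 * m)) = ((cis x + cis (- x)) / 2) ^ (2 * m)"
    by (simp only: of_real_power)
  also have "\<dots> = (cis x + cis (- x)) ^ (2 * m) / 4 ^ m"
    unfolding power_divide by (simp add: power_mult)
  also have "(cis x + cis (- x)) ^ (2 * m) =
     (\<Sum>i\<le>2*m. of_nat ((2 * m) choose i) * cis x ^ i * cis (- x) ^ (2 * m - i))"
    by (rule binomial_ring)
  also have "\<dots> / 4 ^ m = (\<Sum>i\<le>2*m. of_nat ((2 * m) choose i) / 4 ^ m * (cis x ^ i * cis (- x) ^ (2 * m - i)))"
    by (simp add: sum_divide_distrib mult_ac)
  also have "\<dots> = (\<Sum>j=-int m..int m. of_real (binom_weight m j) * cis (2 * x * of_int j))"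
  proof (rule sum.reindex_bij_witness[of _ "\<lambda>j. nat (j + int m)" "\<lambda>i. int i - int m"])
    fix i assume i: "i \<in> {..2*m}"
    have "of_real (binom_weight m (int i - int m)) = (of_nat ((2 * m) choose i) / 4 ^ m :: complex)"
      using i by (auto simp: binom_weight_def)
    moreover have "real i * x + real (2 * m - i) * (- x) = 2 * x * of_int (int i - int m)"
      using i by (simp add: of_nat_diff algebra_simps)
    hence "cis x ^ i * cis (- x) ^ (2 * m - i) = cis (2 * x * of_int (int i - int m))"
      by (simp only: Complex.DeMoivre cis_mult)
    ultimately show "of_real (binom_weight m (int i - int m)) * cis (2 * x * of_int (int i - int m)) =
       of_nat ((2 * m) choose i) / 4 ^ m * (cis x ^ i * cis (- x) ^ (2 * m - i))"
      by simp
  qed auto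
  finally show ?thesis .
qed

lemma polya_identity:
  fixes r m :: nat and \<theta> :: real
  defines "l \<equiv> 2 * r + 1"
  shows "(\<Sum>\<^sub>\<infinity>k. of_real (real l * binom_weight m (int l * k)) * cis (\<theta> * of_int k)) =
         (\<Sum>\<nu>=-int r..int r. complex_of_real (cos ((\<theta> + 2 * pi * of_int \<nu>) / (2 * real l)) ^ (2 * m)))"
proof -
  define g where "g = (\<lambda>j. of_real (binom_weight m j) * cis (\<theta> / real l * of_int j) * 
      (if int l dvd j then of_nat l else 0 :: complex))"
  have l: "l > 0" by (simp add: l_def)
  have "(\<Sum>\<nu>=-int r..int r. complex_of_real (cos ((\<theta> + 2 * pi * of_int \<nu>) / (2 * real l)) ^ (2 * m))) =
    (\<Sum>\<nu>=-int r..int r. \<Sum>j=-int m..int m. of_real (binom_weight m j) * cis (\<theta> / real l * of_int j) *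
        cis (2 * pi * of_int (j * \<nu>) / real l))"
  proof (subst cos_power_expansion, intro sum.cong refl)
    fix \<nu> j
    have "2 * ((\<theta> + 2 * pi * of_int \<nu>) / (2 * real l)) * of_int j =
       \<theta> / real l * of_int j + 2 * pi * of_int (j * \<nu>) / real l"
      using l by (simp add: field_simps)
    thus "of_real (binom_weight m j) * cis (2 * ((\<theta> + 2 * pi * of_int \<nu>) / (2 * real l)) * of_int j) =
      of_real (binom_weight m j) * cis (\<theta> / real l * of_int j) * cis (2 * pi * of_int (j * \<nu>) / real l)"
      by (simp only: cis_mult[symmetric] mult.assoc)
  qed
  also have "\<dots> = (\<Sum>j=-int m..int m. g j)"
    unfolding g_def l_def
    by (subst sum.swap, subst sum_distrib_left[symmetric], subst sum_cis_root_of_unity) (rule refl)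
  also have "\<dots> = (\<Sum>j\<in>(\<lambda>k. int l * k) ` {k. \<bar>int l * k\<bar> \<le> int m}. g j)"
    by (rule sum.mono_neutral_right) (auto simp: g_def elim!: dvdE)
  also have "\<dots> = (\<Sum>k | \<bar>int l * k\<bar> \<le> int m. g (int l * k))"
    using l by (subst sum.reindex) (auto simp: inj_on_def o_def)
  also have "\<dots> = (\<Sum>\<^sub>\<infinity>k. g (int l * k))"
  proof (rule sym, rule infsumI, rule has_sum_finite_neutralI)
    have "{k. \<bar>int l * k\<bar> \<le> int m} \<subseteq> {-int m..int m}"
    proof
      fix k assume "k \<in> {k. \<bar>int l * k\<bar> \<le> int m}"
      moreover have "1 * \<bar>k\<bar> \<le> int l * \<bar>k\<bar>" using l by (intro mult_right_mono) auto
      ultimately show "k \<in> {-int m..int m}" by (auto simp: abs_mult)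
    qed
    thus "finite {k. \<bar>int l * k\<bar> \<le> int m}" by (rule finite_subset) auto
  qed (auto simp: g_def binom_weight_def)
  also have "\<dots> = (\<Sum>\<^sub>\<infinity>k. of_real (real l * binom_weight m (int l * k)) * cis (\<theta> * of_int k))"
    using l by (intro infsum_cong) (simp add: g_def mult_ac)
  finally show ?thesis ..
qed

section \<open>Gaussian bounds for cosines and central binomial weights\<close>

lemma cos_le_exp:
  assumes "\<bar>x\<bar> \<le> pi / 2"
  shows "cos x \<le> exp (- (x\<^sup>2 / 3))"
proof -
  \<comment> \<open>Since y <= 1, sin y >= y - y^3/6 >= 5y/6, hence 1 - cos x = 2 (sin y)^2 >= 25
    x^2/72 >= x^2/3. The sharp local constant 1/2 is not aimed at: this is only a majorant.\<close>
  define y where "y = \<bar>x\<bar> / 2"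
  have y: "0 \<le> y" "y \<le> 1" using assms pi_less_4 by (auto simp: y_def)
  have "\<bar>sin y - y\<bar> \<le> y ^ 3 / 6"
    using Maclaurin_sin_bound[of y 3] y by (simp add: sin_coeff_def lessThan_nat_numeral fact_numeral eval_nat_numeral field_simps)
  moreover have "y ^ 3 / 6 \<le> y / 6"
    using y power_decreasing[of 1 3 y] by simp
  ultimately have "5 / 6 * y \<le> sin y" by linarith
  hence "(5 / 6 * y)\<^sup>2 \<le> (sin y)\<^sup>2" using y by (intro power_mono) auto
  hence "2 * (25 / 36 * y\<^sup>2) \<le> 2 * (sin y)\<^sup>2" by (simp add: power_mult_distrib power_divide)
  moreover have "cos x = 1 - 2 * (sin y)\<^sup>2"
    using cos_double_sin[of y] by (simp add: y_def)
  moreover have "y\<^sup>2 = x\<^sup>2 / 4" by (simp add: y_def power_divide)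
  ultimately have "cos x \<le> 1 + (- (x\<^sup>2 / 3))" using zero_le_power2[of x] by linarith
  also have "\<dots> \<le> exp (- (x\<^sup>2 / 3))" by (rule exp_ge_add_one_self)
  finally show ?thesis .
qed

lemma summable_gaussian_int:
  fixes a c :: real
  assumes "c > 0"
  shows "(\<lambda>n::int. exp (- c * (of_int n + a)\<^sup>2)) summable_on UNIV"
proof (rule summable_on_comparison_test)
  show "(\<lambda>n. exp (c * (\<bar>a\<bar> + 1)) * exp (- c) ^ nat \<bar>n\<bar>) summable_on UNIV"
    using assms by (intro summable_on_cmult_right summable_on_power_abs_int) auto
  fix n :: int
  \<comment> \<open>A square exceeds its root minus 1/4; applied to |n| - |a|, this bounds the
    Gaussian by a geometric term in |n|.\<close>
  have "0 \<le> (\<bar>real_of_int n\<bar> - \<bar>a\<bar> - 1 / 2)\<^sup>2" by simp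
  also have "\<dots> = (\<bar>real_of_int n\<bar> - \<bar>a\<bar>)\<^sup>2 - \<bar>real_of_int n\<bar> + \<bar>a\<bar> + 1 / 4"
    by (simp add: power2_eq_square algebra_simps)
  also have "(\<bar>real_of_int n\<bar> - \<bar>a\<bar>)\<^sup>2 \<le> (of_int n + a)\<^sup>2"
  proof -
    have "\<bar>\<bar>real_of_int n\<bar> - \<bar>a\<bar>\<bar> \<le> \<bar>of_int n + a\<bar>" by linarith
    thus ?thesis by (simp add: abs_le_square_iff)
  qed
  finally have "\<bar>real_of_int n\<bar> - (\<bar>a\<bar> + 1) \<le> (of_int n + a)\<^sup>2" by simp
  hence "c * (\<bar>real_of_int n\<bar> - (\<bar>a\<bar> + 1)) \<le> c * (of_int n + a)\<^sup>2"
    using assms by (intro mult_left_mono) auto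
  hence "exp (- c * (of_int n + a)\<^sup>2) \<le> exp (c * (\<bar>a\<bar> + 1) + real (nat \<bar>n\<bar>) * (- c))"
    by (simp add: algebra_simps)
  thus "exp (- c * (of_int n + a)\<^sup>2) \<le> exp (c * (\<bar>a\<bar> + 1)) * exp (- c) ^ nat \<bar>n\<bar>"
    by (simp only: exp_add exp_of_nat_mult)
qed auto

text \<open>The square of the m-th term is exactly the reciprocal of the Wallis product
  \<open>W m\<close>, which tends to pi/2.\<close>

lemma central_binom_limit:
  "(\<lambda>m. binom_weight m 0 * sqrt (real (2 * m + 1))) \<longlonglongrightarrow> sqrt (2 / pi)"
proof -
  define W where "W = (\<lambda>n::nat. \<Prod>k=1..n. (4 * real k ^ 2) / (4 * real k ^ 2 - 1))"
  have rec: "binom_weight (Suc m) 0 = binom_weight m 0 * ((2 * real m + 1) / (2 * real m + 2))" for m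
  proof -
    have fact: "binom_weight m 0 = fact (2 * m) / (fact m * fact m) / 4 ^ m" for m
      by (simp add: binom_weight_def binomial_fact)
    have f1: "fact (2 * Suc m) = (2 * real m + 2) * (2 * real m + 1) * fact (2 * m)"
      by (simp add: algebra_simps)
    have f2: "fact (Suc m) = (real m + 1) * fact m"
      by (simp add: algebra_simps)
    have "binom_weight (Suc m) 0 = (2 * real m + 2) * (2 * real m + 1) * fact (2 * m) /
        ((real m + 1) * fact m * ((real m + 1) * fact m)) / (4 * 4 ^ m)"
      unfolding fact f1 f2 power_Suc ..
    also have "\<dots> = binom_weight m 0 * ((2 * real m + 1) / (2 * real m + 2))"
      unfolding fact by (simp add: divide_simps) (simp add: algebra_simps)
    finally show ?thesis .
  qed
  have W: "(binom_weight m 0)\<^sup>2 * real (2 * m + 1) = inverse (W m)" for m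
  proof (induction m)
    case 0
    show ?case by (simp add: W_def binom_weight_def)
  next
    case (Suc m)
    have "W (Suc m) = W m * (4 * (real m + 1) ^ 2 / ((2 * real m + 1) * (2 * real m + 3)))"
      by (simp add: W_def power2_eq_square algebra_simps)
    hence "inverse (W (Suc m)) = inverse (W m) * ((2 * real m + 1) * (2 * real m + 3) / (4 * (real m + 1) ^ 2))"
      by (simp add: field_simps)
    also have "\<dots> = (binom_weight (Suc m) 0)\<^sup>2 * real (2 * Suc m + 1)"
      unfolding Suc.IH[symmetric] rec
      by (simp add: divide_simps power2_eq_square) (simp add: algebra_simps)
    finally show ?case ..
  qed
  have "W \<longlonglongrightarrow> pi / 2" unfolding W_def by (rule wallis)
  hence "(\<lambda>m. sqrt (inverse (W m))) \<longlonglongrightarrow> sqrt (inverse (pi / 2))"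
    by (intro tendsto_intros) auto
  moreover have "sqrt (inverse (W m)) = binom_weight m 0 * sqrt (real (2 * m + 1))" for m
    unfolding W[symmetric] by (simp add: real_sqrt_mult binom_weight_def)
  ultimately show ?thesis by simp
qed

lemma binom_weight_nonneg: "binom_weight m j \<ge> 0"
  by (simp add: binom_weight_def)

lemma binom_weight_minus: "binom_weight m (- j) = binom_weight m j"
proof (cases "\<bar>j\<bar> \<le> int m")
  case True
  have "(2 * m) choose nat (int m + j) = (2 * m) choose (2 * m - nat (int m + j))"
    using True by (intro binomial_symmetric) auto
  also have "2 * m - nat (int m + j) = nat (int m + - j)"
    using True by auto
  finally show ?thesis by (simp add: binom_weight_def)
qed (auto simp: binom_weight_def)

lemma binom_weight_Suc:
  assumes "j < m"
  shows "binom_weight m (int (Suc j)) = binom_weight m (int j) * (real (m - j) / real (m + j + 1))"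
proof -
  have "(m + j + 1) * ((2 * m) choose (m + j + 1)) = (m - j) * ((2 * m) choose (m + j))"
    using binomial_absorb_comp[of "2 * m" "m + j"] binomial_absorption[of "m + j" "2 * m"] assms
    by simp
  hence "real (m + j + 1) * real ((2 * m) choose (m + j + 1)) = real (m - j) * real ((2 * m) choose (m + j))"
    by (metis of_nat_mult)
  moreover have "nat (int m + int (Suc j)) = m + j + 1" "nat (int m + int j) = m + j" by auto
  ultimately show ?thesis using assms unfolding binom_weight_def
    by (simp add: divide_simps del: of_nat_Suc of_nat_add) (simp add: mult_ac)
qed

text \<open>Consecutive weights have ratio 1 - (2i+1)/(m+i+1) <= exp(-(2i+1)/M), and the odd numbers
  2i+1 for i < j add up to j^2.\<close>

lemma binom_weight_upper:
  assumes "j \<le> m" "real (m + j) \<le> M" "M > 0"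
  shows "binom_weight m (int j) \<le> binom_weight m 0 * exp (- ((real j)\<^sup>2 / M))"
  using assms(1,2)
proof (induction j)
  case (Suc j)
  have IH: "binom_weight m (int j) \<le> binom_weight m 0 * exp (- ((real j)\<^sup>2 / M))"
    using Suc by auto
  have less: "j < m" using Suc.prems by simp
  have "real (m - j) / real (m + j + 1) = 1 - (2 * real j + 1) / real (m + j + 1)"
    using Suc.prems by (simp add: of_nat_diff field_simps)
  also have "\<dots> \<le> 1 + (- ((2 * real j + 1) / M))"
    using Suc.prems assms(3) by (auto intro!: divide_left_mono)
  also have "\<dots> \<le> exp (- ((2 * real j + 1) / M))" by (rule exp_ge_add_one_self)
  finally have "binom_weight m (int (Suc j)) \<le>
      binom_weight m 0 * exp (- ((real j)\<^sup>2 / M)) * exp (- ((2 * real j + 1) / M))"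
    unfolding binom_weight_Suc[OF less] using binom_weight_nonneg by (intro mult_mono IH mult_nonneg_nonneg) auto
  moreover have "exp (- ((real j)\<^sup>2 / M)) * exp (- ((2 * real j + 1) / M)) = exp (- ((real (Suc j))\<^sup>2 / M))"
    by (simp add: power2_eq_square add_divide_distrib algebra_simps flip: exp_add)
  ultimately show ?case by (simp only: mult.assoc)
qed simp

text \<open>Here the inverse ratio 1 + (2i+1)/(m-i) is bounded by the exponential. \<open>M\<close>
  must therefore lie below every m - i, while in the upper bound it lies above every m + i +
  1.\<close>

lemma binom_weight_lower:
  assumes "real j \<le> real m - M" "M > 0"
  shows "binom_weight m 0 * exp (- ((real j)\<^sup>2 / M)) \<le> binom_weight m (int j)"
  using assms(1)
proof (induction j)
  case (Suc j)
  have IH: "binom_weight m 0 * exp (- ((real j)\<^sup>2 / M)) \<le> binom_weight m (int j)"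
    using Suc by auto
  have less: "j < m" using Suc.prems assms(2) by linarith
  have "exp (- ((2 * real j + 1) / M)) \<le> exp (- ((2 * real j + 1) / real (m - j)))"
    using Suc.prems assms(2) less by (auto simp: of_nat_diff intro!: divide_left_mono)
  also have "\<dots> = inverse (exp ((2 * real j + 1) / real (m - j)))"
    by (rule exp_minus)
  also have "\<dots> \<le> inverse (1 + (2 * real j + 1) / real (m - j))"
    by (intro le_imp_inverse_le exp_ge_add_one_self) (auto intro!: add_pos_nonneg)
  also have "\<dots> = real (m - j) / real (m + j + 1)"
    using less by (simp add: of_nat_diff field_simps)
  finally have "binom_weight m 0 * exp (- ((real j)\<^sup>2 / M)) * exp (- ((2 * real j + 1) / M)) \<le> 
      binom_weight m (int (Suc j))"
    unfolding binom_weight_Suc[OF less] using binom_weight_nonneg by (intro mult_mono IH mult_nonneg_nonneg) auto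
  moreover have "exp (- ((real j)\<^sup>2 / M)) * exp (- ((2 * real j + 1) / M)) = exp (- ((real (Suc j))\<^sup>2 / M))"
    by (simp add: power2_eq_square add_divide_distrib algebra_simps flip: exp_add)
  ultimately show ?case by (simp only: mult.assoc)
qed simp

section \<open>Polya's scaling limit\<close>

context
  fixes \<alpha> :: real
  assumes \<alpha>: "\<alpha> > 0"
begin

text \<open>\<open>len\<close> and \<open>hgt\<close> are the l and m of
  \<open>polya_identity\<close>. As the width of the binomial distribution is of order sqrt m, the
  scaling m ~ alpha l^2 keeps the distance l k at a fixed multiple of that width.\<close>

definition len :: "nat \<Rightarrow> nat" where "len r = 2 * r + 1"
definition hgt :: "nat \<Rightarrow> nat" where "hgt r = nat \<lceil>\<alpha> * real (len r) ^ 2\<rceil>"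

lemma len_pos: "real (len r) > 0"
  by (simp add: len_def)

lemma hgt_bounds: "\<alpha> * real (len r) ^ 2 \<le> real (hgt r)" "real (hgt r) \<le> \<alpha> * real (len r) ^ 2 + 1"
proof -
  have "\<alpha> * real (len r) ^ 2 \<ge> 0" using \<alpha> by simp
  thus "\<alpha> * real (len r) ^ 2 \<le> real (hgt r)" "real (hgt r) \<le> \<alpha> * real (len r) ^ 2 + 1"
    unfolding hgt_def by linarith+
qed

lemma len_at_top: "filterlim (\<lambda>r. real (len r)) at_top sequentially"
  unfolding len_def by real_asymp

lemma hgt_at_top: "filterlim hgt at_top sequentially"
proof -
  have "filterlim (\<lambda>r. \<alpha> * real (len r) ^ 2) at_top sequentially"
    using \<alpha> unfolding len_def by real_asymp
  hence "filterlim (\<lambda>r. real (hgt r)) at_top sequentially"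
    by (rule filterlim_at_top_mono) (simp add: hgt_bounds)
  thus ?thesis by (simp add: filterlim_sequentially_iff_filterlim_real)
qed

lemma hgt_ratio: "(\<lambda>r. real (hgt r) / real (len r) ^ 2) \<longlonglongrightarrow> \<alpha>"
proof (rule tendsto_sandwich)
  show "\<forall>\<^sub>F r in sequentially. \<alpha> \<le> real (hgt r) / real (len r) ^ 2"
    using hgt_bounds(1) len_pos by (intro always_eventually) (auto simp: field_simps)
  show "\<forall>\<^sub>F r in sequentially. real (hgt r) / real (len r) ^ 2 \<le> \<alpha> + 1 / real (len r) ^ 2"
    using hgt_bounds(2) len_pos by (intro always_eventually) (auto simp: field_simps)
  show "(\<lambda>r. \<alpha> + 1 / real (len r) ^ 2) \<longlonglongrightarrow> \<alpha>"
    unfolding len_def by real_asymp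
qed simp

lemma central_limit: "(\<lambda>r. real (len r) * binom_weight (hgt r) 0) \<longlonglongrightarrow> 1 / sqrt (pi * \<alpha>)"
proof -
  have "(\<lambda>r. sqrt (2 * (real (hgt r) / real (len r) ^ 2) + 1 / real (len r) ^ 2)) \<longlonglongrightarrow> sqrt (2 * \<alpha> + 0)"
  proof (intro tendsto_intros hgt_ratio)
    show "(\<lambda>r. 1 / real (len r) ^ 2) \<longlonglongrightarrow> 0" unfolding len_def by real_asymp
  qed
  moreover have "(\<lambda>r. binom_weight (hgt r) 0 * sqrt (real (2 * hgt r + 1))) \<longlonglongrightarrow> sqrt (2 / pi)"
    by (rule filterlim_compose[OF central_binom_limit hgt_at_top])
  ultimately have "(\<lambda>r. binom_weight (hgt r) 0 * sqrt (real (2 * hgt r + 1)) / 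
      sqrt (2 * (real (hgt r) / real (len r) ^ 2) + 1 / real (len r) ^ 2)) \<longlonglongrightarrow> sqrt (2 / pi) / sqrt (2 * \<alpha> + 0)"
    using \<alpha> by (intro tendsto_divide) auto
  moreover have "sqrt (2 / pi) / sqrt (2 * \<alpha> + 0) = 1 / sqrt (pi * \<alpha>)"
    using \<alpha> by (simp add: real_sqrt_divide real_sqrt_mult)
  moreover have "binom_weight (hgt r) 0 * sqrt (real (2 * hgt r + 1)) / 
      sqrt (2 * (real (hgt r) / real (len r) ^ 2) + 1 / real (len r) ^ 2) = real (len r) * binom_weight (hgt r) 0" for r
  proof -
    have "2 * (real (hgt r) / real (len r) ^ 2) + 1 / real (len r) ^ 2 = real (2 * hgt r + 1) / real (len r) ^ 2"
      by (simp add: add_divide_distrib)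
    hence "sqrt (2 * (real (hgt r) / real (len r) ^ 2) + 1 / real (len r) ^ 2) = sqrt (real (2 * hgt r + 1)) / real (len r)"
      using len_pos[of r] by (simp add: real_sqrt_divide)
    moreover have "sqrt (real (2 * hgt r + 1)) > 0" by simp
    ultimately show ?thesis using len_pos[of r] by (simp add: field_simps del: of_nat_add of_nat_mult)
  qed
  ultimately show ?thesis by simp
qed

text \<open>The weight is squeezed between the two binomial bounds with M = m - l k and M = m + l k;
  both are asymptotic to alpha l^2, so both exponents tend to -k^2/alpha.\<close>

lemma weight_limit_nat:
  "(\<lambda>r. real (len r) * binom_weight (hgt r) (int (len r * k))) \<longlonglongrightarrow> 1 / sqrt (pi * \<alpha>) * exp (- ((real k)\<^sup>2 / \<alpha>))"
proof (rule tendsto_sandwich)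
  define L where "L = (\<lambda>r. real (hgt r) - real (len r * k))"
  define U where "U = (\<lambda>r. real (hgt r) + real (len r * k))"
  have lim0: "(\<lambda>r. real k / real (len r)) \<longlonglongrightarrow> 0"
    by (rule tendsto_divide_0[OF tendsto_const filterlim_at_top_imp_at_infinity[OF len_at_top]])
  have sq: "(real (len r * k))\<^sup>2 / X = (real k)\<^sup>2 / (X / real (len r) ^ 2)" for r X
    using len_pos[of r] by (simp add: power_mult_distrib field_simps)
  have "(\<lambda>r. real (hgt r) / real (len r) ^ 2 - real k / real (len r)) \<longlonglongrightarrow> \<alpha> - 0"
    by (intro tendsto_diff hgt_ratio lim0)
  moreover have "real (hgt r) / real (len r) ^ 2 - real k / real (len r) = L r / real (len r) ^ 2" for r
    using len_pos[of r] by (simp add: L_def power2_eq_square diff_divide_distrib)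
  ultimately have L: "(\<lambda>r. L r / real (len r) ^ 2) \<longlonglongrightarrow> \<alpha>" by simp
  have "(\<lambda>r. real (hgt r) / real (len r) ^ 2 + real k / real (len r)) \<longlonglongrightarrow> \<alpha> + 0"
    by (intro tendsto_add hgt_ratio lim0)
  moreover have "real (hgt r) / real (len r) ^ 2 + real k / real (len r) = U r / real (len r) ^ 2" for r
    using len_pos[of r] by (simp add: U_def power2_eq_square add_divide_distrib)
  ultimately have U: "(\<lambda>r. U r / real (len r) ^ 2) \<longlonglongrightarrow> \<alpha>" by simp
  have "\<forall>\<^sub>F r in sequentially. L r / real (len r) ^ 2 > 0"
    using L \<alpha> by (rule order_tendstoD)
  hence L_pos: "\<forall>\<^sub>F r in sequentially. L r > 0"
    by eventually_elim (use len_pos in \<open>auto simp: zero_less_divide_iff\<close>)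
  show "\<forall>\<^sub>F r in sequentially. real (len r) * binom_weight (hgt r) 0 * exp (- ((real (len r * k))\<^sup>2 / L r))
           \<le> real (len r) * binom_weight (hgt r) (int (len r * k))"
    using L_pos
  proof eventually_elim
    case (elim r)
    thus ?case using binom_weight_lower[of "len r * k" "hgt r" "L r"] len_pos[of r]
      by (simp add: L_def mult.assoc)
  qed
  show "\<forall>\<^sub>F r in sequentially. real (len r) * binom_weight (hgt r) (int (len r * k)) \<le>
          real (len r) * binom_weight (hgt r) 0 * exp (- ((real (len r * k))\<^sup>2 / U r))"
    using L_pos
  proof eventually_elim
    case (elim r)
    hence "len r * k < hgt r" unfolding L_def by linarith
    moreover from this have "U r > 0" unfolding U_def by linarith
    ultimately show ?case using binom_weight_upper[of "len r * k" "hgt r" "U r"] len_pos[of r]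
      by (simp add: U_def mult.assoc)
  qed
  show "(\<lambda>r. real (len r) * binom_weight (hgt r) 0 * exp (- ((real (len r * k))\<^sup>2 / L r)))
          \<longlonglongrightarrow> 1 / sqrt (pi * \<alpha>) * exp (- ((real k)\<^sup>2 / \<alpha>))"
    unfolding sq using \<alpha> by (intro tendsto_intros central_limit L) auto
  show "(\<lambda>r. real (len r) * binom_weight (hgt r) 0 * exp (- ((real (len r * k))\<^sup>2 / U r)))
          \<longlonglongrightarrow> 1 / sqrt (pi * \<alpha>) * exp (- ((real k)\<^sup>2 / \<alpha>))"
    unfolding sq using \<alpha> by (intro tendsto_intros central_limit U) auto
qed

lemma weight_limit:
  "(\<lambda>r. real (len r) * binom_weight (hgt r) (int (len r) * k)) \<longlonglongrightarrow> 1 / sqrt (pi * \<alpha>) * exp (- ((of_int k)\<^sup>2 / \<alpha>))"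
proof (cases "k \<ge> 0")
  case True
  thus ?thesis using weight_limit_nat[of "nat k"] by simp
next
  case False
  have "binom_weight (hgt r) (int (len r) * k) = binom_weight (hgt r) (int (len r * nat (- k)))" for r
    using False binom_weight_minus[of "hgt r" "int (len r) * k"] by simp
  thus ?thesis using weight_limit_nat[of "nat (- k)"] False by simp
qed

text \<open>A nonzero weight has l |k| <= m, so m + l |k| <= 2m <= 2 (alpha + 1) l^2. With this
  \<open>M\<close> the exponent in \<open>binom_weight_upper\<close> no longer depends on r.\<close>

lemma weight_bound:
  obtains C where "C > 0" "\<And>r k. real (len r) * binom_weight (hgt r) (int (len r) * k) \<le> 
     C * exp (- (1 / (2 * (\<alpha> + 1))) * (of_int k)\<^sup>2)"
proof -
  have "convergent (\<lambda>r. real (len r) * binom_weight (hgt r) 0)"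
    using central_limit by (auto simp: convergent_def)
  then obtain C where C: "C > 0" "\<And>r. norm (real (len r) * binom_weight (hgt r) 0) \<le> C"
    by (elim BseqE[OF convergent_imp_Bseq]) blast
  have nat: "real (len r) * binom_weight (hgt r) (int (len r * k)) \<le> C * exp (- (1 / (2 * (\<alpha> + 1))) * (real k)\<^sup>2)" for r k
  proof (cases "len r * k \<le> hgt r")
    case False
    hence "binom_weight (hgt r) (int (len r * k)) = 0"
      by (auto simp: binom_weight_def simp del: of_nat_mult)
    thus ?thesis using C(1) by simp
  next
    case True
    define M where "M = 2 * (\<alpha> + 1) * real (len r) ^ 2"
    have len1: "1 \<le> real (len r) ^ 2" by (simp add: len_def)
    have M_pos: "M > 0" using \<alpha> len_pos[of r] by (simp add: M_def)
    have "real (hgt r + len r * k) \<le> 2 * real (hgt r)" using True by linarith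
    also have "\<dots> \<le> 2 * (\<alpha> * real (len r) ^ 2 + real (len r) ^ 2)"
      using hgt_bounds(2)[of r] len1 by (intro mult_left_mono) auto
    also have "\<dots> = M" by (simp add: M_def algebra_simps)
    finally have M: "real (hgt r + len r * k) \<le> M" .
    have "real (len r) * binom_weight (hgt r) (int (len r * k)) \<le> 
      real (len r) * binom_weight (hgt r) 0 * exp (- ((real (len r * k))\<^sup>2 / M))"
      using binom_weight_upper[OF True M M_pos] len_pos[of r] by (simp add: mult.assoc)
    also have "\<dots> \<le> C * exp (- ((real (len r * k))\<^sup>2 / M))"
      using C(2)[of r] by (intro mult_right_mono) auto
    also have "(real (len r * k))\<^sup>2 / M = 1 / (2 * (\<alpha> + 1)) * (real k)\<^sup>2"
    proof -
      have "(real (len r))\<^sup>2 \<noteq> 0" "\<alpha> + 1 \<noteq> 0" using len_pos[of r] \<alpha> by auto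
      thus ?thesis by (simp add: M_def power_mult_distrib divide_simps)
    qed
    finally show ?thesis by simp
  qed
  have "real (len r) * binom_weight (hgt r) (int (len r) * k) \<le> C * exp (- (1 / (2 * (\<alpha> + 1))) * (of_int k)\<^sup>2)" for r k
  proof (cases "k \<ge> 0")
    case True
    thus ?thesis using nat[of r "nat k"] by simp
  next
    case False
    have "binom_weight (hgt r) (int (len r) * k) = binom_weight (hgt r) (int (len r * nat (- k)))"
      using False binom_weight_minus[of "hgt r" "int (len r) * k"] by simp
    thus ?thesis using nat[of r "nat (- k)"] False by simp
  qed
  with C(1) show ?thesis by (rule that)
qed

lemma cos_power_limit:
  "(\<lambda>r. cos (y / real (len r)) ^ (2 * hgt r)) \<longlonglongrightarrow> exp (- (\<alpha> * y\<^sup>2))"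
proof (rule Lim_transform_eventually)
  have "(\<lambda>r. real (len r) ^ 2 * ln (cos (y / real (len r)))) \<longlonglongrightarrow> - (y\<^sup>2 / 2)"
    unfolding len_def power2_eq_square[of y] by real_asymp
  hence "(\<lambda>r. exp (2 * (real (hgt r) / real (len r) ^ 2) * (real (len r) ^ 2 * ln (cos (y / real (len r)))))) \<longlonglongrightarrow> 
     exp (2 * \<alpha> * (- (y\<^sup>2 / 2)))"
    by (intro tendsto_intros hgt_ratio)
  thus "(\<lambda>r. exp (2 * (real (hgt r) / real (len r) ^ 2) * (real (len r) ^ 2 * ln (cos (y / real (len r)))))) \<longlonglongrightarrow> 
     exp (- (\<alpha> * y\<^sup>2))" by simp
  have "(\<lambda>r. cos (y / real (len r))) \<longlonglongrightarrow> cos 0"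
    by (intro tendsto_cos tendsto_divide_0[OF tendsto_const filterlim_at_top_imp_at_infinity[OF len_at_top]])
  hence "\<forall>\<^sub>F r in sequentially. cos (y / real (len r)) > 0"
    by (rule order_tendstoD) simp
  thus "\<forall>\<^sub>F r in sequentially. exp (2 * (real (hgt r) / real (len r) ^ 2) * (real (len r) ^ 2 * ln (cos (y / real (len r))))) =
      cos (y / real (len r)) ^ (2 * hgt r)"
  proof eventually_elim
    case (elim r)
    have "2 * (real (hgt r) / real (len r) ^ 2) * (real (len r) ^ 2 * ln (cos (y / real (len r)))) = 
       real (2 * hgt r) * ln (cos (y / real (len r)))"
      using len_pos[of r] by simp
    thus ?case using elim by (simp only: exp_of_nat_mult exp_ln)
  qed
qed

lemma cos_power_bound:
  assumes "\<bar>y / real (len r)\<bar> \<le> pi / 2"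
  shows "cos (y / real (len r)) ^ (2 * hgt r) \<le> exp (- (\<alpha> * y\<^sup>2 / 3))"
proof -
  have "cos (y / real (len r)) ^ (2 * hgt r) \<le> exp (- ((y / real (len r))\<^sup>2 / 3)) ^ (2 * hgt r)"
  proof (intro power_mono cos_le_exp cos_ge_zero)
    show "- (pi / 2) \<le> y / real (len r)" "y / real (len r) \<le> pi / 2" using assms by linarith+
  qed (rule assms)
  also have "\<dots> = exp (real (2 * hgt r) * (- ((y / real (len r))\<^sup>2 / 3)))"
    by (rule exp_of_nat_mult[symmetric])
  also have "\<dots> \<le> exp (- (\<alpha> * y\<^sup>2 / 3))"
  proof -
    have "\<alpha> * real (len r) ^ 2 \<le> real (2 * hgt r)" using hgt_bounds(1)[of r] by simp
    hence "\<alpha> * real (len r) ^ 2 * ((y / real (len r))\<^sup>2 / 3) \<le> real (2 * hgt r) * ((y / real (len r))\<^sup>2 / 3)"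
      by (intro mult_right_mono) auto
    moreover have "\<alpha> * real (len r) ^ 2 * ((y / real (len r))\<^sup>2 / 3) = \<alpha> * y\<^sup>2 / 3"
      using len_pos[of r] by (simp add: power_divide)
    ultimately show ?thesis unfolding exp_le_cancel_iff by linarith
  qed
  finally show ?thesis .
qed

text \<open>Both sides are limits of the two sides of \<open>polya_identity\<close>: the weights at
  multiples of l yield one Gaussian, the powers of cosines the other. The condition on theta keeps
  |theta + 2 pi nu| / (2l) <= pi/2 for |nu| <= r, where \<open>cos_le_exp\<close> supplies a
  majorant independent of r.\<close>

lemma gaussian_duality:
  assumes \<theta>: "\<bar>\<theta>\<bar> \<le> pi"
  shows "(\<Sum>\<^sub>\<infinity>k::int. of_real (1 / sqrt (pi * \<alpha>) * exp (- ((of_int k)\<^sup>2 / \<alpha>))) * cis (\<theta> * of_int k)) =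
         (\<Sum>\<^sub>\<infinity>\<nu>::int. complex_of_real (exp (- (\<alpha> * ((\<theta> + 2 * pi * of_int \<nu>) / 2)\<^sup>2))))"
proof (rule LIMSEQ_unique)
  obtain C where C: "C > 0" "\<And>r k. real (len r) * binom_weight (hgt r) (int (len r) * k) \<le> 
     C * exp (- (1 / (2 * (\<alpha> + 1))) * (of_int k)\<^sup>2)" using weight_bound by blast
  show "(\<lambda>r. \<Sum>\<^sub>\<infinity>k. of_real (real (len r) * binom_weight (hgt r) (int (len r) * k)) * cis (\<theta> * of_int k))
     \<longlonglongrightarrow> (\<Sum>\<^sub>\<infinity>k::int. of_real (1 / sqrt (pi * \<alpha>) * exp (- ((of_int k)\<^sup>2 / \<alpha>))) * cis (\<theta> * of_int k))"
  proof (rule infsum_dominated_convergence)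
    fix r k
    show "norm (of_real (real (len r) * binom_weight (hgt r) (int (len r) * k)) * cis (\<theta> * of_int k)) \<le>
        C * exp (- (1 / (2 * (\<alpha> + 1))) * (of_int k + 0)\<^sup>2)"
      using C(2)[of r k] len_pos[of r] binom_weight_nonneg[of "hgt r" "int (len r) * k"]
      by (simp add: norm_mult del: of_real_mult)
  next
    show "(\<lambda>k. C * exp (- (1 / (2 * (\<alpha> + 1))) * (of_int k + 0)\<^sup>2)) summable_on UNIV"
      using \<alpha> by (intro summable_on_cmult_right summable_gaussian_int) auto
  qed (intro tendsto_mult tendsto_of_real weight_limit tendsto_const)
  \<comment> \<open>Extension by zero turns finite sums of growing range into sums over all
    integers, so that dominated convergence applies.\<close>
  define h where "h = (\<lambda>r \<nu>. if \<bar>\<nu>\<bar> \<le> int r then complex_of_real (cos ((\<theta> + 2 * pi * of_int \<nu>) / (2 * real (len r))) ^ (2 * hgt r)) else 0)"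
  have "(\<lambda>r. infsum (h r) UNIV) \<longlonglongrightarrow> (\<Sum>\<^sub>\<infinity>\<nu>::int. complex_of_real (exp (- (\<alpha> * ((\<theta> + 2 * pi * of_int \<nu>) / 2)\<^sup>2))))"
  proof (rule infsum_dominated_convergence)
    fix \<nu> :: int
    show "(\<lambda>r. h r \<nu>) \<longlonglongrightarrow> complex_of_real (exp (- (\<alpha> * ((\<theta> + 2 * pi * of_int \<nu>) / 2)\<^sup>2)))"
    proof (rule Lim_transform_eventually)
      show "(\<lambda>r. complex_of_real (cos ((\<theta> + 2 * pi * of_int \<nu>) / 2 / real (len r)) ^ (2 * hgt r))) \<longlonglongrightarrow>
         complex_of_real (exp (- (\<alpha> * ((\<theta> + 2 * pi * of_int \<nu>) / 2)\<^sup>2)))"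
        by (intro tendsto_of_real cos_power_limit)
      show "\<forall>\<^sub>F r in sequentially. complex_of_real (cos ((\<theta> + 2 * pi * of_int \<nu>) / 2 / real (len r)) ^ (2 * hgt r)) = h r \<nu>"
        using eventually_ge_at_top[of "nat \<bar>\<nu>\<bar>"] by eventually_elim (auto simp: h_def)
    qed
  next
    fix r \<nu>
    have eq: "\<alpha> * ((\<theta> + 2 * pi * of_int \<nu>) / 2)\<^sup>2 / 3 = \<alpha> * pi\<^sup>2 / 3 * (of_int \<nu> + \<theta> / (2 * pi))\<^sup>2"
      by (simp add: power2_eq_square field_simps)
    show "norm (h r \<nu>) \<le> exp (- (\<alpha> * pi\<^sup>2 / 3) * (of_int \<nu> + \<theta> / (2 * pi))\<^sup>2)"
    proof (cases "\<bar>\<nu>\<bar> \<le> int r")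
      case True
      have "\<bar>\<theta> + 2 * pi * of_int \<nu>\<bar> \<le> \<bar>\<theta>\<bar> + \<bar>2 * pi * of_int \<nu>\<bar>" by (rule abs_triangle_ineq)
      also have "\<dots> \<le> pi + 2 * pi * real r"
        using \<theta> True by (auto simp: abs_mult intro!: add_mono)
      also have "\<dots> = pi * real (len r)" by (simp add: len_def algebra_simps)
      finally have "\<bar>(\<theta> + 2 * pi * of_int \<nu>) / 2 / real (len r)\<bar> \<le> pi / 2"
        using len_pos[of r] by (simp add: field_simps)
      moreover have "cos ((\<theta> + 2 * pi * of_int \<nu>) / 2 / real (len r)) ^ (2 * hgt r) \<ge> 0"
        by (intro zero_le_even_power) auto
      ultimately show ?thesis
        using True cos_power_bound[of "(\<theta> + 2 * pi * of_int \<nu>) / 2" r] by (simp add: h_def eq norm_power power_abs[symmetric] del: of_real_power)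
    qed (simp add: h_def)
  next
    show "(\<lambda>\<nu>. exp (- (\<alpha> * pi\<^sup>2 / 3) * (of_int \<nu> + \<theta> / (2 * pi))\<^sup>2)) summable_on UNIV"
      using \<alpha> by (intro summable_gaussian_int) auto
  qed
  moreover have "infsum (h r) UNIV = 
    (\<Sum>\<^sub>\<infinity>k. of_real (real (len r) * binom_weight (hgt r) (int (len r) * k)) * cis (\<theta> * of_int k))" for r
  proof -
    have "infsum (h r) UNIV = (\<Sum>\<nu>=-int r..int r. h r \<nu>)"
      by (intro infsumI has_sum_finite_neutralI) (auto simp: h_def)
    also have "\<dots> = (\<Sum>\<nu>=-int r..int r. complex_of_real (cos ((\<theta> + 2 * pi * of_int \<nu>) / (2 * real (len r))) ^ (2 * hgt r)))"
      by (intro sum.cong) (auto simp: h_def)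
    also have "\<dots> = (\<Sum>\<^sub>\<infinity>k. of_real (real (len r) * binom_weight (hgt r) (int (len r) * k)) * cis (\<theta> * of_int k))"
      unfolding len_def by (rule polya_identity[symmetric])
    finally show ?thesis .
  qed
  ultimately show "(\<lambda>r. \<Sum>\<^sub>\<infinity>k. of_real (real (len r) * binom_weight (hgt r) (int (len r) * k)) * cis (\<theta> * of_int k))
     \<longlonglongrightarrow> (\<Sum>\<^sub>\<infinity>\<nu>::int. complex_of_real (exp (- (\<alpha> * ((\<theta> + 2 * pi * of_int \<nu>) / 2)\<^sup>2))))"
    by simp
qed

end

subsection \<open>Theta functions and their inversion formula\<close>

text \<open>This is \<open>gaussian_duality\<close> with alpha = s/pi and theta = 2 pi a.\<close>

lemma poisson_gaussian:
  assumes s: "s > 0" and a: "\<bar>a\<bar> \<le> 1 / 2"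
  shows "(\<Sum>\<^sub>\<infinity>n::int. complex_of_real (exp (- (pi * s) * (of_int n + a)\<^sup>2))) =
         of_real (1 / sqrt s) * (\<Sum>\<^sub>\<infinity>k::int. of_real (exp (- (pi / s) * (of_int k)\<^sup>2)) * cis (2 * pi * a * of_int k))"
proof -
  have \<alpha>: "s / pi > 0" using s by simp
  have \<theta>: "\<bar>2 * pi * a\<bar> \<le> pi" using a by (simp add: abs_mult)
  have "(\<Sum>\<^sub>\<infinity>n::int. complex_of_real (exp (- (pi * s) * (of_int n + a)\<^sup>2))) =
    (\<Sum>\<^sub>\<infinity>\<nu>::int. complex_of_real (exp (- (s / pi * ((2 * pi * a + 2 * pi * of_int \<nu>) / 2)\<^sup>2))))"
  proof (rule infsum_cong)
    fix n :: int
    have "s / pi * ((2 * pi * a + 2 * pi * of_int n) / 2)\<^sup>2 = pi * s * (of_int n + a)\<^sup>2"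
      by (simp add: power2_eq_square field_simps)
    thus "complex_of_real (exp (- (pi * s) * (of_int n + a)\<^sup>2)) =
      complex_of_real (exp (- (s / pi * ((2 * pi * a + 2 * pi * of_int n) / 2)\<^sup>2)))" by simp
  qed
  also have "\<dots> = (\<Sum>\<^sub>\<infinity>k::int. of_real (1 / sqrt (pi * (s / pi)) * exp (- ((of_int k)\<^sup>2 / (s / pi)))) * cis (2 * pi * a * of_int k))"
    by (rule gaussian_duality[OF \<alpha> \<theta>, symmetric])
  also have "\<dots> = (\<Sum>\<^sub>\<infinity>k::int. of_real (1 / sqrt s) * (of_real (exp (- (pi / s) * (of_int k)\<^sup>2)) * cis (2 * pi * a * of_int k)))"
    by (intro infsum_cong) (simp add: mult_ac)
  also have "\<dots> = of_real (1 / sqrt s) * (\<Sum>\<^sub>\<infinity>k::int. of_real (exp (- (pi / s) * (of_int k)\<^sup>2)) * cis (2 * pi * a * of_int k))"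
    by (rule infsum_cmult_right')
  finally show ?thesis .
qed

lemma infsum_split_residues:
  fixes g :: "int \<Rightarrow> complex"
  assumes K: "K > 0" and g: "(\<lambda>n. norm (g n)) summable_on UNIV"
  shows "infsum g UNIV = (\<Sum>i<K. \<Sum>\<^sub>\<infinity>j. g (int K * j + int i))"
proof -
  have inj: "inj (\<lambda>j. int K * j + int i)" for i
    using K by (auto intro!: injI)
  have "(\<Union>i\<in>{..<K}. range (\<lambda>j. int K * j + int i)) = UNIV"
  proof (intro equalityI subsetI)
    fix n :: int
    have "n = int K * (n div int K) + int (nat (n mod int K))" "nat (n mod int K) < K"
      using K by (simp_all add: nat_less_iff)
    thus "n \<in> (\<Union>i\<in>{..<K}. range (\<lambda>j. int K * j + int i))" by blast
  qed auto
  hence "infsum g UNIV = infsum g (\<Union>i\<in>{..<K}. range (\<lambda>j. int K * j + int i))"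
    by simp
  also have "\<dots> = (\<Sum>i<K. infsum g (range (\<lambda>j. int K * j + int i)))"
  proof (rule sum_infsum[symmetric])
    show "g summable_on range (\<lambda>j. int K * j + int i)" for i
      by (rule summable_on_subset_banach[OF abs_summable_summable[OF g]]) simp
    fix i i' assume "i \<in> {..<K}" "i' \<in> {..<K}" "i \<noteq> i'"
    show "range (\<lambda>j. int K * j + int i) \<inter> range (\<lambda>j. int K * j + int i') = {}"
    proof (rule ccontr)
      assume "range (\<lambda>j. int K * j + int i) \<inter> range (\<lambda>j. int K * j + int i') \<noteq> {}"
      then obtain j j' where "int K * j + int i = int K * j' + int i'" by auto
      hence "(int K * j + int i) mod int K = (int K * j' + int i') mod int K" by simp
      with \<open>i \<in> {..<K}\<close> \<open>i' \<in> {..<K}\<close> \<open>i \<noteq> i'\<close> show False by simp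
    qed
  qed simp
  also have "\<dots> = (\<Sum>i<K. \<Sum>\<^sub>\<infinity>j. g (int K * j + int i))"
    by (intro sum.cong refl, subst infsum_reindex[OF inj]) (simp add: o_def)
  finally show ?thesis .
qed

lemma minus_one_powi_even_odd:
  "(-1 :: complex) powi (2 * j) = 1" "(-1 :: complex) powi (2 * j + 1) = -1"
  by (simp_all add: power_int_mult power_int_add)

text \<open>The alternating sum is twice the even terms minus all terms. The even terms form a
  Gaussian series with parameters 4s and a/2; in its dual, the terms of even index cancel the dual
  of the full series, and the odd indices, halved, give j + 1/2.\<close>

lemma alternating_poisson:
  assumes s: "s > 0" and a: "\<bar>a\<bar> \<le> 1 / 2"
  shows "(\<Sum>\<^sub>\<infinity>n::int. (-1) powi n * complex_of_real (exp (- (pi * s) * (of_int n + a)\<^sup>2))) =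
         of_real (1 / sqrt s) *
           (\<Sum>\<^sub>\<infinity>j::int. of_real (exp (- (pi / s) * (of_int j + 1 / 2)\<^sup>2)) * cis (2 * pi * a * (of_int j + 1 / 2)))"
proof -
  define f where "f = (\<lambda>n::int. complex_of_real (exp (- (pi * s) * (of_int n + a)\<^sup>2)))"
  define h where "h = (\<lambda>k::int. of_real (exp (- (pi / (4 * s)) * (of_int k)\<^sup>2)) * cis (pi * a * of_int k))"
  have f_sum: "(\<lambda>n. norm (f n)) summable_on UNIV"
    using summable_gaussian_int[of "pi * s" a] s by (simp add: f_def)
  have h_sum: "(\<lambda>n. norm (h n)) summable_on UNIV"
    using summable_gaussian_int[of "pi / (4 * s)" 0] s by (simp add: h_def norm_mult)
  have two: "{..<2::nat} = {0, 1}" by auto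
  have f_split: "infsum f UNIV = (\<Sum>\<^sub>\<infinity>j. f (2 * j)) + (\<Sum>\<^sub>\<infinity>j. f (2 * j + 1))"
    using infsum_split_residues[of 2, OF _ f_sum] by (simp add: two)
  have h_split: "infsum h UNIV = (\<Sum>\<^sub>\<infinity>j. h (2 * j)) + (\<Sum>\<^sub>\<infinity>j. h (2 * j + 1))"
    using infsum_split_residues[of 2, OF _ h_sum] by (simp add: two)
  have "(\<lambda>n. norm ((-1) powi n * f n)) summable_on UNIV"
    using f_sum by (simp add: norm_mult norm_power_int)
  hence "(\<Sum>\<^sub>\<infinity>n. (-1) powi n * f n) = (\<Sum>\<^sub>\<infinity>j. f (2 * j)) - (\<Sum>\<^sub>\<infinity>j. f (2 * j + 1))"
    using infsum_split_residues[of 2 "\<lambda>n. (-1) powi n * f n"]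
    by (simp add: two minus_one_powi_even_odd infsum_uminus)
  also have "\<dots> = 2 * (\<Sum>\<^sub>\<infinity>j. f (2 * j)) - infsum f UNIV"
    by (simp add: f_split)
  also have "(\<Sum>\<^sub>\<infinity>j. f (2 * j)) = (\<Sum>\<^sub>\<infinity>n::int. complex_of_real (exp (- (pi * (4 * s)) * (of_int n + a / 2)\<^sup>2)))"
    by (intro infsum_cong) (simp add: f_def power2_eq_square field_simps)
  also have "\<dots> = of_real (1 / sqrt (4 * s)) * infsum h UNIV"
    using poisson_gaussian[of "4 * s" "a / 2"] s a by (simp add: h_def)
  also have "infsum f UNIV = of_real (1 / sqrt s) * (\<Sum>\<^sub>\<infinity>k::int. h (2 * k))"
    unfolding f_def poisson_gaussian[OF s a]
    by (intro arg_cong2[of _ _ _ _ "(*)"] refl infsum_cong) (simp add: h_def power_mult_distrib mult_ac)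
  also have "2 * (of_real (1 / sqrt (4 * s)) * infsum h UNIV) - of_real (1 / sqrt s) * (\<Sum>\<^sub>\<infinity>k::int. h (2 * k)) =
     of_real (1 / sqrt s) * (\<Sum>\<^sub>\<infinity>j. h (2 * j + 1))"
    by (simp add: h_split real_sqrt_mult algebra_simps)
  also have "(\<Sum>\<^sub>\<infinity>j. h (2 * j + 1)) = 
    (\<Sum>\<^sub>\<infinity>j::int. of_real (exp (- (pi / s) * (of_int j + 1 / 2)\<^sup>2)) * cis (2 * pi * a * (of_int j + 1 / 2)))"
  proof (rule infsum_cong)
    fix j :: int
    have "- (pi / (4 * s)) * (of_int (2 * j + 1))\<^sup>2 = - (pi / s) * (of_int j + 1 / 2)\<^sup>2"
      using s by (simp add: power2_eq_square field_simps)
    moreover have "pi * a * of_int (2 * j + 1) = 2 * pi * a * (of_int j + 1 / 2)"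
      by (simp add: algebra_simps)
    ultimately show "h (2 * j + 1) = of_real (exp (- (pi / s) * (of_int j + 1 / 2)\<^sup>2)) * cis (2 * pi * a * (of_int j + 1 / 2))"
      by (simp only: h_def)
  qed
  finally show ?thesis by (simp only: f_def)
qed

section \<open>Holomorphy and inversion of the theta series\<close>

lemma open_upper_half_plane: "open upper_half_plane"
  unfolding upper_half_plane_def by (rule open_halfspace_Im_gt)

lemma connected_upper_half_plane: "connected upper_half_plane"
  unfolding upper_half_plane_def by (intro convex_connected convex_halfspace_Im_gt)

lemma norm_theta_term:
  "norm (exp (of_real pi * \<i> * of_real k * \<tau> * (of_int n + of_real a)\<^sup>2)) = exp (- (pi * k * Im \<tau>) * (of_int n + a)\<^sup>2)"
proof -
  have "(of_int n + of_real a :: complex)\<^sup>2 = of_real ((of_int n + a)\<^sup>2)" by simp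
  thus ?thesis unfolding norm_exp_eq_Re by (simp add: mult_ac)
qed

lemma summable_theta_series:
  fixes c :: "int \<Rightarrow> complex"
  assumes "\<And>n. norm (c n) = 1" "k > 0" "Im \<tau> > 0"
  shows "(\<lambda>n. norm (c n * exp (of_real pi * \<i> * of_real k * \<tau> * (of_int n + of_real a)\<^sup>2))) summable_on UNIV"
  unfolding norm_mult norm_theta_term
  using summable_gaussian_int[of "pi * k * Im \<tau>" a] assms by simp

lemma holomorphic_theta_series:
  fixes c :: "int \<Rightarrow> complex"
  assumes c: "\<And>n. norm (c n) = 1" and k: "k > 0"
  shows "(\<lambda>\<tau>. \<Sum>\<^sub>\<infinity>n. c n * exp (of_real pi * \<i> * of_real k * \<tau> * (of_int n + of_real a)\<^sup>2))
           holomorphic_on upper_half_plane"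
proof (rule holomorphic_on_open[OF open_upper_half_plane, THEN iffD2], intro ballI)
  fix z assume "z \<in> upper_half_plane"
  hence z: "Im z > 0" by (simp add: upper_half_plane_def)
  \<comment> \<open>On the closed disc of this radius Im tau >= Im z / 2, so one Gaussian majorant
    serves for all its points.\<close>
  define r where "r = Im z / 2"
  have r: "r > 0" using z by (simp add: r_def)
  let ?f = "\<lambda>X \<tau>. \<Sum>n\<in>X. c n * exp (of_real pi * \<i> * of_real k * \<tau> * (of_int n + of_real a)\<^sup>2)"
  let ?g = "\<lambda>\<tau>. \<Sum>\<^sub>\<infinity>n. c n * exp (of_real pi * \<i> * of_real k * \<tau> * (of_int n + of_real a)\<^sup>2)"
  have "uniform_limit (cball z r) ?f ?g (finite_subsets_at_top UNIV)"
  proof (rule Weierstrass_m_test_general)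
    fix n \<tau> assume "\<tau> \<in> cball z r"
    hence "\<bar>Im (z - \<tau>)\<bar> \<le> r" using abs_Im_le_cmod[of "z - \<tau>"] by (simp add: dist_norm)
    hence "\<bar>Im z - Im \<tau>\<bar> \<le> r" by simp
    hence "r \<le> Im \<tau>" unfolding r_def by linarith
    hence "pi * k * r * (of_int n + a)\<^sup>2 \<le> pi * k * Im \<tau> * (of_int n + a)\<^sup>2"
      using k by (intro mult_right_mono mult_left_mono) auto
    thus "norm (c n * exp (of_real pi * \<i> * of_real k * \<tau> * (of_int n + of_real a)\<^sup>2)) \<le> exp (- (pi * k * r) * (of_int n + a)\<^sup>2)"
      unfolding norm_mult norm_theta_term by (simp add: c)
  qed (use k r in \<open>intro summable_gaussian_int, simp\<close>)
  moreover have "\<forall>\<^sub>F X in finite_subsets_at_top UNIV. continuous_on (cball z r) (?f X) \<and> ?f X holomorphic_on ball z r"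
    by (intro always_eventually allI conjI continuous_intros holomorphic_intros)
  ultimately have "?g holomorphic_on ball z r"
    by (elim holomorphic_uniform_limit) auto
  thus "\<exists>f'. (?g has_field_derivative f') (at z)"
    using r holomorphic_on_open[of "ball z r" ?g] by auto
qed

text \<open>A theta constant with characteristics, the sign being the second one. In particular
  \<open>theta 3 (1 / 6)\<close> is the Dedekind eta function, with exponents (6n+1)^2/24 of
  q.\<close>

definition theta :: "real \<Rightarrow> real \<Rightarrow> complex \<Rightarrow> complex" where
  "theta k a \<tau> = (\<Sum>\<^sub>\<infinity>n::int. (-1) powi n * exp (of_real pi * \<i> * of_real k * \<tau> * (of_int n + of_real a)\<^sup>2))"

lemma holomorphic_theta: "k > 0 \<Longrightarrow> theta k a holomorphic_on upper_half_plane"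
  unfolding theta_def by (rule holomorphic_theta_series) (auto simp: norm_power_int)

lemma minus_inverse_upper_half_plane: "\<tau> \<in> upper_half_plane \<Longrightarrow> -1 / \<tau> \<in> upper_half_plane"
  by (auto simp: upper_half_plane_def Im_divide power2_eq_square intro!: divide_pos_pos add_nonneg_pos mult_pos_pos)

text \<open>For tau = i y this is \<open>alternating_poisson\<close> with s = k/y. Both sides are
  holomorphic, as -i tau/k has positive real part and avoids the cut of \<open>csqrt\<close>, so
  agreement on the imaginary axis extends to the half-plane.\<close>

lemma theta_inversion:
  assumes k: "k > 0" and a: "\<bar>a\<bar> \<le> 1 / 2" and \<tau>: "\<tau> \<in> upper_half_plane"
  shows "theta k a (-1 / \<tau>) = csqrt (-\<i> * \<tau> / of_real k) *
     (\<Sum>\<^sub>\<infinity>j::int. cis (2 * pi * a * (of_int j + 1 / 2)) *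
        exp (of_real pi * \<i> * of_real (1 / k) * \<tau> * (of_int j + of_real (1 / 2))\<^sup>2))"
    (is "?L \<tau> = ?R \<tau>")
proof -
  define U where "U = {of_real y * \<i> | y. y > 0}"
  have "?L \<tau> - ?R \<tau> = 0"
  proof (rule analytic_continuation[OF _ open_upper_half_plane connected_upper_half_plane,
      where f = "\<lambda>\<tau>. ?L \<tau> - ?R \<tau>" and U = U and \<xi> = \<i> and w = \<tau>])
    have nz: "z \<noteq> 0" if "z \<in> upper_half_plane" for z using that by (auto simp: upper_half_plane_def)
    have "theta k a \<circ> (\<lambda>\<tau>. -1 / \<tau>) holomorphic_on upper_half_plane"
    proof (rule holomorphic_on_compose_gen)
      show "(\<lambda>\<tau>. -1 / \<tau>) holomorphic_on upper_half_plane"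
        using nz by (intro holomorphic_intros)
      show "theta k a holomorphic_on upper_half_plane"
        using k by (rule holomorphic_theta)
      show "(\<lambda>\<tau>. -1 / \<tau>) ` upper_half_plane \<subseteq> upper_half_plane"
        using minus_inverse_upper_half_plane by blast
    qed
    hence "(\<lambda>\<tau>. theta k a (-1 / \<tau>)) holomorphic_on upper_half_plane"
      by (simp only: o_def)
    moreover have "-\<i> * z / of_real k \<notin> \<real>\<^sub>\<le>\<^sub>0" if "z \<in> upper_half_plane" for z
    proof
      assume "-\<i> * z / of_real k \<in> \<real>\<^sub>\<le>\<^sub>0"
      hence "Re (-\<i> * z / of_real k) \<le> 0" by (simp add: complex_nonpos_Reals_iff)
      thus False using that k by (simp add: upper_half_plane_def field_simps)
    qed
    ultimately show "(\<lambda>\<tau>. ?L \<tau> - ?R \<tau>) holomorphic_on upper_half_plane"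
      using k by (intro holomorphic_intros holomorphic_theta_series) auto
    show "U \<subseteq> upper_half_plane" "\<i> \<in> upper_half_plane"
      by (auto simp: U_def upper_half_plane_def)
    show "\<i> islimpt U"
      unfolding islimpt_approachable
    proof (intro allI impI)
      fix e :: real assume e: "e > 0"
      have "of_real (1 + e / 2) * \<i> \<in> U" using e unfolding U_def by (intro CollectI exI[of _ "1 + e / 2"]) auto
      moreover have "of_real (1 + e / 2) * \<i> \<noteq> \<i>" using e by (simp add: complex_eq_iff)
      moreover have "dist (of_real (1 + e / 2) * \<i>) \<i> < e" 
        using e by (simp add: dist_norm algebra_simps norm_mult)
      ultimately show "\<exists>x'\<in>U. x' \<noteq> \<i> \<and> dist x' \<i> < e" by blast
    qed
    show "?L z - ?R z = 0" if "z \<in> U" for z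
    proof -
      obtain y where y: "z = of_real y * \<i>" "y > 0" using \<open>z \<in> U\<close> by (auto simp: U_def)
      have "?L z = (\<Sum>\<^sub>\<infinity>n::int. (-1) powi n * complex_of_real (exp (- (pi * (k / y)) * (of_int n + a)\<^sup>2)))"
        unfolding theta_def
      proof (rule infsum_cong)
        fix n :: int
        have "of_real pi * \<i> * of_real k * (-1 / z) * (of_int n + of_real a)\<^sup>2 = 
          complex_of_real (- (pi * (k / y)) * (of_int n + a)\<^sup>2)"
          using y by (simp add: field_simps)
        thus "(-1) powi n * exp (of_real pi * \<i> * of_real k * (-1 / z) * (of_int n + of_real a)\<^sup>2) =
           (-1) powi n * complex_of_real (exp (- (pi * (k / y)) * (of_int n + a)\<^sup>2))"
          by (simp only: exp_of_real)
      qed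
      also have "\<dots> = of_real (1 / sqrt (k / y)) *
           (\<Sum>\<^sub>\<infinity>j::int. of_real (exp (- (pi / (k / y)) * (of_int j + 1 / 2)\<^sup>2)) * cis (2 * pi * a * (of_int j + 1 / 2)))"
        using k y a by (intro alternating_poisson) auto
      also have "\<dots> = ?R z"
      proof -
        have "-\<i> * z / of_real k = of_real (y / k)" using y by (simp add: algebra_simps)
        moreover have "y / k \<ge> 0" using y k by simp
        ultimately have "csqrt (-\<i> * z / of_real k) = of_real (sqrt (y / k))" by (simp only: csqrt_of_real_nonneg Re_complex_of_real Im_complex_of_real of_real_0)
        hence sqrt: "of_real (1 / sqrt (k / y)) = csqrt (-\<i> * z / of_real k)" by (simp add: real_sqrt_divide)
        have series: "of_real (exp (- (pi / (k / y)) * (of_int j + 1 / 2)\<^sup>2)) * cis (2 * pi * a * (of_int j + 1 / 2)) =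
          cis (2 * pi * a * (of_int j + 1 / 2)) * exp (of_real pi * \<i> * of_real (1 / k) * z * (of_int j + of_real (1 / 2))\<^sup>2)"
          for j :: int
        proof -
          have "of_real pi * \<i> * of_real (1 / k) * z * (of_int j + of_real (1 / 2))\<^sup>2 = 
           complex_of_real (- (pi / (k / y)) * (of_int j + 1 / 2)\<^sup>2)"
          using y k by (simp add: field_simps)
          thus "of_real (exp (- (pi / (k / y)) * (of_int j + 1 / 2)\<^sup>2)) * cis (2 * pi * a * (of_int j + 1 / 2)) =
          cis (2 * pi * a * (of_int j + 1 / 2)) * exp (of_real pi * \<i> * of_real (1 / k) * z * (of_int j + of_real (1 / 2))\<^sup>2)"
          by (simp only: exp_of_real mult.commute)
        qed
        show ?thesis unfolding sqrt series ..
      qed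
      finally show ?thesis by simp
    qed
  qed (rule \<tau>)
  thus ?thesis by simp
qed

text \<open>Writing the dual index as K j + i gives K j + i + 1/2 = K (j + (2i+1)/(2K)), which turns
  the dual parameter 1/K back into K. As b is odd, the phase contributes exp(pi i b j) = (-1)^j, so
  the pieces are alternating again.\<close>

lemma theta_inversion_odd:
  fixes K :: nat and b :: int
  assumes K: "K > 0" and b: "odd b" "\<bar>b\<bar> \<le> int K" and \<tau>: "\<tau> \<in> upper_half_plane"
  shows "theta K (of_int b / (2 * K)) (-1 / \<tau>) = csqrt (-\<i> * \<tau> / of_nat K) *
     (\<Sum>i<K. cis (pi * of_int b * (2 * real i + 1) / (2 * K)) * theta K ((2 * real i + 1) / (2 * K)) \<tau>)"
proof -
  define g where "g = (\<lambda>j::int. cis (2 * pi * (of_int b / (2 * K)) * (of_int j + 1 / 2)) *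
        exp (of_real pi * \<i> * of_real (1 / K) * \<tau> * (of_int j + of_real (1 / 2))\<^sup>2))"
  have g: "(\<lambda>n. norm (g n)) summable_on UNIV"
    unfolding g_def using K \<tau> by (intro summable_theta_series) (auto simp: upper_half_plane_def)
  have "\<bar>real_of_int b\<bar> \<le> real K" using b(2) by linarith
  hence "theta K (of_int b / (2 * K)) (-1 / \<tau>) = csqrt (-\<i> * \<tau> / of_real (real K)) * infsum g UNIV"
    unfolding g_def using K \<tau> by (intro theta_inversion) (auto simp: field_simps)
  also have "infsum g UNIV = (\<Sum>i<K. \<Sum>\<^sub>\<infinity>j. g (int K * j + int i))"
    using K g by (rule infsum_split_residues)
  also have "\<dots> = (\<Sum>i<K. cis (pi * of_int b * (2 * real i + 1) / (2 * K)) * theta K ((2 * real i + 1) / (2 * K)) \<tau>)"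
    unfolding theta_def infsum_cmult_right'[symmetric]
  proof (intro sum.cong infsum_cong refl)
    fix i :: nat and j :: int
    have "2 * pi * (of_int b / (2 * K)) * (of_int (int K * j + int i) + 1 / 2) = 
       pi * of_int b * (2 * real i + 1) / (2 * K) + of_int j * (pi * of_int b)"
      using K by (simp add: field_simps)
    moreover have "cis (of_int j * (pi * of_int b)) = (-1) powi j"
    proof -
      obtain c where c: "b = 2 * c + 1" using b(1) by (elim oddE)
      have "cis (pi * of_int b) = cis (2 * pi * of_int c) * cis pi"
        unfolding cis_mult by (rule arg_cong) (simp add: c algebra_simps)
      also have "\<dots> = -1" by (simp only: cis_multiple_2pi Ints_of_int cis_pi mult_1_left)
      finally show ?thesis by (metis cis_power_int)
    qed
    ultimately have 1: "cis (2 * pi * (of_int b / (2 * K)) * (of_int (int K * j + int i) + 1 / 2)) = 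
      cis (pi * of_int b * (2 * real i + 1) / (2 * K)) * (-1) powi j"
      by (simp only: cis_mult[symmetric])
    have "of_int (int K * j + int i) + of_real (1 / 2) = of_nat K * (of_int j + of_real ((2 * real i + 1) / (2 * K)) :: complex)"
      using K by (simp add: field_simps)
    hence "of_real pi * \<i> * of_real (1 / K) * \<tau> * (of_int (int K * j + int i) + of_real (1 / 2))\<^sup>2 = 
        of_real pi * \<i> * of_real K * \<tau> * (of_int j + of_real ((2 * real i + 1) / (2 * K)))\<^sup>2"
      using K by (simp add: power_mult_distrib power2_eq_square[of "of_nat K"])
    thus "g (int K * j + int i) = cis (pi * of_int b * (2 * real i + 1) / (2 * K)) *
      ((-1) powi j * exp (of_real pi * \<i> * of_real K * \<tau> * (of_int j + of_real ((2 * real i + 1) / (2 * K)))\<^sup>2))"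
      unfolding g_def 1 by (simp only: mult.assoc)
  qed
  finally show ?thesis by simp
qed

lemma theta_minus: "theta k (- a) \<tau> = theta k a \<tau>"
proof -
  have "theta k (- a) \<tau> = (\<Sum>\<^sub>\<infinity>n::int. (-1) powi (0 - n) * exp (of_real pi * \<i> * of_real k * \<tau> * (of_int (0 - n) + of_real (- a))\<^sup>2))"
    unfolding theta_def by (rule infsum_reflect_int[symmetric])
  also have "\<dots> = theta k a \<tau>"
    unfolding theta_def
  proof (rule infsum_cong)
    fix n :: int
    have "(of_int (0 - n) + of_real (- a))\<^sup>2 = (of_int n + of_real a :: complex)\<^sup>2"
      by (simp add: power2_eq_square algebra_simps)
    thus "(-1) powi (0 - n) * exp (of_real pi * \<i> * of_real k * \<tau> * (of_int (0 - n) + of_real (- a))\<^sup>2) =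
      (-1) powi n * exp (of_real pi * \<i> * of_real k * \<tau> * (of_int n + of_real a)\<^sup>2)"
      by (simp only: diff_0 minus_one_powi_minus)
  qed
  finally show ?thesis .
qed

lemma theta_add_1: "theta k (a + 1) \<tau> = - theta k a \<tau>"
proof -
  have "theta k a \<tau> = (\<Sum>\<^sub>\<infinity>n::int. (-1) powi (n + 1) * exp (of_real pi * \<i> * of_real k * \<tau> * (of_int (n + 1) + of_real a)\<^sup>2))"
    unfolding theta_def by (rule infsum_shift_int[symmetric])
  also have "\<dots> = - theta k (a + 1) \<tau>"
    unfolding theta_def infsum_uminus[symmetric]
    by (intro infsum_cong) (simp add: power_int_add add_ac)
  finally show ?thesis by simp
qed

text \<open>Adding 1 to the shift changes the sign while reflection does not, so this value is its
  own negative. It removes the middle residue for K = 3 and K = 5.\<close>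

lemma theta_half: "theta k (1 / 2) \<tau> = 0"
  using theta_add_1[of k "- (1 / 2)" \<tau>] theta_minus[of k "1 / 2" \<tau>] by simp

lemma theta_one_minus: "theta k (1 - a) \<tau> = - theta k a \<tau>"
  using theta_add_1[of k "- a" \<tau>] by (simp add: theta_minus add.commute)

subsection \<open>Rogers--Ramanujan functions as theta quotients\<close>

lemma csqrt_divide_of_nat:
  assumes n: "n > 0"
  shows "csqrt (z / of_nat n) * of_real (sqrt (real n)) = csqrt z"
proof (rule sym, rule csqrt_unique)
  show "(csqrt (z / of_nat n) * of_real (sqrt (real n)))\<^sup>2 = z"
    using n by (simp add: power_mult_distrib flip: of_real_power)
  have "Re (csqrt (z / of_nat n) * of_real (sqrt (real n))) = Re (csqrt (z / of_nat n)) * sqrt (real n)"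
    "Im (csqrt (z / of_nat n) * of_real (sqrt (real n))) = Im (csqrt (z / of_nat n)) * sqrt (real n)"
    by simp_all
  thus "0 < Re (csqrt (z / of_nat n) * of_real (sqrt (real n))) \<or>
        Re (csqrt (z / of_nat n) * of_real (sqrt (real n))) = 0 \<and> 0 \<le> Im (csqrt (z / of_nat n) * of_real (sqrt (real n)))"
    using csqrt_principal[of "z / of_nat n"] n by auto
qed

text \<open>Completing the square: 3 (j - 1/6)^2 = j(j-1) + 2j^2 + 1/12, 5 (j - 1/10)^2 = j(j-1) +
  4j^2 + 1/20 and 5 (j + 3/10)^2 = j(j-1) + 4j(j+1) + 9/20. The negative shifts are reflected by
  \<open>theta_minus\<close>; the constants account for the fractional powers of q in
  \<open>rr_f1\<close> and \<open>rr_f2\<close>.\<close>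

lemma theta_nome:
  assumes "\<tau> \<in> upper_half_plane"
  shows "theta 3 (1 / 6) \<tau> \<noteq> 0"
    and "rr_f1 \<tau> * theta 3 (1 / 6) \<tau> = theta 5 (1 / 10) \<tau>"
    and "rr_f2 \<tau> * theta 3 (1 / 6) \<tau> = theta 5 (3 / 10) \<tau>"
proof -
  define w where "w = of_real pi * \<i> * \<tau>"
  interpret nome "exp w"
    using assms by unfold_locales (auto simp: w_def upper_half_plane_def norm_exp_eq_Re)
  have q: "q_power 1 \<tau> = q"
  proof -
    have "exp w ^ 2 = exp (2 * w)" by (rule exp_double[symmetric])
    thus ?thesis unfolding q_def by (simp add: q_power_def w_def mult_ac)
  qed
  have G: "rr_G q = (\<Sum>n. q ^ (n * (n + 0)) / P n)" and H: "rr_H q = (\<Sum>n. q ^ (n * (n + 1)) / P n)"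
    by (simp_all add: rr_G_def rr_H_def power2_eq_square)
  have uq: "u j * q powi m = (-1) powi j * exp (of_int (j * (j - 1) + 2 * m) * w)" for j m
    by (simp add: u_def q_powi exp_power_int ring_distribs flip: exp_add)
  have uqq: "u j * q powi m * q powi m = (-1) powi j * exp (of_int (j * (j - 1) + 4 * m) * w)" for j m
  proof -
    have "u j * q powi m * q powi m = u j * q powi (2 * m)"
      using power_int_add[of q m m] q_nonzero by (simp only: mult_2 mult.assoc) simp
    thus ?thesis unfolding uq by simp
  qed
  have "theta 3 (- (1 / 6)) \<tau> = (\<Sum>\<^sub>\<infinity>j. exp (w / 12) * (u j * q powi (j * (j + int 0))))"
    unfolding theta_def
  proof (rule infsum_cong)
    fix j :: int
    have "of_real pi * \<i> * of_real 3 * \<tau> * (of_int j + of_real (- (1 / 6)))\<^sup>2 =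
       w / 12 + of_int (j * (j - 1) + 2 * (j * (j + int 0))) * w"
      by (simp add: w_def power2_eq_square field_simps)
    thus "(-1) powi j * exp (of_real pi * \<i> * of_real 3 * \<tau> * (of_int j + of_real (- (1 / 6)))\<^sup>2) =
       exp (w / 12) * (u j * q powi (j * (j + int 0)))"
      unfolding uq by (simp only: exp_add mult_ac)
  qed
  also have "\<dots> = exp (w / 12) * qinf"
    by (subst infsum_cmult_right', subst theta_eq_qinf) auto
  finally have eta: "theta 3 (1 / 6) \<tau> = exp (w / 12) * qinf"
    by (simp add: theta_minus)
  thus "theta 3 (1 / 6) \<tau> \<noteq> 0" using qinf_nonzero by simp
  have "theta 5 (- (1 / 10)) \<tau> = (\<Sum>\<^sub>\<infinity>j. exp (w / 20) * (u j * q powi (j * (j + int 0)) * q powi (j * (j + int 0))))"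
    unfolding theta_def
  proof (rule infsum_cong)
    fix j :: int
    have "of_real pi * \<i> * of_real 5 * \<tau> * (of_int j + of_real (- (1 / 10)))\<^sup>2 =
       w / 20 + of_int (j * (j - 1) + 4 * (j * (j + int 0))) * w"
      by (simp add: w_def power2_eq_square field_simps)
    thus "(-1) powi j * exp (of_real pi * \<i> * of_real 5 * \<tau> * (of_int j + of_real (- (1 / 10)))\<^sup>2) =
       exp (w / 20) * (u j * q powi (j * (j + int 0)) * q powi (j * (j + int 0)))"
      unfolding uqq by (simp only: exp_add mult_ac)
  qed
  also have "\<dots> = exp (w / 20) * (qinf * rr_G q)"
    by (subst infsum_cmult_right', subst theta_eq_qinf_times_sum) (auto simp: G)
  finally have th1: "theta 5 (1 / 10) \<tau> = exp (w / 20) * (qinf * rr_G q)"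
    by (simp add: theta_minus)
  have "theta 5 (3 / 10) \<tau> = (\<Sum>\<^sub>\<infinity>j. exp (9 * w / 20) * (u j * q powi (j * (j + int 1)) * q powi (j * (j + int 1))))"
    unfolding theta_def
  proof (rule infsum_cong)
    fix j :: int
    have "of_real pi * \<i> * of_real 5 * \<tau> * (of_int j + of_real (3 / 10))\<^sup>2 =
       9 * w / 20 + of_int (j * (j - 1) + 4 * (j * (j + int 1))) * w"
      by (simp add: w_def power2_eq_square field_simps)
    thus "(-1) powi j * exp (of_real pi * \<i> * of_real 5 * \<tau> * (of_int j + of_real (3 / 10))\<^sup>2) =
       exp (9 * w / 20) * (u j * q powi (j * (j + int 1)) * q powi (j * (j + int 1)))"
      unfolding uqq by (simp only: exp_add mult_ac)
  qed
  also have "\<dots> = exp (9 * w / 20) * (qinf * rr_H q)"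
    by (subst infsum_cmult_right', subst theta_eq_qinf_times_sum) (auto simp: H)
  finally have th2: "theta 5 (3 / 10) \<tau> = exp (9 * w / 20) * (qinf * rr_H q)" .
  have "q_power (- 1 / 60) \<tau> * exp (w / 12) = exp (w / 20)"
    by (simp add: q_power_def w_def field_simps flip: exp_add)
  thus "rr_f1 \<tau> * theta 3 (1 / 6) \<tau> = theta 5 (1 / 10) \<tau>"
    unfolding rr_f1_def q eta th1 by (metis mult.assoc mult.commute)
  have "q_power (11 / 60) \<tau> * exp (w / 12) = exp (9 * w / 20)"
    by (simp add: q_power_def w_def field_simps flip: exp_add)
  thus "rr_f2 \<tau> * theta 3 (1 / 6) \<tau> = theta 5 (3 / 10) \<tau>"
    unfolding rr_f2_def q eta th2 by (metis mult.assoc mult.commute)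
qed

lemma cis_add_cis_minus: "cis x + cis (- x) = of_real (2 * cos x)"
  by (simp add: complex_eq_iff)

lemma cis_pi_minus: "cis (pi - x) = - cis (- x)"
  by (simp add: complex_eq_iff)

text \<open>The inversion law of eta: the residues 1/6 and 5/6 combine with coefficient 2 cos(pi/6)
  = sqrt 3, which cancels the factor 1/sqrt 3 from the square root.\<close>

lemma theta_3_inversion:
  assumes "\<tau> \<in> upper_half_plane"
  shows "theta 3 (1 / 6) (-1 / \<tau>) = csqrt (-\<i> * \<tau>) * theta 3 (1 / 6) \<tau>"
proof -
  have "theta (real 3) (of_int 1 / (real (2 * 3))) (-1 / \<tau>) = csqrt (-\<i> * \<tau> / of_nat 3) *
     (\<Sum>i<3. cis (pi * of_int 1 * (2 * real i + 1) / (real (2 * 3))) * theta (real 3) ((2 * real i + 1) / (real (2 * 3))) \<tau>)"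
    using assms by (intro theta_inversion_odd) auto
  also have "(\<Sum>i<3. cis (pi * of_int 1 * (2 * real i + 1) / (real (2 * 3))) * theta (real 3) ((2 * real i + 1) / (real (2 * 3))) \<tau>) =
     cis (pi / 6) * theta 3 (1 / 6) \<tau> + cis (pi - pi / 6) * theta 3 (1 - 1 / 6) \<tau>"
    by (simp add: eval_nat_numeral theta_half mult_ac)
  also have "\<dots> = (cis (pi / 6) + cis (- (pi / 6))) * theta 3 (1 / 6) \<tau>"
    unfolding theta_one_minus cis_pi_minus by (simp add: algebra_simps)
  also have "cis (pi / 6) + cis (- (pi / 6)) = of_real (sqrt (real 3))"
    unfolding cis_add_cis_minus by (simp add: cos_30)
  finally show ?thesis
    using csqrt_divide_of_nat[of 3 "-\<i> * \<tau>"] by (simp flip: mult.assoc)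
qed

text \<open>The shifts 9/10 and 7/10 fold onto 1/10 and 3/10. The sign from
  \<open>theta_one_minus\<close> meets exp(pi i b) = -1, so the phases add up to cosines.\<close>

lemma theta_5_inversion:
  fixes b :: int
  assumes "\<tau> \<in> upper_half_plane" "odd b" "\<bar>b\<bar> \<le> 5"
  shows "theta 5 (of_int b / 10) (-1 / \<tau>) = csqrt (-\<i> * \<tau>) * of_real (2 / sqrt 5) *
     (of_real (cos (pi * of_int b / 10)) * theta 5 (1 / 10) \<tau> +
      of_real (cos (pi * of_int b * 3 / 10)) * theta 5 (3 / 10) \<tau>)"
proof -
  define x where "x = pi * of_int b / 10"
  have cis_b: "cis (pi * of_int b) = -1"
  proof -
    obtain c where c: "b = 2 * c + 1" using assms(2) by (elim oddE)
    have "cis (pi * of_int b) = cis (2 * pi * of_int c) * cis pi"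
      unfolding cis_mult by (rule arg_cong) (simp add: c algebra_simps)
    thus ?thesis by (simp only: cis_multiple_2pi Ints_of_int cis_pi mult_1_left)
  qed
  have cis_minus: "cis (pi * of_int b - y) = - cis (- y)" for y
    using cis_mult[of "pi * of_int b" "- y"] by (simp add: cis_b)
  have args: "pi * of_int b * 9 / 10 = pi * of_int b - x" "pi * of_int b * 7 / 10 = pi * of_int b - 3 * x"
    by (simp_all add: x_def field_simps)
  have "theta (real 5) (of_int b / (real (2 * 5))) (-1 / \<tau>) = csqrt (-\<i> * \<tau> / of_nat 5) *
     (\<Sum>i<5. cis (pi * of_int b * (2 * real i + 1) / (real (2 * 5))) * theta (real 5) ((2 * real i + 1) / (real (2 * 5))) \<tau>)"
    using assms by (intro theta_inversion_odd) auto
  also have "(\<Sum>i<5. cis (pi * of_int b * (2 * real i + 1) / (real (2 * 5))) * theta (real 5) ((2 * real i + 1) / (real (2 * 5))) \<tau>) =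
     cis x * theta 5 (1 / 10) \<tau> + cis (3 * x) * theta 5 (3 / 10) \<tau> +
     cis (pi * of_int b - 3 * x) * theta 5 (1 - 3 / 10) \<tau> + cis (pi * of_int b - x) * theta 5 (1 - 1 / 10) \<tau>"
    unfolding args[symmetric] by (simp add: eval_nat_numeral theta_half x_def mult_ac)
  also have "\<dots> = (cis x + cis (- x)) * theta 5 (1 / 10) \<tau> + (cis (3 * x) + cis (- (3 * x))) * theta 5 (3 / 10) \<tau>"
    unfolding theta_one_minus cis_minus by (simp add: algebra_simps)
  also have "csqrt (-\<i> * \<tau> / of_nat 5) * \<dots> = csqrt (-\<i> * \<tau>) * of_real (2 / sqrt 5) *
     (of_real (cos x) * theta 5 (1 / 10) \<tau> + of_real (cos (3 * x)) * theta 5 (3 / 10) \<tau>)"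
    unfolding cis_add_cis_minus
    using csqrt_divide_of_nat[of 5 "-\<i> * \<tau>", symmetric] by (simp add: algebra_simps)
  finally show ?thesis by (simp add: x_def mult_ac)
qed

lemma rr_inversion:
  assumes \<tau>: "\<tau> \<in> upper_half_plane"
  shows "rr_f1 (-1 / \<tau>) = of_real (2 / sqrt 5) * (of_real (sin (2 * pi / 5)) * rr_f1 \<tau> + of_real (sin (pi / 5)) * rr_f2 \<tau>)"
    and "rr_f2 (-1 / \<tau>) = of_real (2 / sqrt 5) * (of_real (sin (pi / 5)) * rr_f1 \<tau> - of_real (sin (2 * pi / 5)) * rr_f2 \<tau>)"
proof -
  have \<tau>': "-1 / \<tau> \<in> upper_half_plane" using \<tau> by (rule minus_inverse_upper_half_plane)
  note th = theta_nome[OF \<tau>] and th' = theta_nome[OF \<tau>']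
  \<comment> \<open>Nonvanishing of the eta series at -1/tau shows that the whole common factor is
    nonzero and may be cancelled.\<close>
  have nz: "csqrt (-\<i> * \<tau>) * theta 3 (1 / 6) \<tau> \<noteq> 0"
    using th'(1) theta_3_inversion[OF \<tau>] by simp
  have c1: "cos (pi / 10) = sin (2 * pi / 5)" and c3: "cos (pi * 3 / 10) = sin (pi / 5)"
    and c9: "cos (pi * 3 * 3 / 10) = - sin (2 * pi / 5)"
  proof -
    show "cos (pi / 10) = sin (2 * pi / 5)" "cos (pi * 3 / 10) = sin (pi / 5)"
      unfolding cos_sin_eq by (rule arg_cong[of _ _ sin], simp add: field_simps)+
    have "cos (pi * 3 * 3 / 10) = cos (pi - pi / 10)" by (rule arg_cong) simp
    thus "cos (pi * 3 * 3 / 10) = - sin (2 * pi / 5)"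
      using \<open>cos (pi / 10) = sin (2 * pi / 5)\<close> by (simp only: cos_pi_minus)
  qed
  have "(csqrt (-\<i> * \<tau>) * theta 3 (1 / 6) \<tau>) * rr_f1 (-1 / \<tau>) = theta 5 (1 / 10) (-1 / \<tau>)"
    using th'(2) theta_3_inversion[OF \<tau>] by (simp add: mult.commute)
  also have "\<dots> = csqrt (-\<i> * \<tau>) * of_real (2 / sqrt 5) *
     (of_real (sin (2 * pi / 5)) * (rr_f1 \<tau> * theta 3 (1 / 6) \<tau>) + of_real (sin (pi / 5)) * (rr_f2 \<tau> * theta 3 (1 / 6) \<tau>))"
    using theta_5_inversion[OF \<tau>, of 1] by (simp add: th c1 c3)
  also have "\<dots> = (csqrt (-\<i> * \<tau>) * theta 3 (1 / 6) \<tau>) * 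
     (of_real (2 / sqrt 5) * (of_real (sin (2 * pi / 5)) * rr_f1 \<tau> + of_real (sin (pi / 5)) * rr_f2 \<tau>))"
    by (simp add: algebra_simps)
  finally show "rr_f1 (-1 / \<tau>) = of_real (2 / sqrt 5) * (of_real (sin (2 * pi / 5)) * rr_f1 \<tau> + of_real (sin (pi / 5)) * rr_f2 \<tau>)"
    using nz by (simp only: mult_cancel_left) simp
  have "(csqrt (-\<i> * \<tau>) * theta 3 (1 / 6) \<tau>) * rr_f2 (-1 / \<tau>) = theta 5 (3 / 10) (-1 / \<tau>)"
    using th'(3) theta_3_inversion[OF \<tau>] by (simp add: mult.commute)
  also have "\<dots> = csqrt (-\<i> * \<tau>) * of_real (2 / sqrt 5) *
     (of_real (sin (pi / 5)) * (rr_f1 \<tau> * theta 3 (1 / 6) \<tau>) - of_real (sin (2 * pi / 5)) * (rr_f2 \<tau> * theta 3 (1 / 6) \<tau>))"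
    using theta_5_inversion[OF \<tau>, of 3] c3 c9 by (simp add: th)
  also have "\<dots> = (csqrt (-\<i> * \<tau>) * theta 3 (1 / 6) \<tau>) * 
     (of_real (2 / sqrt 5) * (of_real (sin (pi / 5)) * rr_f1 \<tau> - of_real (sin (2 * pi / 5)) * rr_f2 \<tau>))"
    by (simp add: algebra_simps)
  finally show "rr_f2 (-1 / \<tau>) = of_real (2 / sqrt 5) * (of_real (sin (pi / 5)) * rr_f1 \<tau> - of_real (sin (2 * pi / 5)) * rr_f2 \<tau>)"
    using nz by (simp only: mult_cancel_left) simp
qed

lemma rr_translation:
  "rr_f1 (\<tau> + 1) = exp (- (2 * of_real pi * \<i> / 60)) * rr_f1 \<tau>"
  "rr_f2 (\<tau> + 1) = exp (11 * (2 * of_real pi * \<i> / 60)) * rr_f2 \<tau>"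
proof -
  have add: "q_power \<alpha> (\<tau> + 1) = exp (2 * of_real pi * \<i> * of_real \<alpha>) * q_power \<alpha> \<tau>" for \<alpha>
    by (simp add: q_power_def ring_distribs add.commute flip: exp_add)
  have 1: "q_power 1 (\<tau> + 1) = q_power 1 \<tau>"
    unfolding add by simp
  show "rr_f1 (\<tau> + 1) = exp (- (2 * of_real pi * \<i> / 60)) * rr_f1 \<tau>"
    "rr_f2 (\<tau> + 1) = exp (11 * (2 * of_real pi * \<i> / 60)) * rr_f2 \<tau>"
    unfolding rr_f1_def rr_f2_def 1 add by (simp_all add: mult_ac)
qed

subsection \<open>Generators and reduction of the modular group\<close>

definition mat2 :: "'a \<Rightarrow> 'a \<Rightarrow> 'a \<Rightarrow> 'a \<Rightarrow> 'a::zero^2^2" where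
  "mat2 a b c d = vector [vector [a, b], vector [c, d]]"

lemma mat2_nth [simp]:
  "mat2 a b c d $ 1 $ 1 = a" "mat2 a b c d $ 1 $ 2 = b"
  "mat2 a b c d $ 2 $ 1 = c" "mat2 a b c d $ 2 $ 2 = d"
  by (simp_all add: mat2_def)

lemma mat2_eqI:
  "A $ 1 $ 1 = B $ 1 $ 1 \<Longrightarrow> A $ 1 $ 2 = B $ 1 $ 2 \<Longrightarrow> A $ 2 $ 1 = B $ 2 $ 1 \<Longrightarrow>
     A $ 2 $ 2 = B $ 2 $ 2 \<Longrightarrow> A = (B :: 'a^2^2)"
  by (simp add: vec_eq_iff forall_2)

lemma mat2_cases:
  obtains a b c d where "A = mat2 a b c d"
  using that[of "A $ 1 $ 1" "A $ 1 $ 2" "A $ 2 $ 1" "A $ 2 $ 2"] by (simp add: mat2_eqI)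

lemma mat2_inject [simp]:
  "mat2 a b c d = mat2 a' b' c' d' \<longleftrightarrow> a = a' \<and> b = b' \<and> c = c' \<and> d = d'"
  by (metis mat2_nth)

lemma mat2_mult:
  "mat2 a b c d ** mat2 a' b' c' d' =
     (mat2 (a * a' + b * c') (a * b' + b * d') (c * a' + d * c') (c * b' + d * d') :: 'a::semiring_1^2^2)"
  by (rule mat2_eqI) (simp_all add: matrix_matrix_mult_def sum_2)

lemma det_mat2: "det (mat2 a b c d :: 'a::comm_ring_1^2^2) = a * d - b * c"
  by (simp add: det_2)

lemma mat_eq_mat2: "mat k = mat2 k 0 0 (k :: 'a::zero)"
  by (rule mat2_eqI) (simp_all add: mat_def)

lemma mat_T_eq: "mat_T = mat2 1 1 0 1" and mat_S_eq: "mat_S = mat2 0 (-1) 1 0"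
  by (simp_all add: mat_T_def mat_S_def mat2_def)

lemma SL2Z_carrier: "A \<in> carrier SL2Z \<longleftrightarrow> det A = 1"
  by (simp add: SL2Z_def)

text \<open>Right multiplication acts on columns, so the Euclidean algorithm on the bottom row
  lowers |c|. Only T and S occur as steps; their inverses are recovered from S^2 = (TS)^3 =
  -1.\<close>

lemma SL2Z_induct [consumes 1, case_names one T S]:
  assumes "det A = 1" and one: "P (mat 1)"
    and T: "\<And>B. det B = 1 \<Longrightarrow> P B \<Longrightarrow> P (B ** mat_T)"
    and S: "\<And>B. det B = 1 \<Longrightarrow> P B \<Longrightarrow> P (B ** mat_S)"
  shows "P A"
proof -
  define Q where "Q = (\<lambda>a b c d. a * d - b * c = 1 \<and> P (mat2 a b c d))"
  have step_T: "Q a (a + b) c (c + d)" if "Q a b c d" for a b c d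
    using T[of "mat2 a b c d"] that
    by (simp add: Q_def det_mat2 mat2_mult mat_T_eq algebra_simps)
  have step_S: "Q b (- a) d (- c)" if "Q a b c d" for a b c d
    using S[of "mat2 a b c d"] that
    by (simp add: Q_def det_mat2 mat2_mult mat_S_eq algebra_simps)
  have neg: "Q (- a) (- b) (- c) (- d)" if "Q a b c d" for a b c d
    using step_S[OF step_S[OF that]] .
  have unstep_S: "Q a b c d" if "Q b (- a) d (- c)" for a b c d
    using neg[OF step_S[OF that]] by simp
  \<comment> \<open>-(B T) S T S T S = -B (TS)^3 = B.\<close>
  have unstep_T: "Q a b c d" if "Q a (a + b) c (c + d)" for a b c d
    using step_S[OF step_T[OF step_S[OF step_T[OF step_S[OF neg[OF that]]]]]] by simp
  have power_T: "Q a (b + int k * a) c (d + int k * c) \<longleftrightarrow> Q a b c d" for a b c d k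
  proof (induction k)
    case (Suc k)
    have "Q a (b + int (Suc k) * a) c (d + int (Suc k) * c) \<longleftrightarrow>
          Q a (a + (b + int k * a)) c (c + (d + int k * c))"
      by (simp add: algebra_simps)
    also have "\<dots> \<longleftrightarrow> Q a (b + int k * a) c (d + int k * c)"
      using step_T unstep_T by blast
    finally show ?case using Suc.IH by simp
  qed simp
  have shift: "Q a (b + k * a) c (d + k * c) \<longleftrightarrow> Q a b c d" for a b c d k
  proof (cases "k \<ge> 0")
    case True
    thus ?thesis using power_T[of a b "nat k" c d] by simp
  next
    case False
    thus ?thesis using power_T[of a "b + k * a" "nat (- k)" c "d + k * c"] by simp
  qed
  have Q_one: "Q 1 0 0 1" using one by (simp add: Q_def mat_eq_mat2)
  have main: "Q a b c d" if "a * d - b * c = 1" for a b c d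
    using that
  proof (induction "nat \<bar>c\<bar>" arbitrary: a b c d rule: less_induct)
    case less
    show ?case
    proof (cases "c = 0")
      case True
      hence "a * d = 1" using less.prems by simp
      hence "a = 1 \<and> d = 1 \<or> a = -1 \<and> d = -1" by (simp add: zmult_eq_1_iff)
      moreover have "Q 1 b 0 1" for b using shift[of 1 0 b 0 1] Q_one by simp
      ultimately show ?thesis using True neg[of 1 "- b" 0 1] by auto
    next
      case False
      \<comment> \<open>T^k replaces d by d mod c, and S then moves this smaller entry to the lower
        left.\<close>
      define k where "k = - (d div c)"
      have dk: "d + k * c = d mod c"
        by (simp add: k_def minus_div_mult_eq_mod[symmetric])
      have "\<bar>d mod c\<bar> < \<bar>c\<bar>" using False by (rule abs_mod_less)
      hence "nat \<bar>d mod c\<bar> < nat \<bar>c\<bar>" by simp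
      moreover have "(b + k * a) * (- c) - (- a) * (d mod c) = 1"
        using less.prems by (simp add: dk[symmetric] algebra_simps)
      ultimately have "Q (b + k * a) (- a) (d mod c) (- c)"
        by (rule less.hyps)
      hence "Q a (b + k * a) c (d mod c)" by (rule unstep_S)
      thus ?thesis using shift[of a b k c d] by (simp add: dk)
    qed
  qed
  obtain a b c d where A: "A = mat2 a b c d" by (rule mat2_cases)
  show ?thesis using main[of a d b c] \<open>det A = 1\<close> by (simp add: A det_mat2 Q_def)
qed

section \<open>Surjectivity of reduction modulo N and descent of homomorphisms\<close>

lemma coprime_shift:
  fixes c d n :: int
  assumes "c \<noteq> 0" and cdn: "\<And>p. prime p \<Longrightarrow> p dvd c \<Longrightarrow> p dvd d \<Longrightarrow> \<not> p dvd n"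
  shows "\<exists>k. coprime (d + k * n) c"
proof -
  \<comment> \<open>For a prime p dividing c: if p divides d it divides neither \<open>k\<close> nor
    n, and if not it divides \<open>k\<close>. Either way p does not divide d + k n.\<close>
  define k where "k = \<Prod>{p \<in> prime_factors c. \<not> p dvd d}"
  have "coprime (d + k * n) c"
  proof (rule ccontr)
    assume "\<not> coprime (d + k * n) c"
    hence "\<not> is_unit (gcd (d + k * n) c)" by (simp add: coprime_iff_gcd_eq_1)
    moreover have "gcd (d + k * n) c \<noteq> 0" using assms(1) by simp
    ultimately obtain p where "p dvd gcd (d + k * n) c" "prime p"
      using prime_divisor_exists by metis
    hence p: "prime p" "p dvd d + k * n" "p dvd c" by auto
    show False
    proof (cases "p dvd d")
      case True
      hence "p dvd k * n" using p(2) by (simp add: dvd_add_right_iff)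
      moreover have "\<not> p dvd n" using cdn p(1,3) True by blast
      ultimately have "p dvd k" using p(1) by (simp add: prime_dvd_mult_iff)
      then obtain r where r: "r \<in> prime_factors c" "\<not> r dvd d" "p dvd r"
        using p(1) by (auto simp: k_def prime_dvd_prod_iff)
      hence "p = r" using p(1) primes_dvd_imp_eq by blast
      with r(2) True show False by simp
    next
      case False
      hence "p \<in> {p \<in> prime_factors c. \<not> p dvd d}"
        using p(1,3) assms(1) by (auto simp: prime_factors_dvd)
      hence "p dvd k" unfolding k_def by (intro dvd_prodI) auto
      hence "p dvd d" using p(2) by (simp add: dvd_add_left_iff)
      with False show False ..
    qed
  qed
  thus ?thesis ..
qed

text \<open>Once d is moved within its class to be coprime to c', the excess N m of the determinant
  over 1 is removed by adding to a and b multiples of N built from Bezout coefficients of d' and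
  c'.\<close>

lemma SL2Z_lift:
  fixes N a b c d :: int
  assumes N: "N > 0" and det: "(a * d - b * c) mod N = 1 mod N"
  obtains a' b' c' d' where "a' * d' - b' * c' = 1" "a' mod N = a mod N" "b' mod N = b mod N"
    "c' mod N = c mod N" "d' mod N = d mod N"
proof -
  \<comment> \<open>\<open>coprime_shift\<close> needs a nonzero entry, so 0 is replaced by the
    representative N of its class.\<close>
  define c' where "c' = (if c = 0 then N else c)"
  have c': "c' \<noteq> 0" "c' mod N = c mod N" using N by (auto simp: c'_def)
  have det': "[a * d - b * c' = 1] (mod N)"
  proof -
    have "[a * d - b * c' = a * d - b * c] (mod N)"
      using c'(2) by (intro cong_diff cong_mult cong_refl) (simp add: cong_def)
    thus ?thesis using det by (simp add: cong_def)
  qed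
  have "\<exists>k. coprime (d + k * N) c'"
  proof (rule coprime_shift[OF c'(1)])
    fix p assume p: "prime p" "p dvd c'" "p dvd d"
    show "\<not> p dvd N"
    proof
      assume "p dvd N"
      hence "[a * d - b * c' = 1] (mod p)" using det' cong_dvd_modulus by blast
      moreover have "[a * d - b * c' = 0] (mod p)" using p by (simp add: cong_0_iff)
      ultimately have "[1 = 0] (mod p)" using cong_sym cong_trans by blast
      hence "p dvd 1" by (simp only: cong_0_iff)
      thus False using p(1) not_prime_unit by blast
    qed
  qed
  then obtain k where k: "coprime (d + k * N) c'" by blast
  define d' where "d' = d + k * N"
  obtain u v where uv: "u * d' + v * c' = 1"
    using k bezout_int[of d' c'] by (auto simp: d'_def)
  have "[a * d' - b * c' = a * d - b * c'] (mod N)"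
    unfolding d'_def by (intro cong_diff cong_mult cong_refl) (simp add: cong_def)
  hence "[1 = a * d' - b * c'] (mod N)" using det' cong_sym cong_trans by blast
  then obtain m where m: "a * d' - b * c' = 1 + N * m"
    by (auto simp: cong_iff_lin)
  show ?thesis
  proof
    have "(a - m * N * u) * d' - (b + m * N * v) * c' = a * d' - b * c' - m * N * (u * d' + v * c')"
      by (simp add: algebra_simps)
    also have "\<dots> = 1" using m uv by (simp add: mult_ac)
    finally show "(a - m * N * u) * d' - (b + m * N * v) * c' = 1" .
    show "d' mod N = d mod N" "c' mod N = c mod N" by (simp_all add: d'_def c')
    show "(a - m * N * u) mod N = a mod N" "(b + m * N * v) mod N = b mod N"
      using cong_def[of "a - m * N * u" a N] cong_def[of "b + m * N * v" b N]
      by (simp_all add: cong_iff_dvd_diff)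
  qed
qed

lemma reduce_mod_mat2: "reduce_mod N (mat2 a b c d) = mat2 (a mod int N) (b mod int N) (c mod int N) (d mod int N)"
  by (rule mat2_eqI) (simp_all add: reduce_mod_def)

lemma reduce_mod_mult: "reduce_mod N (reduce_mod N A ** reduce_mod N B) = reduce_mod N (A ** B)"
proof -
  obtain a b c d where A: "A = mat2 a b c d" by (rule mat2_cases)
  obtain a' b' c' d' where B: "B = mat2 a' b' c' d'" by (rule mat2_cases)
  show ?thesis
    by (simp add: A B reduce_mod_mat2 mat2_mult) (intro conjI mod_add_cong mod_mult_cong mod_mod_trivial)
qed

lemma SL2_mod_lift:
  assumes "N > 0" "A \<in> carrier (SL2_mod N)"
  obtains B where "det B = 1" "reduce_mod N B = A"
proof -
  obtain a b c d where A: "A = mat2 a b c d" by (rule mat2_cases)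
  have "A $ i $ j mod int N = A $ i $ j" for i j
    using assms(2) by (auto simp: SL2_mod_def intro!: mod_pos_pos_trivial)
  from this[of 1 1] this[of 1 2] this[of 2 1] this[of 2 2]
  have m: "a mod int N = a" "b mod int N = b" "c mod int N = c" "d mod int N = d"
    by (simp_all add: A)
  have "(a * d - b * c) mod int N = 1 mod int N"
    using assms(2) by (simp add: SL2_mod_def A det_mat2)
  then obtain a' b' c' d' where "a' * d' - b' * c' = 1" "a' mod int N = a mod int N" "b' mod int N = b mod int N"
    "c' mod int N = c mod int N" "d' mod int N = d mod int N"
    using SL2Z_lift[of "int N"] assms(1) by (metis of_nat_0_less_iff)
  with that[of "mat2 a' b' c' d'"] show ?thesis by (simp add: A det_mat2 reduce_mod_mat2 m)
qed

text \<open>Classes modulo N are encoded as reduced integer matrices, so a periodic \<open>f\<close>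
  can itself serve as the map on the quotient. Such a matrix need not have determinant 1 over the
  integers, hence the homomorphism property is transferred from lifts.\<close>

lemma factors_through_SL2_modI:
  assumes N: "N > 0" and hom: "f \<in> hom SL2Z G" and per: "\<And>A. f (reduce_mod N A) = f A"
  shows "factors_through_SL2_mod G N f"
  unfolding factors_through_SL2_mod_def
proof (rule bexI[of _ f])
  show "\<forall>\<gamma>\<in>carrier SL2Z. f \<gamma> = f (reduce_mod N \<gamma>)" by (simp add: per)
  show "f \<in> hom (SL2_mod N) G"
  proof (rule homI)
    fix A assume "A \<in> carrier (SL2_mod N)"
    then obtain A' where A': "det A' = 1" "reduce_mod N A' = A" using SL2_mod_lift N by blast
    have "f A = f A'" using per[of A'] A'(2) by simp
    thus "f A \<in> carrier G" using hom A'(1) by (auto simp: hom_def SL2Z_def)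
  next
    fix A B assume "A \<in> carrier (SL2_mod N)" "B \<in> carrier (SL2_mod N)"
    then obtain A' B' where A': "det A' = 1" "reduce_mod N A' = A" and B': "det B' = 1" "reduce_mod N B' = B"
      using SL2_mod_lift N by metis
    have "A \<otimes>\<^bsub>SL2_mod N\<^esub> B = reduce_mod N (A ** B)" by (simp add: SL2_mod_def)
    also have "\<dots> = reduce_mod N (A' ** B')" by (simp flip: A'(2) B'(2) add: reduce_mod_mult)
    finally have "f (A \<otimes>\<^bsub>SL2_mod N\<^esub> B) = f (A' ** B')" by (simp add: per)
    also have "\<dots> = f A' \<otimes>\<^bsub>G\<^esub> f B'"
      using hom A'(1) B'(1) by (auto simp: hom_def SL2Z_def)
    also have "\<dots> = f A \<otimes>\<^bsub>G\<^esub> f B"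
      using per[of A'] per[of B'] A'(2) B'(2) by simp
    finally show "f (A \<otimes>\<^bsub>SL2_mod N\<^esub> B) = f A \<otimes>\<^bsub>G\<^esub> f B" .
  qed
qed

text \<open>As \<open>f\<close> is given on all matrices, multiplicativity follows by induction on
  the right factor, associativity moving the last generator outwards.\<close>

lemma SL2Z_homI:
  assumes "monoid G" and carr: "\<And>A. det A = 1 \<Longrightarrow> f A \<in> carrier G" and one: "f (mat 1) = \<one>\<^bsub>G\<^esub>"
    and T: "\<And>A. det A = 1 \<Longrightarrow> f (A ** mat_T) = f A \<otimes>\<^bsub>G\<^esub> f mat_T"
    and S: "\<And>A. det A = 1 \<Longrightarrow> f (A ** mat_S) = f A \<otimes>\<^bsub>G\<^esub> f mat_S"
  shows "f \<in> hom SL2Z G"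
proof (rule homI)
  interpret monoid G by fact
  fix A assume "A \<in> carrier SL2Z"
  thus "f A \<in> carrier G" by (simp add: SL2Z_carrier carr)
next
  interpret monoid G by fact
  fix A B assume "A \<in> carrier SL2Z" "B \<in> carrier SL2Z"
  hence A: "det A = 1" and B: "det B = 1" by (simp_all add: SL2Z_carrier)
  have gen: "det mat_T = 1" "det mat_S = 1" by (simp_all add: mat_T_eq mat_S_eq det_mat2)
  from B have "f (A ** B) = f A \<otimes>\<^bsub>G\<^esub> f B"
  proof (induction rule: SL2Z_induct)
    case one
    show ?case using A carr assms(3) by simp
  next
    case (T B)
    have "f (A ** (B ** mat_T)) = f (A ** B) \<otimes>\<^bsub>G\<^esub> f mat_T"
      using assms(4)[of "A ** B"] A T.hyps(1) by (simp add: matrix_mul_assoc det_mul)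
    also have "\<dots> = f A \<otimes>\<^bsub>G\<^esub> (f B \<otimes>\<^bsub>G\<^esub> f mat_T)"
      using A T gen carr by (simp add: m_assoc)
    finally show ?case using assms(4) T.hyps(1) by simp
  next
    case (S B)
    have "f (A ** (B ** mat_S)) = f (A ** B) \<otimes>\<^bsub>G\<^esub> f mat_S"
      using assms(5)[of "A ** B"] A S.hyps(1) by (simp add: matrix_mul_assoc det_mul)
    also have "\<dots> = f A \<otimes>\<^bsub>G\<^esub> (f B \<otimes>\<^bsub>G\<^esub> f mat_S)"
      using A S gen carr by (simp add: m_assoc)
    finally show ?case using assms(5) S.hyps(1) by simp
  qed
  thus "f (A \<otimes>\<^bsub>SL2Z\<^esub> B) = f A \<otimes>\<^bsub>G\<^esub> f B" by (simp add: SL2Z_def)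
qed

subsection \<open>A character of order twelve\<close>

text \<open>The closed formula for the isomorphism from the abelianization of
  $\mathrm{SL}_2(\mathbb Z)$ to $\mathbb Z/12$, normalised by $T \mapsto 1$, $S \mapsto -3$.
  Its seventh power splits off the part of the multiplier that is not of level five, since
  $-1/60 \equiv 7/12 + 2/5$ and $11/60 \equiv 7/12 + 3/5$ modulo one.\<close>

definition chi_exponent :: "int^2^2 \<Rightarrow> int" where
  "chi_exponent A = (let a = A $ 1 $ 1; b = A $ 1 $ 2; c = A $ 2 $ 1; d = A $ 2 $ 2 in
     (1 - c\<^sup>2) * (b * d + 3 * (c - 1) * d + c + 3) + c * (a + d - 3))"

lemma chi_exponent_mat2:
  "chi_exponent (mat2 a b c d) = (1 - c\<^sup>2) * (b * d + 3 * (c - 1) * d + c + 3) + c * (a + d - 3)"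
  by (simp add: chi_exponent_def)

lemma chi_exponent_cong:
  assumes "[a = a'] (mod m)" "[b = b'] (mod m)" "[c = c'] (mod m)" "[d = d'] (mod m)"
  shows "[chi_exponent (mat2 a b c d) = chi_exponent (mat2 a' b' c' d')] (mod m)"
  unfolding chi_exponent_mat2
  by (intro cong_add cong_mult cong_diff cong_pow assms cong_refl)

lemma residue_cases:
  fixes a :: int
  shows "\<exists>a' \<in> {0, 1, 2}. [a = a'] (mod 3)" "\<exists>a' \<in> {0, 1, 2, 3}. [a = a'] (mod 4)"
proof -
  have "a mod 3 = 0 \<or> a mod 3 = 1 \<or> a mod 3 = 2" by presburger
  thus "\<exists>a' \<in> {0, 1, 2}. [a = a'] (mod 3)" by (auto simp: cong_def)
  have "a mod 4 = 0 \<or> a mod 4 = 1 \<or> a mod 4 = 2 \<or> a mod 4 = 3" by presburger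
  thus "\<exists>a' \<in> {0, 1, 2, 3}. [a = a'] (mod 4)" by (auto simp: cong_def)
qed

lemma chi_step_3:
  "\<forall>a\<in>{0,1,2}. \<forall>b\<in>{0,1,2}. \<forall>c\<in>{0,1,2}. \<forall>d\<in>{0,1,2}. [a * d - b * c = 1] (mod (3::int)) \<longrightarrow>
     [chi_exponent (mat2 a (a + b) c (c + d)) = chi_exponent (mat2 a b c d) + 1] (mod 3) \<and>
     [chi_exponent (mat2 b (- a) d (- c)) = chi_exponent (mat2 a b c d) - 3] (mod 3)"
  by (simp add: chi_exponent_mat2 cong_def)

lemma chi_step_4:
  "\<forall>a\<in>{0,1,2,3}. \<forall>b\<in>{0,1,2,3}. \<forall>c\<in>{0,1,2,3}. \<forall>d\<in>{0,1,2,3}. [a * d - b * c = 1] (mod (4::int)) \<longrightarrow>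
     [chi_exponent (mat2 a (a + b) c (c + d)) = chi_exponent (mat2 a b c d) + 1] (mod 4) \<and>
     [chi_exponent (mat2 b (- a) d (- c)) = chi_exponent (mat2 a b c d) - 3] (mod 4)"
  by (simp add: chi_exponent_mat2 cong_def)

text \<open>\<open>chi_exponent\<close> is an integer polynomial in the entries, so both rules can
  be checked on residues modulo 3 and modulo 4 and then combined modulo 12.\<close>

lemma chi_exponent_step:
  fixes a b c d :: int
  assumes "a * d - b * c = 1"
  shows "[chi_exponent (mat2 a (a + b) c (c + d)) = chi_exponent (mat2 a b c d) + 1] (mod 12)"
    and "[chi_exponent (mat2 b (- a) d (- c)) = chi_exponent (mat2 a b c d) - 3] (mod 12)"
proof -
  have *: "[chi_exponent (mat2 a (a + b) c (c + d)) = chi_exponent (mat2 a b c d) + 1] (mod m) \<and>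
     [chi_exponent (mat2 b (- a) d (- c)) = chi_exponent (mat2 a b c d) - 3] (mod m)"
    if R: "\<And>x::int. \<exists>x'\<in>R. [x = x'] (mod m)"
      and step: "\<forall>a\<in>R. \<forall>b\<in>R. \<forall>c\<in>R. \<forall>d\<in>R. [a * d - b * c = 1] (mod m) \<longrightarrow>
         [chi_exponent (mat2 a (a + b) c (c + d)) = chi_exponent (mat2 a b c d) + 1] (mod m) \<and>
         [chi_exponent (mat2 b (- a) d (- c)) = chi_exponent (mat2 a b c d) - 3] (mod m)" for m R
  proof -
    obtain a' where a': "a' \<in> R" "[a = a'] (mod m)" using R by blast
    obtain b' where b': "b' \<in> R" "[b = b'] (mod m)" using R by blast
    obtain c' where c': "c' \<in> R" "[c = c'] (mod m)" using R by blast
    obtain d' where d': "d' \<in> R" "[d = d'] (mod m)" using R by blast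
    note cong = a'(2) b'(2) c'(2) d'(2)
    have "[a * d - b * c = a' * d' - b' * c'] (mod m)"
      by (intro cong_diff cong_mult cong)
    hence "[a' * d' - b' * c' = 1] (mod m)" using assms by (metis cong_sym)
    hence step': "[chi_exponent (mat2 a' (a' + b') c' (c' + d')) = chi_exponent (mat2 a' b' c' d') + 1] (mod m)"
       "[chi_exponent (mat2 b' (- a') d' (- c')) = chi_exponent (mat2 a' b' c' d') - 3] (mod m)"
      using step a'(1) b'(1) c'(1) d'(1) by blast+
    have 0: "[chi_exponent (mat2 a' b' c' d') = chi_exponent (mat2 a b c d)] (mod m)"
      by (intro chi_exponent_cong cong cong_sym[OF cong(1)] cong_sym[OF cong(2)] cong_sym[OF cong(3)] cong_sym[OF cong(4)])
    have 1: "[chi_exponent (mat2 a (a + b) c (c + d)) = chi_exponent (mat2 a' (a' + b') c' (c' + d'))] (mod m)"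
      by (intro chi_exponent_cong cong_add cong)
    have 2: "[chi_exponent (mat2 b (- a) d (- c)) = chi_exponent (mat2 b' (- a') d' (- c'))] (mod m)"
      by (intro chi_exponent_cong cong cong_minus_minus_iff[THEN iffD2])
    show ?thesis
      using cong_trans[OF 1 cong_trans[OF step'(1) cong_add[OF 0 cong_refl]]]
        cong_trans[OF 2 cong_trans[OF step'(2) cong_diff[OF 0 cong_refl]]] by blast
  qed
  have twelve: "[x = y] (mod 12)" if "[x = y] (mod 3)" "[x = y] (mod 4)" for x y :: int
    using that unfolding cong_iff_dvd_diff by presburger
  show "[chi_exponent (mat2 a (a + b) c (c + d)) = chi_exponent (mat2 a b c d) + 1] (mod 12)"
    and "[chi_exponent (mat2 b (- a) d (- c)) = chi_exponent (mat2 a b c d) - 3] (mod 12)"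
    using *[OF residue_cases(1) chi_step_3] *[OF residue_cases(2) chi_step_4] twelve by blast+
qed

lemma cis_cong:
  assumes "[x = y] (mod int n)" "n > 0"
  shows "cis (2 * pi * of_int x / real n) = cis (2 * pi * of_int y / real n)"
proof -
  obtain k where "x = y + int n * k"
    using assms(1) by (metis cong_iff_lin cong_sym)
  hence "2 * pi * of_int x / real n = 2 * pi * of_int y / real n + 2 * pi * of_int k"
    using assms(2) by (simp add: field_simps)
  hence "cis (2 * pi * of_int x / real n) = cis (2 * pi * of_int y / real n) * cis (2 * pi * of_int k)"
    by (simp only: cis_mult)
  also have "cis (2 * pi * of_int k) = 1" by (rule cis_multiple_2pi) simp
  finally show ?thesis by simp
qed

definition psi :: "int^2^2 \<Rightarrow> complex" where
  "psi A = cis (2 * pi * of_int (7 * chi_exponent A) / real 12)"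

lemma psi_nonzero: "psi A \<noteq> 0"
  by (simp add: psi_def)

lemma psi_T: "psi mat_T = cis (2 * pi * of_int 7 / real 12)"
  by (simp add: psi_def mat_T_eq chi_exponent_mat2)

lemma psi_S: "psi mat_S = \<i>"
proof -
  \<comment> \<open>7 * (-3) = -21 is congruent to 3 modulo 12.\<close>
  have "psi mat_S = cis (2 * pi * of_int 3 / real 12)"
    unfolding psi_def by (rule cis_cong) (simp_all add: mat_S_eq chi_exponent_mat2 cong_def)
  also have "2 * pi * of_int 3 / real 12 = pi / 2" by simp
  finally show ?thesis by simp
qed

lemma psi_one: "psi (mat 1) = 1"
  by (simp add: psi_def mat_eq_mat2 chi_exponent_mat2)

lemma psi_reduce_mod: "psi (reduce_mod 12 A) = psi A"
proof -
  obtain a b c d where A: "A = mat2 a b c d" by (rule mat2_cases)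
  show ?thesis
    unfolding psi_def A reduce_mod_mat2
    by (intro cis_cong cong_mult cong_refl chi_exponent_cong) (simp_all add: cong_def)
qed

lemma monoid_complex_mult_group: "monoid complex_mult_group"
  by unfold_locales (auto simp: complex_mult_group_def)

lemma monoid_GL: "monoid GL"
  by unfold_locales (auto simp: GL_def matrix_mul_assoc invertible_det_nz det_mul)

lemma psi_hom: "psi \<in> hom SL2Z complex_mult_group"
proof (rule SL2Z_homI[OF monoid_complex_mult_group])
  fix A :: "int^2^2" assume "det A = 1"
  obtain a b c d where A: "A = mat2 a b c d" by (rule mat2_cases)
  have det: "a * d - b * c = 1" using \<open>det A = 1\<close> by (simp add: A det_mat2)
  have "psi (A ** mat_T) = cis (2 * pi * of_int (7 * (chi_exponent A + 1)) / real 12)"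
    unfolding psi_def
  proof (rule cis_cong)
    show "[7 * chi_exponent (A ** mat_T) = 7 * (chi_exponent A + 1)] (mod int 12)"
      using chi_exponent_step(1)[OF det] by (intro cong_mult cong_refl) (simp add: A mat2_mult mat_T_eq)
  qed simp
  also have "\<dots> = psi A * psi mat_T"
    unfolding psi_def cis_mult by (rule arg_cong) (simp add: mat_T_eq chi_exponent_mat2 field_simps)
  finally show "psi (A ** mat_T) = psi A \<otimes>\<^bsub>complex_mult_group\<^esub> psi mat_T"
    by (simp add: complex_mult_group_def)
  have "psi (A ** mat_S) = cis (2 * pi * of_int (7 * (chi_exponent A - 3)) / real 12)"
    unfolding psi_def
  proof (rule cis_cong)
    show "[7 * chi_exponent (A ** mat_S) = 7 * (chi_exponent A - 3)] (mod int 12)"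
      using chi_exponent_step(2)[OF det] by (intro cong_mult cong_refl) (simp add: A mat2_mult mat_S_eq)
  qed simp
  also have "\<dots> = psi A * psi mat_S"
    unfolding psi_def cis_mult by (rule arg_cong) (simp add: mat_S_eq chi_exponent_mat2 field_simps)
  finally show "psi (A ** mat_S) = psi A \<otimes>\<^bsub>complex_mult_group\<^esub> psi mat_S"
    by (simp add: complex_mult_group_def)
qed (auto simp: complex_mult_group_def psi_nonzero psi_one)

subsection \<open>An explicit two-dimensional representation modulo five\<close>

definition zeta5 :: complex where "zeta5 = cis (2 * pi / 5)"

lemma zeta5_power: "zeta5 ^ k = cis (2 * pi * real k / 5)"
  unfolding zeta5_def Complex.DeMoivre by (rule arg_cong) simp

lemma cyclotomic_5: "1 + zeta5 + zeta5 ^ 2 + zeta5 ^ 3 + zeta5 ^ 4 = 0"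
proof -
  have "zeta5 ^ 5 = 1"
    unfolding zeta5_power using cis_2pi by simp
  hence "(zeta5 - 1) * (1 + zeta5 + zeta5 ^ 2 + zeta5 ^ 3 + zeta5 ^ 4) = 0"
    by (simp add: algebra_simps eval_nat_numeral)
  moreover have "zeta5 \<noteq> 1"
  proof
    assume "zeta5 = 1"
    hence "sin (2 * pi / 5) = 0" by (simp add: zeta5_def complex_eq_iff)
    moreover have "sin (2 * pi / 5) > 0" by (rule sin_gt_zero) auto
    ultimately show False by simp
  qed
  ultimately show ?thesis by simp
qed

lemma zeta5_conj_power: "zeta5 ^ 4 = cis (- (2 * pi / 5))" "zeta5 ^ 3 = cis (- (4 * pi / 5))"
proof -
  have "cis (2 * pi * real 4 / 5) = cis (- (2 * pi / 5)) * cis (2 * pi)"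
    unfolding cis_mult by (rule arg_cong) simp
  thus "zeta5 ^ 4 = cis (- (2 * pi / 5))" by (simp only: zeta5_power cis_2pi mult_1_right)
  have "cis (2 * pi * real 3 / 5) = cis (- (4 * pi / 5)) * cis (2 * pi)"
    unfolding cis_mult by (rule arg_cong) simp
  thus "zeta5 ^ 3 = cis (- (4 * pi / 5))" by (simp only: zeta5_power cis_2pi mult_1_right)
qed

lemma zeta5_square: "zeta5 ^ 2 = cis (4 * pi / 5)"
  unfolding zeta5_power by (rule arg_cong) simp

lemma sqrt5_zeta5: "of_real (sqrt 5) = zeta5 + zeta5 ^ 4 - zeta5 ^ 2 - zeta5 ^ 3"
proof -
  define r where "r = 2 * cos (2 * pi / 5) - 2 * cos (4 * pi / 5)"
  have r: "complex_of_real r = zeta5 + zeta5 ^ 4 - zeta5 ^ 2 - zeta5 ^ 3"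
    unfolding zeta5_conj_power zeta5_square unfolding zeta5_def r_def by (simp add: complex_eq_iff)
  have "(zeta5 + zeta5 ^ 4 - zeta5 ^ 2 - zeta5 ^ 3) ^ 2 = 5"
    using cyclotomic_5 by algebra
  hence "complex_of_real (r ^ 2) = of_real 5" by (simp add: r)
  hence "r ^ 2 = 5" by (simp only: of_real_eq_iff)
  moreover have "cos (4 * pi / 5) < cos (2 * pi / 5)"
    by (rule cos_monotone_0_pi) auto
  hence "r > 0" by (simp add: r_def)
  ultimately have "sqrt 5 = r" by (metis real_sqrt_unique less_imp_le)
  thus ?thesis by (simp add: r)
qed

text \<open>The entries of the required matrix at S, multiplied by -i because the character takes
  the value i there; the resulting matrix \<open>sM\<close> has determinant one.\<close>

definition alpha :: complex where "alpha = - \<i> * of_real (2 / sqrt 5 * sin (2 * pi / 5))"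
definition beta :: complex where "beta = - \<i> * of_real (2 / sqrt 5 * sin (pi / 5))"

lemma alpha_beta_zeta5:
  "5 * alpha = - (zeta5 - zeta5 ^ 4) * (zeta5 + zeta5 ^ 4 - zeta5 ^ 2 - zeta5 ^ 3)"
  "5 * beta = - (zeta5 ^ 2 - zeta5 ^ 3) * (zeta5 + zeta5 ^ 4 - zeta5 ^ 2 - zeta5 ^ 3)"
proof -
  have "5 * (2 / sqrt 5 * x) = 2 * x * sqrt 5" for x :: real
    by (simp add: real_divide_square_eq field_simps)
  hence *: "5 * (\<i> * complex_of_real (2 / sqrt 5 * x)) = 2 * \<i> * of_real x * of_real (sqrt 5)" for x
    by (metis (no_types, opaque_lifting) mult.assoc mult.commute of_real_mult of_real_numeral)
  have 1: "zeta5 - zeta5 ^ 4 = 2 * \<i> * of_real (sin (2 * pi / 5))"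
    unfolding zeta5_conj_power unfolding zeta5_def by (simp add: complex_eq_iff)
  have "sin (4 * pi / 5) = sin (pi - pi / 5)" by (rule arg_cong) simp
  also have "\<dots> = sin (pi / 5)" by (rule sin_pi_minus)
  finally have 2: "zeta5 ^ 2 - zeta5 ^ 3 = 2 * \<i> * of_real (sin (pi / 5))"
    unfolding zeta5_conj_power zeta5_square by (simp add: complex_eq_iff)
  show "5 * alpha = - (zeta5 - zeta5 ^ 4) * (zeta5 + zeta5 ^ 4 - zeta5 ^ 2 - zeta5 ^ 3)"
    using *[of "sin (2 * pi / 5)"] unfolding 1 sqrt5_zeta5[symmetric] alpha_def by simp
  show "5 * beta = - (zeta5 ^ 2 - zeta5 ^ 3) * (zeta5 + zeta5 ^ 4 - zeta5 ^ 2 - zeta5 ^ 3)"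
    using *[of "sin (pi / 5)"] unfolding 2 sqrt5_zeta5[symmetric] beta_def by simp
qed

lemma alpha_beta_products:
  "5 * alpha ^ 2 = zeta5 ^ 2 + zeta5 ^ 3 - 2"
  "5 * beta ^ 2 = zeta5 + zeta5 ^ 4 - 2"
  "5 * (alpha * beta) = zeta5 ^ 2 + zeta5 ^ 3 - zeta5 - zeta5 ^ 4"
proof -
  have "5 * (5 * alpha ^ 2) = (5 * alpha) ^ 2" "5 * (5 * beta ^ 2) = (5 * beta) ^ 2"
    "5 * (5 * (alpha * beta)) = (5 * alpha) * (5 * beta)"
    by (simp_all add: power2_eq_square)
  moreover have "(- (zeta5 - zeta5 ^ 4) * (zeta5 + zeta5 ^ 4 - zeta5 ^ 2 - zeta5 ^ 3)) ^ 2 = 5 * (zeta5 ^ 2 + zeta5 ^ 3 - 2)"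
    "(- (zeta5 ^ 2 - zeta5 ^ 3) * (zeta5 + zeta5 ^ 4 - zeta5 ^ 2 - zeta5 ^ 3)) ^ 2 = 5 * (zeta5 + zeta5 ^ 4 - 2)"
    "(- (zeta5 - zeta5 ^ 4) * (zeta5 + zeta5 ^ 4 - zeta5 ^ 2 - zeta5 ^ 3)) * 
       (- (zeta5 ^ 2 - zeta5 ^ 3) * (zeta5 + zeta5 ^ 4 - zeta5 ^ 2 - zeta5 ^ 3)) =
       5 * (zeta5 ^ 2 + zeta5 ^ 3 - zeta5 - zeta5 ^ 4)"
    using cyclotomic_5 by algebra+
  ultimately show "5 * alpha ^ 2 = zeta5 ^ 2 + zeta5 ^ 3 - 2"
    "5 * beta ^ 2 = zeta5 + zeta5 ^ 4 - 2"
    "5 * (alpha * beta) = zeta5 ^ 2 + zeta5 ^ 3 - zeta5 - zeta5 ^ 4"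
    unfolding alpha_beta_zeta5 by (metis mult_cancel_left zero_neq_numeral)+
qed

text \<open>\<open>tM y\<close>, \<open>sM\<close> and \<open>dM c\<close> are to be the images of
  T^y, S and diag(c, 1/c), the factors of the Bruhat decomposition.\<close>

definition tM :: "int \<Rightarrow> complex^2^2" where
  "tM y = mat2 (cis (2 * pi * of_int (2 * y) / real 5)) 0 0 (cis (2 * pi * of_int (3 * y) / real 5))"

definition sM :: "complex^2^2" where
  "sM = mat2 alpha beta beta (- alpha)"

text \<open>Conjugation by diag(c, 1/c) takes T to T^(c^2). For c = 2 and c = 3 this is the inverse
  of T modulo 5, so the matrix must exchange the two eigenlines of \<open>tM\<close>. The group is
  cyclic of order four, generated by the matrix for c = 2; the final branch holds the class of
  3.\<close>

definition dM :: "int \<Rightarrow> complex^2^2" where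
  "dM c = (if c mod 5 = 1 then mat2 1 0 0 1 else if c mod 5 = 4 then mat2 (-1) 0 0 (-1)
           else if c mod 5 = 2 then mat2 0 (-1) 1 0 else mat2 0 1 (-1) 0)"

lemma tM_cong: "[x = y] (mod 5) \<Longrightarrow> tM x = tM y"
  unfolding tM_def mat2_inject by (intro conjI refl cis_cong cong_mult cong_refl) auto

lemma tM_add: "tM x ** tM y = tM (x + y)"
  by (simp add: tM_def mat2_mult cis_mult) (simp add: field_simps)

lemma tM_0: "tM 0 = mat 1"
  by (simp add: tM_def mat_eq_mat2)

lemma dM_cong: "[x = y] (mod 5) \<Longrightarrow> dM x = dM y"
  by (simp add: dM_def cong_def)

lemma dM_1: "dM 1 = mat 1"
  by (simp add: dM_def mat_eq_mat2)

lemma nonzero_mod_5: "c mod 5 \<noteq> 0 \<Longrightarrow> c mod 5 = 1 \<or> c mod 5 = 2 \<or> c mod 5 = 3 \<or> c mod 5 = (4::int)"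
  by presburger

lemma dM_tM:
  assumes "c mod 5 \<noteq> 0"
  shows "dM c ** tM y = tM (c ^ 2 * y) ** dM c"
proof -
  have sq: "[c ^ 2 = k] (mod 5)" if "c mod 5 = r" "r ^ 2 mod 5 = k mod 5" for r k
    using that by (metis cong_def power_mod)
  show ?thesis
  proof (cases "c mod 5 = 1 \<or> c mod 5 = 4")
    case True
    hence "[c ^ 2 = 1] (mod 5)" using sq[of 1 1] sq[of 4 1] by auto
    hence "tM (c ^ 2 * y) = tM y"
      using cong_mult[of "c ^ 2" 1 5 y y] by (intro tM_cong) simp
    thus ?thesis using True by (auto simp: dM_def tM_def mat2_mult)
  next
    case False
    hence c: "c mod 5 = 2 \<or> c mod 5 = 3" using nonzero_mod_5[OF assms] by auto
    hence "[c ^ 2 = -1] (mod 5)" using sq[of 2 "-1"] sq[of 3 "-1"] by auto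
    hence "tM (c ^ 2 * y) = tM (- y)"
      using cong_mult[of "c ^ 2" "-1" 5 y y] by (intro tM_cong) simp
    also have "\<dots> = mat2 (cis (2 * pi * of_int (3 * y) / real 5)) 0 0 (cis (2 * pi * of_int (2 * y) / real 5))"
      unfolding tM_def mat2_inject by (intro conjI refl cis_cong) (auto simp: cong_iff_dvd_diff)
    finally show ?thesis using c by (auto simp: dM_def tM_def mat2_mult)
  qed
qed

text \<open>Image of diag(c, 1/c) S = S diag(1/c, c).\<close>

lemma dM_sM:
  assumes "c mod 5 \<noteq> 0"
  shows "dM c ** sM = sM ** dM (c ^ 3)"
proof -
  have "c ^ 3 mod 5 = (c mod 5) ^ 3 mod 5" by (simp add: power_mod)
  thus ?thesis
    using nonzero_mod_5[OF assms] by (auto simp: dM_def sM_def mat2_mult)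
qed

lemma dM_dM:
  assumes "c mod 5 \<noteq> 0" "d mod 5 \<noteq> 0"
  shows "dM c ** dM d = dM (c * d)"
proof -
  have "c * d mod 5 = (c mod 5) * (d mod 5) mod 5" by (simp add: mod_simps)
  thus ?thesis
    using nonzero_mod_5[OF assms(1)] nonzero_mod_5[OF assms(2)]
    by (elim disjE) (simp_all add: dM_def mat2_mult)
qed

lemma sM_sM: "sM ** sM = dM (-1)"
proof -
  have "5 * (alpha ^ 2 + beta ^ 2) = 5 * (-1)"
    using alpha_beta_products cyclotomic_5 by algebra
  hence "alpha ^ 2 + beta ^ 2 = -1" by (simp only: mult_cancel_left) simp
  thus ?thesis by (simp add: sM_def dM_def mat2_mult power2_eq_square algebra_simps)
qed

lemma tM_concrete:
  "tM 1 = mat2 (zeta5 ^ 2) 0 0 (zeta5 ^ 3)" "tM 2 = mat2 (zeta5 ^ 4) 0 0 zeta5"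
  "tM 3 = mat2 zeta5 0 0 (zeta5 ^ 4)" "tM 4 = mat2 (zeta5 ^ 3) 0 0 (zeta5 ^ 2)"
proof -
  have pow: "cis (2 * pi * of_int x / real 5) = zeta5 ^ k" if "[x = int k] (mod int 5)" for x k
    using cis_cong[OF that] by (simp add: zeta5_power)
  show "tM 1 = mat2 (zeta5 ^ 2) 0 0 (zeta5 ^ 3)" "tM 4 = mat2 (zeta5 ^ 3) 0 0 (zeta5 ^ 2)"
    unfolding tM_def mat2_inject by (intro conjI refl pow; simp add: cong_def)+
  have "tM 2 = mat2 (zeta5 ^ 4) 0 0 (zeta5 ^ 1)" "tM 3 = mat2 (zeta5 ^ 1) 0 0 (zeta5 ^ 4)"
    unfolding tM_def mat2_inject by (intro conjI refl pow; simp add: cong_def)+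
  thus "tM 2 = mat2 (zeta5 ^ 4) 0 0 zeta5" "tM 3 = mat2 zeta5 0 0 (zeta5 ^ 4)"
    by simp_all
qed

lemma five_cancel: "5 * x = 5 * y \<Longrightarrow> x = (y :: complex)"
  by simp

lemma braid_concrete:
  "tM 1 ** sM ** tM 1 ** sM = sM ** tM 4 ** mat2 1 0 0 1"
  "tM 3 ** sM ** tM 2 ** sM = sM ** tM 3 ** mat2 0 (-1) 1 0"
  "tM 2 ** sM ** tM 3 ** sM = sM ** tM 2 ** mat2 0 1 (-1) 0"
  "tM 4 ** sM ** tM 4 ** sM = sM ** tM 1 ** mat2 (-1) 0 0 (-1)"
  \<comment> \<open>The four lines are \<open>braid\<close> for y = 1, 2, 3, 4. Multiplying every
    entry by 5 clears the denominators of \<open>alpha\<close>, \<open>beta\<close> and their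
    products, leaving polynomial identities modulo the cyclotomic relation.\<close>
  unfolding tM_concrete sM_def mat2_mult mat2_inject
  by (intro conjI; rule five_cancel; use alpha_beta_products alpha_beta_zeta5 cyclotomic_5 in algebra)+

text \<open>Image of T^(1/y) S T^y S = S T^(-y) diag(y, 1/y); it merges two factors S into
  one.\<close>

lemma braid:
  assumes "y mod 5 \<noteq> 0"
  shows "tM (y ^ 3) ** sM ** tM y ** sM = sM ** tM (- y) ** dM y"
proof -
  have *: "tM (y ^ 3) = tM (r ^ 3 mod 5)" "tM y = tM r" "tM (- y) = tM (- r mod 5)" if "y mod 5 = r" for r
  proof -
    have y: "[y = r] (mod 5)" using that by (auto simp: cong_def)
    have "[y ^ 3 = r ^ 3] (mod 5)" "[- y = - r] (mod 5)"
      using y by (auto intro: cong_pow simp: cong_minus_minus_iff)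
    thus "tM (y ^ 3) = tM (r ^ 3 mod 5)" "tM y = tM r" "tM (- y) = tM (- r mod 5)"
      using y by (auto intro!: tM_cong simp: cong_def)
  qed
  from nonzero_mod_5[OF assms] show ?thesis
    by (elim disjE) (simp_all add: * dM_def braid_concrete)
qed

text \<open>Bruhat decomposition modulo five, with $c^3$ as the inverse of $c$: for $c \neq 0$ one has
  $\gamma = T^{a/c} \, S \, \mathrm{diag}(c, 1/c) \, T^{d/c}$, and
  $\gamma = \mathrm{diag}(a, 1/a) \, T^{bd}$ otherwise.\<close>

definition rep5 :: "int^2^2 \<Rightarrow> complex^2^2" where
  "rep5 A = (let a = A $ 1 $ 1; b = A $ 1 $ 2; c = A $ 2 $ 1; d = A $ 2 $ 2 in
     if c mod 5 = 0 then dM a ** tM (b * d)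
     else tM (a * c ^ 3) ** sM ** dM c ** tM (d * c ^ 3))"

lemma rep5_mat2:
  "rep5 (mat2 a b c d) = (if c mod 5 = 0 then dM a ** tM (b * d)
     else tM (a * c ^ 3) ** sM ** dM c ** tM (d * c ^ 3))"
  by (simp add: rep5_def)

lemma rep5_T: "rep5 mat_T = tM 1" and rep5_S: "rep5 mat_S = sM" and rep5_one: "rep5 (mat 1) = mat 1"
  by (simp_all add: mat_T_eq mat_S_eq mat_eq_mat2[of "1 :: int"] rep5_mat2 dM_1 tM_0 matrix_mul_lid matrix_mul_rid)

lemma rep5_reduce_mod: "rep5 (reduce_mod 5 A) = rep5 A"
proof -
  obtain a b c d where A: "A = mat2 a b c d" by (rule mat2_cases)
  have cong: "[x mod 5 = x] (mod 5)" for x :: int by (simp add: cong_def)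
  have 1: "dM (x mod 5) = dM x" for x by (intro dM_cong cong)
  have 2: "tM ((b mod 5) * (d mod 5)) = tM (b * d)" by (intro tM_cong cong_mult cong)
  have 3: "tM ((x mod 5) * (c mod 5) ^ 3) = tM (x * c ^ 3)" for x by (intro tM_cong cong_mult cong_pow cong)
  show ?thesis unfolding A reduce_mod_mat2 rep5_mat2 by (simp add: 1 2 3)
qed

lemma det_rep5: "det (rep5 A) = 1"
proof -
  have "det (tM y) = 1" for y
  proof -
    have sum: "2 * pi * of_int (2 * y) / real 5 + 2 * pi * of_int (3 * y) / real 5 = 2 * pi * of_int y"
      by (simp add: field_simps)
    have "det (tM y) = cis (2 * pi * of_int y)"
      unfolding tM_def det_mat2 cis_mult sum by (simp only: mult_zero_left diff_zero)
    thus ?thesis by (simp only: cis_multiple_2pi Ints_of_int)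
  qed
  moreover have "det (dM c) = 1" for c by (simp add: dM_def det_mat2)
  moreover have "det sM = 1"
  proof -
    have "(sM ** sM) $ 1 $ 1 = -1" unfolding sM_sM by (simp add: dM_def)
    thus ?thesis by (simp add: sM_def mat2_mult det_mat2) (metis add.commute minus_diff_minus minus_minus uminus_add_conv_diff)
  qed
  ultimately show ?thesis by (simp add: rep5_def Let_def det_mul)
qed

lemma power4_mod_5: "c mod 5 \<noteq> 0 \<Longrightarrow> [c ^ 4 = 1] (mod (5 :: int))"
proof -
  assume "c mod 5 \<noteq> 0"
  moreover have "c ^ 4 mod 5 = (c mod 5) ^ 4 mod 5" by (simp add: power_mod)
  ultimately show ?thesis using nonzero_mod_5[of c] by (auto simp: cong_def)
qed

lemma rep5_mult_T:
  assumes "a * d - b * c = 1"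
  shows "rep5 (mat2 a (a + b) c (c + d)) = rep5 (mat2 a b c d) ** tM 1"
proof (cases "c mod 5 = 0")
  case True
  hence c: "[c = 0] (mod 5)" by (simp add: cong_def)
  have "(a + b) * (c + d) = b * d + 1 + c * (a + 2 * b)"
    using assms by (simp add: algebra_simps)
  moreover have "[b * d + 1 + c * (a + 2 * b) = b * d + 1 + 0 * (a + 2 * b)] (mod 5)"
    by (intro cong_add cong_mult cong_refl c)
  ultimately have "tM ((a + b) * (c + d)) = tM (b * d + 1)"
    by (intro tM_cong) simp
  thus ?thesis using True by (simp add: rep5_mat2 tM_add flip: matrix_mul_assoc)
next
  case False
  have "[c ^ 4 + d * c ^ 3 = 1 + d * c ^ 3] (mod 5)"
    by (intro cong_add cong_refl power4_mod_5 False)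
  hence "tM ((c + d) * c ^ 3) = tM (d * c ^ 3 + 1)"
    by (intro tM_cong) (simp add: algebra_simps eval_nat_numeral)
  thus ?thesis using False by (simp add: rep5_mat2 tM_add flip: matrix_mul_assoc)
qed

text \<open>The cases follow the Bruhat cells. If c = 0, moving diag(a, 1/a) to the right of S leads
  into the big cell. If c is invertible and d = 0, the two S become adjacent and S^2 = -1 leads back
  to the small cell. If both are invertible, \<open>braid\<close> with y = cd stays in the big
  cell.\<close>

lemma rep5_mult_S:
  assumes det: "a * d - b * c = 1"
  shows "rep5 (mat2 b (- a) d (- c)) = rep5 (mat2 a b c d) ** sM"
proof (cases "c mod 5 = 0")
  case True
  hence c: "[c = 0] (mod 5)" by (simp add: cong_def)
  have ad: "[a * d = 1] (mod 5)"
  proof -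
    have "[a * d - b * c = a * d - b * 0] (mod 5)" by (intro cong_diff cong_mult cong_refl c)
    thus ?thesis using det by (simp add: cong_sym)
  qed
  have a: "a mod 5 \<noteq> 0" and d: "d mod 5 \<noteq> 0"
  proof -
    have "\<not> 5 dvd a * d" using ad by (metis cong_dvd_iff dvd_refl odd_one one_dvd zdvd1_eq abs_numeral numeral_eq_one_iff semiring_norm(84))
    thus "a mod 5 \<noteq> 0" "d mod 5 \<noteq> 0" by (auto simp: mod_eq_0_iff_dvd)
  qed
  have da: "[d = a ^ 3] (mod 5)"
  proof -
    have "[a ^ 4 * d = 1 * d] (mod 5)" by (intro cong_mult cong_refl power4_mod_5 a)
    moreover have "[a ^ 3 * (a * d) = a ^ 3 * 1] (mod 5)" by (intro cong_mult cong_refl ad)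
    moreover have "a ^ 4 * d = a ^ 3 * (a * d)" by (simp add: eval_nat_numeral)
    ultimately show ?thesis by (metis cong_sym cong_trans mult_1 mult_1_right)
  qed
  have "rep5 (mat2 a b c d) ** sM = dM a ** tM (b * d) ** sM" using True by (simp add: rep5_mat2)
  also have "\<dots> = tM (a ^ 2 * (b * d)) ** (dM a ** sM)"
    by (simp add: dM_tM[OF a] matrix_mul_assoc)
  also have "\<dots> = tM (a ^ 2 * (b * d)) ** sM ** dM (a ^ 3)"
    by (simp add: dM_sM[OF a] matrix_mul_assoc)
  also have "dM (a ^ 3) = dM d" by (intro dM_cong cong_sym[OF da])
  also have "tM (a ^ 2 * (b * d)) = tM (b * d ^ 3)"
  proof (rule tM_cong)
    have "[a ^ 2 * (b * d) * 1 = a ^ 2 * (b * d) * d ^ 4] (mod 5)"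
      by (intro cong_mult cong_refl cong_sym[OF power4_mod_5[OF d]])
    also have "a ^ 2 * (b * d) * d ^ 4 = (a * d) ^ 2 * (b * d ^ 3)" by (simp add: eval_nat_numeral)
    also have "[(a * d) ^ 2 * (b * d ^ 3) = 1 ^ 2 * (b * d ^ 3)] (mod 5)"
      by (intro cong_mult cong_pow cong_refl ad)
    finally show "[a ^ 2 * (b * d) = b * d ^ 3] (mod 5)" by simp
  qed
  also have "tM (b * d ^ 3) ** sM ** dM d = tM (b * d ^ 3) ** sM ** dM d ** tM (- c * d ^ 3)"
  proof -
    have "[- c * d ^ 3 = - 0 * d ^ 3] (mod 5)"
      using c by (intro cong_mult cong_refl) (simp add: cong_0_iff)
    hence "tM (- c * d ^ 3) = mat 1" using tM_cong[of "- c * d ^ 3" 0] tM_0 by simp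
    thus ?thesis by (simp add: matrix_mul_rid)
  qed
  also have "\<dots> = rep5 (mat2 b (- a) d (- c))" using d by (simp add: rep5_mat2)
  finally show ?thesis ..
next
  case False
  note c = False
  have S: "rep5 (mat2 a b c d) ** sM = tM (a * c ^ 3) ** sM ** tM (d * c) ** sM ** dM (c ^ 3)"
  proof -
    have "rep5 (mat2 a b c d) ** sM = tM (a * c ^ 3) ** sM ** (dM c ** tM (d * c ^ 3)) ** sM"
      using c by (simp add: rep5_mat2 matrix_mul_assoc)
    also have "\<dots> = tM (a * c ^ 3) ** sM ** tM (c ^ 2 * (d * c ^ 3)) ** (dM c ** sM)"
      by (simp add: dM_tM[OF c] matrix_mul_assoc)
    also have "\<dots> = tM (a * c ^ 3) ** sM ** tM (c ^ 2 * (d * c ^ 3)) ** sM ** dM (c ^ 3)"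
      by (simp add: dM_sM[OF c] matrix_mul_assoc)
    also have "tM (c ^ 2 * (d * c ^ 3)) = tM (d * c)"
    proof (rule tM_cong)
      have "[c ^ 4 * (d * c) = 1 * (d * c)] (mod 5)" by (intro cong_mult cong_refl power4_mod_5 c)
      thus "[c ^ 2 * (d * c ^ 3) = d * c] (mod 5)" by (simp add: eval_nat_numeral mult_ac)
    qed
    finally show ?thesis .
  qed
  have c3: "c ^ 3 mod 5 \<noteq> 0"
    using nonzero_mod_5[OF c] by (auto simp: power_mod[symmetric, of c])
  show ?thesis
  proof (cases "d mod 5 = 0")
    case True
    hence d: "[d = 0] (mod 5)" by (simp add: cong_def)
    have bc: "[b * c = -1] (mod 5)"
    proof -
      have "[a * d - b * c = a * 0 - b * c] (mod 5)" by (intro cong_diff cong_mult cong_refl d)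
      hence "[- 1 = b * c] (mod 5)"
        unfolding det using cong_minus_minus_iff[of 1 "- (b * c)" 5] by simp
      thus ?thesis by (rule cong_sym)
    qed
    have "b * c mod 5 \<noteq> 0" using bc by (auto simp: cong_def)
    hence b: "b mod 5 \<noteq> 0" by (auto simp: mod_eq_0_iff_dvd)
    have "tM (d * c) = mat 1"
      using tM_cong[of "d * c" 0] tM_0 cong_mult[OF d cong_refl, of c] by simp
    hence "rep5 (mat2 a b c d) ** sM = tM (a * c ^ 3) ** (sM ** sM) ** dM (c ^ 3)"
      unfolding S by (simp add: matrix_mul_assoc matrix_mul_rid)
    also have "\<dots> = tM (a * c ^ 3) ** dM (- 1 * c ^ 3)"
      unfolding sM_sM by (subst matrix_mul_assoc[symmetric], subst dM_dM) (use c3 in auto)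
    also have "dM (- 1 * c ^ 3) = dM b"
    proof (rule dM_cong)
      have "[b * c * c ^ 3 = -1 * c ^ 3] (mod 5)" by (intro cong_mult cong_refl bc)
      moreover have "[b * c ^ 4 = b * 1] (mod 5)" by (intro cong_mult cong_refl power4_mod_5 c)
      moreover have "b * c * c ^ 3 = b * c ^ 4" by (simp add: eval_nat_numeral)
      ultimately show "[- 1 * c ^ 3 = b] (mod 5)" by (metis cong_sym cong_trans mult_1_right)
    qed
    also have "tM (a * c ^ 3) = tM (b ^ 2 * (a * c))"
    proof (rule tM_cong)
      have "[a * c ^ 3 * (b * c) ^ 2 = a * c ^ 3 * (-1) ^ 2] (mod 5)"
        by (intro cong_mult cong_pow cong_refl bc)
      moreover have "[b ^ 2 * (a * c) * c ^ 4 = b ^ 2 * (a * c) * 1] (mod 5)"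
        by (intro cong_mult cong_refl power4_mod_5 c)
      moreover have "a * c ^ 3 * (b * c) ^ 2 = b ^ 2 * (a * c) * c ^ 4"
        by (simp add: eval_nat_numeral mult_ac)
      ultimately show "[a * c ^ 3 = b ^ 2 * (a * c)] (mod 5)"
        using cong_sym cong_trans by fastforce
    qed
    also have "tM (b ^ 2 * (a * c)) ** dM b = dM b ** tM (a * c)" by (rule dM_tM[OF b, symmetric])
    also have "\<dots> = rep5 (mat2 b (- a) d (- c))" using True by (simp add: rep5_mat2)
    finally show ?thesis ..
  next
    case d: False
    have cd: "(d * c) mod 5 \<noteq> 0"
      using nonzero_mod_5[OF c] nonzero_mod_5[OF d] by (auto simp: mod_mult_eq[symmetric, of d c])
    \<comment> \<open>In fractions modulo 5: a/c - 1/(cd) = (ad - 1)/(cd) = b/d.\<close>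
    have exp: "tM (a * c ^ 3 - (d * c) ^ 3) = tM (b * d ^ 3)"
    proof (rule tM_cong)
      have "[b * d ^ 3 * 1 = b * d ^ 3 * c ^ 4] (mod 5)"
        by (intro cong_mult cong_refl cong_sym[OF power4_mod_5[OF c]])
      also have "b * d ^ 3 * c ^ 4 = (b * c) * (d * c) ^ 3" by (simp add: eval_nat_numeral mult_ac)
      also have "b * c = a * d - 1" using det by simp
      also have "(a * d - 1) * (d * c) ^ 3 = a * c ^ 3 * d ^ 4 - (d * c) ^ 3"
        by (simp add: eval_nat_numeral algebra_simps)
      also have "[a * c ^ 3 * d ^ 4 - (d * c) ^ 3 = a * c ^ 3 * 1 - (d * c) ^ 3] (mod 5)"
        by (intro cong_mult cong_diff cong_refl power4_mod_5 d)
      finally show "[a * c ^ 3 - (d * c) ^ 3 = b * d ^ 3] (mod 5)" by (simp add: cong_sym_eq)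
    qed
    \<comment> \<open>T^(1/(cd)) is split off from T^(a/c) to expose the left side of
      \<open>braid\<close>.\<close>
    have "rep5 (mat2 a b c d) ** sM = 
       tM (a * c ^ 3 - (d * c) ^ 3) ** (tM ((d * c) ^ 3) ** sM ** tM (d * c) ** sM) ** dM (c ^ 3)"
      unfolding S matrix_mul_assoc tM_add by simp
    also have "\<dots> = tM (b * d ^ 3) ** sM ** tM (- (d * c)) ** (dM (d * c) ** dM (c ^ 3))"
      unfolding braid[OF cd] exp by (simp add: matrix_mul_assoc)
    also have "dM (d * c) ** dM (c ^ 3) = dM d"
      unfolding dM_dM[OF cd c3]
    proof (rule dM_cong)
      have "[d * c ^ 4 = d * 1] (mod 5)" by (intro cong_mult cong_refl power4_mod_5 c)
      thus "[d * c * c ^ 3 = d] (mod 5)" by (simp add: eval_nat_numeral mult_ac)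
    qed
    also have "tM (- (d * c)) = tM (d ^ 2 * (- c * d ^ 3))"
    proof (rule tM_cong)
      have "[- (d * c) * 1 = - (d * c) * d ^ 4] (mod 5)"
        by (intro cong_mult cong_refl cong_sym[OF power4_mod_5[OF d]])
      thus "[- (d * c) = d ^ 2 * (- c * d ^ 3)] (mod 5)" by (simp add: eval_nat_numeral mult_ac)
    qed
    also have "tM (b * d ^ 3) ** sM ** tM (d ^ 2 * (- c * d ^ 3)) ** dM d =
       tM (b * d ^ 3) ** sM ** dM d ** tM (- c * d ^ 3)"
      by (simp only: matrix_mul_assoc[symmetric] dM_tM[OF d])
    also have "\<dots> = rep5 (mat2 b (- a) d (- c))" using d by (simp add: rep5_mat2)
    finally show ?thesis ..
  qed
qed

lemma rep5_hom: "rep5 \<in> hom SL2Z GL"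
proof (rule SL2Z_homI[OF monoid_GL])
  fix A :: "int^2^2" assume "det A = 1"
  obtain a b c d where A: "A = mat2 a b c d" by (rule mat2_cases)
  have det: "a * d - b * c = 1" using \<open>det A = 1\<close> by (simp add: A det_mat2)
  show "rep5 (A ** mat_T) = rep5 A \<otimes>\<^bsub>GL\<^esub> rep5 mat_T"
    using rep5_mult_T[OF det] by (simp add: A mat_T_eq mat2_mult GL_def rep5_T[unfolded mat_T_eq])
  show "rep5 (A ** mat_S) = rep5 A \<otimes>\<^bsub>GL\<^esub> rep5 mat_S"
    using rep5_mult_S[OF det] by (simp add: A mat_S_eq mat2_mult GL_def rep5_S[unfolded mat_S_eq])
qed (simp_all add: GL_def invertible_det_nz det_rep5 rep5_one)

section \<open>The multiplier and the transformation law for the full modular group\<close>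

definition rr_rho :: "int^2^2 \<Rightarrow> complex^2^2" where
  "rr_rho A = mat (psi A) ** rep5 A"

lemma mat_commute: "mat k ** A = A ** mat (k :: complex)" for A :: "complex^2^2"
proof -
  obtain a b c d where A: "A = mat2 a b c d" by (rule mat2_cases)
  show ?thesis by (simp add: A mat_eq_mat2 mat2_mult mult.commute)
qed

lemma rr_rho_hom: "rr_rho \<in> hom SL2Z GL"
proof (rule homI)
  fix A assume "A \<in> carrier SL2Z"
  show "rr_rho A \<in> carrier GL"
    by (simp add: GL_def rr_rho_def invertible_det_nz det_mul det_rep5 mat_eq_mat2 det_mat2 psi_nonzero)
next
  fix A B assume AB: "A \<in> carrier SL2Z" "B \<in> carrier SL2Z"
  have "psi (A ** B) = psi A * psi B" "rep5 (A ** B) = rep5 A ** rep5 B"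
    using hom_mult[OF psi_hom AB] hom_mult[OF rep5_hom AB] by (simp_all add: SL2Z_def GL_def complex_mult_group_def)
  moreover have "mat (psi A * psi B) = (mat (psi A) ** mat (psi B) :: complex^2^2)"
    by (simp add: mat_eq_mat2 mat2_mult)
  ultimately have "rr_rho (A ** B) = mat (psi A) ** (mat (psi B) ** rep5 A) ** rep5 B"
    by (simp add: rr_rho_def matrix_mul_assoc)
  also have "\<dots> = rr_rho A ** rr_rho B"
    unfolding mat_commute[of "psi B"] by (simp add: rr_rho_def matrix_mul_assoc)
  finally show "rr_rho (A \<otimes>\<^bsub>SL2Z\<^esub> B) = rr_rho A \<otimes>\<^bsub>GL\<^esub> rr_rho B"
    by (simp add: SL2Z_def GL_def)
qed

lemma rr_rho_level: "has_level 5 rr_rho"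
  unfolding has_level_def
proof (intro exI conjI ballI)
  show "(12::nat) > 0" by simp
  show "factors_through_SL2_mod complex_mult_group 12 psi"
    by (intro factors_through_SL2_modI psi_hom psi_reduce_mod) simp
  show "factors_through_SL2_mod GL 5 rep5"
    by (intro factors_through_SL2_modI rep5_hom rep5_reduce_mod) simp
  show "rr_rho \<gamma> = mat (psi \<gamma>) ** rep5 \<gamma>" for \<gamma> by (rule rr_rho_def)
qed

lemma rr_rho_T: "rr_rho mat_T = rr_rho_T"
proof -
  have "cis (2 * pi * of_int 7 / real 12) * cis (2 * pi * of_int 2 / real 5) = cis (2 * pi * of_int 59 / real 60)"
    unfolding cis_mult by (rule arg_cong) simp
  also have "\<dots> = cis (2 * pi * of_int (-1) / real 60)" by (rule cis_cong) (simp_all add: cong_def)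
  finally have 1: "cis (2 * pi * of_int 7 / real 12) * cis (2 * pi * of_int 2 / real 5) = exp (- (2 * of_real pi * \<i> / 60))"
    by (simp add: cis_conv_exp mult_ac)
  have "cis (2 * pi * of_int 7 / real 12) * cis (2 * pi * of_int 3 / real 5) = cis (2 * pi * of_int 71 / real 60)"
    unfolding cis_mult by (rule arg_cong) simp
  also have "\<dots> = cis (2 * pi * of_int 11 / real 60)" by (rule cis_cong) (simp_all add: cong_def)
  finally have 2: "cis (2 * pi * of_int 7 / real 12) * cis (2 * pi * of_int 3 / real 5) = exp (11 * (2 * of_real pi * \<i> / 60))"
    by (simp add: cis_conv_exp mult_ac)
  have "rr_rho_T = mat2 (exp (- (2 * of_real pi * \<i> / 60))) 0 0 (exp (11 * (2 * of_real pi * \<i> / 60)))"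
    by (simp add: rr_rho_T_def mat2_def)
  also have "\<dots> = mat2 (psi mat_T) 0 0 (psi mat_T) ** tM 1"
    unfolding psi_T tM_def mat2_mult using 1 2 by simp
  finally show ?thesis by (simp add: rr_rho_def rep5_T mat_eq_mat2)
qed

lemma rr_rho_S: "rr_rho mat_S = rr_rho_S"
proof -
  have "rr_rho_S = mat (of_real (2 / sqrt 5)) ** mat2 (of_real (sin (2 * pi / 5))) (of_real (sin (pi / 5)))
     (of_real (sin (pi / 5))) (- of_real (sin (2 * pi / 5)))"
    by (simp add: rr_rho_S_def mat2_def)
  also have "\<dots> = mat \<i> ** sM"
    unfolding mat_eq_mat2 mat2_mult sM_def alpha_def beta_def by (simp add: mult_ac)
  finally show ?thesis by (simp add: rr_rho_def psi_S rep5_S)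
qed

lemma mat2_vector_mult:
  fixes a b c d x y :: complex
  shows "mat2 a b c d *v vector [x, y] = vector [a * x + b * y, c * x + d * y]"
  by (simp add: vec_eq_iff forall_2 matrix_vector_mult_def sum_2)

lemma rr_vec_T: "rr_vec (\<tau> + 1) = rr_rho mat_T *v rr_vec \<tau>"
proof -
  have eq: "rr_rho_T = mat2 (exp (- (2 * of_real pi * \<i> / 60))) 0 0 (exp (11 * (2 * of_real pi * \<i> / 60)))"
    by (simp add: rr_rho_T_def mat2_def)
  show ?thesis unfolding rr_rho_T rr_vec_def eq mat2_vector_mult rr_translation by simp
qed

lemma rr_vec_S:
  assumes "\<tau> \<in> upper_half_plane"
  shows "rr_vec (-1 / \<tau>) = rr_rho mat_S *v rr_vec \<tau>"
proof -
  have eq: "rr_rho_S = mat (of_real (2 / sqrt 5)) ** mat2 (of_real (sin (2 * pi / 5))) (of_real (sin (pi / 5)))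
     (of_real (sin (pi / 5))) (- of_real (sin (2 * pi / 5)))"
    by (simp add: rr_rho_S_def mat2_def)
  show ?thesis
    unfolding rr_rho_S rr_vec_def rr_inversion[OF assms] eq mat_eq_mat2 mat2_mult mat2_vector_mult
    by (simp add: ring_distribs mult.assoc)
qed

text \<open>A generator multiplied on the right acts on tau first, so the induction hypothesis is
  used at tau + 1 or -1/tau; this is why tau stays arbitrary.\<close>

lemma rr_vec_moebius:
  assumes "det A = 1" and "\<tau> \<in> upper_half_plane"
  shows "rr_vec (moebius_act A \<tau>) = rr_rho A *v rr_vec \<tau>"
proof -
  have gen: "mat_T \<in> carrier SL2Z" "mat_S \<in> carrier SL2Z"
    by (simp_all add: SL2Z_carrier mat_T_eq mat_S_eq det_mat2)
  have rho_mult: "rr_rho (A ** B) = rr_rho A ** rr_rho B" if "det A = 1" "B \<in> carrier SL2Z" for A B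
    using hom_mult[OF rr_rho_hom, of A B] that by (simp add: SL2Z_def GL_def)
  from assms show ?thesis
  proof (induction arbitrary: \<tau> rule: SL2Z_induct)
    case one
    have "rr_rho (mat 1) = mat 1" by (simp add: rr_rho_def psi_one rep5_one)
    moreover have "moebius_act (mat 1) \<tau> = \<tau>" by (simp add: moebius_act_def mat_def)
    ultimately show ?case by simp
  next
    case (T B)
    have \<tau>: "\<tau> + 1 \<in> upper_half_plane" using T.prems by (simp add: upper_half_plane_def)
    obtain a b c d where B: "B = mat2 a b c d" by (rule mat2_cases)
    have "moebius_act (B ** mat_T) \<tau> = moebius_act B (\<tau> + 1)"
      by (simp add: B mat_T_eq mat2_mult moebius_act_def algebra_simps)
    thus ?case using T.IH[OF \<tau>] rr_vec_T rho_mult[OF T.hyps(1) gen(1)]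
      by (simp add: matrix_vector_mul_assoc)
  next
    case (S B)
    have \<tau>: "-1 / \<tau> \<in> upper_half_plane" using S.prems by (rule minus_inverse_upper_half_plane)
    have nz: "\<tau> \<noteq> 0" using S.prems by (auto simp: upper_half_plane_def)
    obtain a b c d where B: "B = mat2 a b c d" by (rule mat2_cases)
    have "moebius_act B (-1 / \<tau>) = ((of_int a * (-1 / \<tau>) + of_int b) * \<tau>) / ((of_int c * (-1 / \<tau>) + of_int d) * \<tau>)"
      using nz by (simp add: B moebius_act_def)
    also have "\<dots> = moebius_act (B ** mat_S) \<tau>"
      using nz by (simp add: B mat_S_eq mat2_mult moebius_act_def ring_distribs)
    finally show ?case using S.IH[OF \<tau>] rr_vec_S[OF S.prems] rho_mult[OF S.hyps(1) gen(2)]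
      by (simp add: matrix_vector_mul_assoc)
  qed
qed

theorem theorem1:
  "\<exists>\<rho> :: int^2^2 \<Rightarrow> complex^2^2.
     vv_modular_function 5 \<rho> rr_vec \<and>
     \<rho> mat_T = rr_rho_T \<and> \<rho> mat_S = rr_rho_S \<and>
     (\<forall>\<tau> \<in> upper_half_plane.
        rr_vec (\<tau> + 1) = \<rho> mat_T *v rr_vec \<tau> \<and>
        rr_vec (- 1 / \<tau>) = \<rho> mat_S *v rr_vec \<tau>)"
proof (intro exI[of _ rr_rho] conjI ballI)
  show "vv_modular_function 5 rr_rho rr_vec"
    unfolding vv_modular_function_def
    by (auto simp: rr_rho_hom rr_rho_level SL2Z_carrier rr_vec_moebius)
qed (simp_all only: rr_rho_T rr_rho_S rr_vec_T rr_vec_S)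

end
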